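(* Let $\alpha>0$ and let $\phi\in\mathcal S(\mathbb R^d)$ be real-valued, even, $\|\phi\|_{L^2}=1$, with $\widehat\phi\in C_c^\infty(\mathbb R^d)$, and suppose there are constants $0<R_0<R_1<\infty$, $m_0>0$ with $R_0>3\cdot 2^{\max\{\alpha-1,0\}}$, $\operatorname{supp}\widehat\phi\subset B(0,R_1)$ and $|\widehat\phi(\zeta)|\ge m_0$ for $|\zeta|\le R_0$. Then there exists a scale $\rho_\ast\in(0,\rho_0]$ such that the subdyadic lattice $\Omega_\alpha=\{(x_j^k,\xi_k):k\in\mathbb N,\ j\in\mathbb Z^d\}$ constructed at scale $\rho_\ast$ (see context), with frequency balls $\{B_k\}$, has the following property. Define, for $(x,\xi)\in\mathbb R^d\times(\mathbb R^d\setminus\{0\})$, $$\psi_{x,\xi}(t)=|\xi|^{\frac d2(1-\alpha)}\,\phi\bigl((t-x)|\xi|^{1-\alpha}\bigr)e^{it\cdot\xi},\qquad t\in\mathbb R^d .$$ Then the system $\mathcal G_\alpha(\phi)=\{\psi_{x_j^k,\xi_k}:(x_j^k,\xi_k)\in\Omega_\alpha\}$ is a frame for $L^2(\mathbb R^d)$: there exist constants $0<A\le B<\infty$, depending only on $(d,\alpha)$, on $\phi$, and on the overlap constants of $\{B_k\}$ and $\Omega_\alpha$, such that $$A\|f\|_{L^2}^2\le\sum_k\sum_{j\in\mathbb Z^d}|\langle f,\psi_{x_j^k,\xi_k}\rangle|^2\le B\|f\|_{L^2}^2,\qquad f\in L^2(\mathbb R^d).$$ Moreover, the canonical dual family $\{\widetilde\psi_{x_j^k,\xi_k}\}$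 is intrinsically localized with respect to the subdyadic geometry, i.e. for every $N>0$ there is $C_N<\infty$ such that for all $w,z\in\Omega_\alpha$ $$|\langle\widetilde\psi_w,\widetilde\psi_z\rangle|+|\langle\widetilde\psi_w,\psi_z\rangle|\le C_N(1+\mathbf d_\alpha(w,z))^{-N},$$ and it provides the reconstruction formula $$f=\sum_k\sum_{j\in\mathbb Z^d}\langle f,\psi_{x_j^k,\xi_k}\rangle\,\widetilde\psi_{x_j^k,\xi_k}$$ with convergence in $L^2$, for every $f\in L^2(\mathbb R^d)$.
   Context: Conventions: $\widehat f(\eta)=\int_{\mathbb R^d}f(t)e^{-it\cdot\eta}\,dt$, $\langle f,g\rangle=\int f\overline g$, and $B(c,r)$ is the Euclidean ball of center $c$ and radius $r$. Subdyadic lattice at scale $\rho\in(0,\rho_0]$. Here $\rho_0>0$ and $a>0$ are fixed sufficiently small constants and $b>0$ is a fixed constant, all depending only on $d,\alpha$. For $n\in\mathbb N_0$ let $A_n=\{\xi\in\mathbb R^d:2^n\le|\xi|<2^{n+1}\}$ and $h_n=\rho 2^{n(1-\alpha)}$. Partition $\mathbb R^d$ into half-open cubes of side $h_n$ and from each cube meeting $A_n$ choose one point of the intersection; this gives a candidate set $\mathcal C_n\subset A_n$. Order $\bigcup_n\mathcal C_n$ first by $n$ and arbitrarily inside each annulus; process candidates in this order, retaining a candidate $\xi$ exactly when the ball $\{\eta:|\eta-\xi|<a\rho|\xi|^{1-\alpha}\}$ is disjoint from all such balls of previously retained candidates. Enumerate the retained points as $\{\xi_k\}_{k\in\mathbb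 N}$ and set $x_j^k=b\rho|\xi_k|^{\alpha-1}j$, $j\in\mathbb Z^d$. The lattice is $\Omega_\alpha=\{(x_j^k,\xi_k)\}$. The associated balls are $B_k=\{\eta:|\eta-\xi_k|\le A_{\mathrm{cov}}\rho|\xi_k|^{1-\alpha}\}$, where $A_{\mathrm{cov}}>1$ is a constant depending only on $d,\alpha$ such that these balls cover $\{|\eta|\ge1\}$ (for every $\rho\in(0,\rho_0]$); they have uniformly bounded overlap. Adapted separation function: for $w=(x,\xi)$, $z=(y,\eta)$ with $\xi,\eta\ne0$, put $r(w,z)=1+\min\{|\xi|,|\eta|\}$ and $\mathbf d_\alpha(w,z)=r(w,z)^{1-\alpha}|x-y|+r(w,z)^{\alpha-1}|\xi-\eta|$. Canonical dual: $\widetilde\psi_w=S^{-1}\psi_w$, where $Sf=\sum_{w\in\Omega_\alpha}\langle f,\psi_w\rangle\psi_w$ is the frame operator. *)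

theory Defs
  imports "HOL-Analysis.Analysis"
begin

section \<open>Smooth and Schwartz functions\<close>

text \<open>
  Mixed partial derivatives are indexed by lists of directions instead of multi-indices.
  Requiring every iterated partial derivative to be (Frechet) differentiable everywhere
  is the same as being infinitely differentiable, and excludes junk values of
  \<^const>\<open>frechet_derivative\<close>.
\<close>

primrec iter_partial ::
  "'d::finite list \<Rightarrow> (real^'d \<Rightarrow> 'b::real_normed_vector) \<Rightarrow> real^'d \<Rightarrow> 'b" where
  "iter_partial [] f = f"
| "iter_partial (i # ds) f = (\<lambda>x. frechet_derivative (iter_partial ds f) (at x) (axis i 1))"

definition smooth :: "(real^'d::finite \<Rightarrow> 'b::real_normed_vector) \<Rightarrow> bool" where
  "smooth f \<longleftrightarrow> (\<forall>ds x. iter_partial ds f differentiable (at x))"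

definition schwartz :: "(real^'d::finite \<Rightarrow> 'b::real_normed_vector) \<Rightarrow> bool" where
  "schwartz f \<longleftrightarrow> smooth f \<and>
     (\<forall>ds (m::nat). \<exists>C. \<forall>x. (1 + norm x) ^ m * norm (iter_partial ds f x) \<le> C)"

definition supp :: "('v::topological_space \<Rightarrow> 'b::zero) \<Rightarrow> 'v set" where
  "supp f = closure {x. f x \<noteq> 0}"

definition smooth_compact_support :: "(real^'d::finite \<Rightarrow> 'b::real_normed_vector) \<Rightarrow> bool" where
  "smooth_compact_support f \<longleftrightarrow> smooth f \<and> compact (supp f)"

definition fourier :: "('v::euclidean_space \<Rightarrow> complex) \<Rightarrow> 'v \<Rightarrow> complex" where
  "fourier f \<eta> = (LINT t|lborel. f t * cis (- (t \<bullet> \<eta>)))"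

section \<open>Square-integrable functions and frames\<close>

text \<open>
  Elements of the Lebesgue space are represented by Borel functions; every class contains one.
  Equality in that space is equality almost everywhere.
\<close>

definition L2 :: "('v::euclidean_space \<Rightarrow> complex) set" where
  "L2 = {f \<in> borel_measurable lborel. integrable lborel (\<lambda>t. (cmod (f t))\<^sup>2)}"

definition l2_inner :: "('v::euclidean_space \<Rightarrow> complex) \<Rightarrow> ('v \<Rightarrow> complex) \<Rightarrow> complex" where
  "l2_inner f g = (LINT t|lborel. f t * cnj (g t))"

definition l2_norm :: "('v::euclidean_space \<Rightarrow> complex) \<Rightarrow> real" where
  "l2_norm f = sqrt (LINT t|lborel. (cmod (f t))\<^sup>2)"

text \<open>Unconditional convergence of a series of functions to \<open>g\<close> in the mean-square norm.\<close>

definition l2_has_sum ::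
  "('i \<Rightarrow> 'v::euclidean_space \<Rightarrow> complex) \<Rightarrow> 'i set \<Rightarrow> ('v \<Rightarrow> complex) \<Rightarrow> bool" where
  "l2_has_sum F W g \<longleftrightarrow> (\<forall>w\<in>W. F w \<in> L2) \<and> g \<in> L2 \<and>
     ((\<lambda>X. l2_norm (\<lambda>t. g t - (\<Sum>w\<in>X. F w t))) \<longlongrightarrow> 0) (finite_subsets_at_top W)"

definition frame_with_bounds ::
  "real \<Rightarrow> real \<Rightarrow> 'i set \<Rightarrow> ('i \<Rightarrow> 'v::euclidean_space \<Rightarrow> complex) \<Rightarrow> bool" where
  "frame_with_bounds A B W \<psi> \<longleftrightarrow> (\<forall>w\<in>W. \<psi> w \<in> L2) \<and>
     (\<forall>f\<in>L2. (\<lambda>w. (cmod (l2_inner f (\<psi> w)))\<^sup>2) summable_on W \<and>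
        A * (l2_norm f)\<^sup>2 \<le> (\<Sum>\<^sub>\<infinity>w\<in>W. (cmod (l2_inner f (\<psi> w)))\<^sup>2) \<and>
        (\<Sum>\<^sub>\<infinity>w\<in>W. (cmod (l2_inner f (\<psi> w)))\<^sup>2) \<le> B * (l2_norm f)\<^sup>2)"

text \<open>
  \<open>frame_operator W \<psi> f g\<close> is the relation \<open>S f = g\<close>.  It is a relation because functions
  stand for their almost-everywhere classes.
\<close>

definition frame_operator ::
  "'i set \<Rightarrow> ('i \<Rightarrow> 'v::euclidean_space \<Rightarrow> complex) \<Rightarrow> ('v \<Rightarrow> complex) \<Rightarrow> ('v \<Rightarrow> complex) \<Rightarrow> bool" where
  "frame_operator W \<psi> f g \<longleftrightarrow>
     f \<in> L2 \<and> l2_has_sum (\<lambda>w t. l2_inner f (\<psi> w) * \<psi> w t) W g"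

text \<open>
  The dual element at \<open>w\<close> is the inverse image of \<open>\<psi> w\<close> under the frame operator:
  the solution of \<open>S f = \<psi> w\<close>, unique as an element of the Lebesgue space.
\<close>

definition canonical_dual ::
  "'i set \<Rightarrow> ('i \<Rightarrow> 'v::euclidean_space \<Rightarrow> complex) \<Rightarrow> ('i \<Rightarrow> 'v \<Rightarrow> complex) \<Rightarrow> bool" where
  "canonical_dual W \<psi> \<psi>d \<longleftrightarrow> (\<forall>w\<in>W. frame_operator W \<psi> (\<psi>d w) (\<psi> w) \<and>
     (\<forall>f. frame_operator W \<psi> f (\<psi> w) \<longrightarrow> (AE t in lborel. f t = \<psi>d w t)))"

section \<open>Subdyadic lattices\<close>

definition dyadic_annulus :: "nat \<Rightarrow> 'v::real_normed_vector set" where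
  "dyadic_annulus n = {\<xi>. 2 ^ n \<le> norm \<xi> \<and> norm \<xi> < 2 ^ Suc n}"

definition half_open_cube :: "real^'d::finite \<Rightarrow> real \<Rightarrow> (real^'d) set" where
  "half_open_cube c h = {x. \<forall>i. c $ i \<le> x $ i \<and> x $ i < c $ i + h}"

definition candidate_set ::
  "real \<Rightarrow> real \<Rightarrow> nat \<Rightarrow> (real^'d::finite) set \<Rightarrow> bool" where
  "candidate_set \<alpha> \<rho> n C \<longleftrightarrow>
     (\<exists>P p. P \<subseteq> range (\<lambda>c. half_open_cube c (\<rho> * 2 powr (real n * (1 - \<alpha>)))) \<and>
        disjoint P \<and> \<Union>P = UNIV \<and>
        (\<forall>Q\<in>P. Q \<inter> dyadic_annulus n \<noteq> {} \<longrightarrow> p Q \<in> Q \<inter> dyadic_annulus n) \<and>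
        C = p ` {Q \<in> P. Q \<inter> dyadic_annulus n \<noteq> {}})"

text \<open>
  Each candidate set is finite and nonempty, so an ordering of all candidates, first by annulus
  and arbitrary inside each annulus, is an enumeration by the natural numbers.
\<close>

definition candidate_ordering ::
  "(nat \<Rightarrow> (real^'d::finite) set) \<Rightarrow> (nat \<Rightarrow> real^'d) \<Rightarrow> bool" where
  "candidate_ordering C c \<longleftrightarrow> bij_betw c UNIV (\<Union>n. C n) \<and>
     (\<forall>i j m n. c i \<in> C m \<and> c j \<in> C n \<and> m < n \<longrightarrow> i < j)"

function retained ::
  "real \<Rightarrow> real \<Rightarrow> real \<Rightarrow> (nat \<Rightarrow> real^'d::finite) \<Rightarrow> nat \<Rightarrow> bool" where
  "retained \<alpha> a \<rho> c i \<longleftrightarrow>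
     (\<forall>j\<in>{..<i}. retained \<alpha> a \<rho> c j \<longrightarrow>
        ball (c i) (a * \<rho> * norm (c i) powr (1 - \<alpha>)) \<inter>
        ball (c j) (a * \<rho> * norm (c j) powr (1 - \<alpha>)) = {})"
  by pat_completeness auto
termination
  by (relation "Wellfounded.measure (\<lambda>(\<alpha>, a, \<rho>, c, i). i)") auto

declare retained.simps [simp del]

text \<open>
  \<open>\<xi>\<close> enumerates the frequencies retained in some run of the construction at scale \<open>\<rho>\<close>.
\<close>

definition subdyadic_frequencies ::
  "real \<Rightarrow> real \<Rightarrow> real \<Rightarrow> (nat \<Rightarrow> real^'d::finite) \<Rightarrow> bool" where
  "subdyadic_frequencies \<alpha> a \<rho> \<xi> \<longleftrightarrow>
     (\<exists>C c. (\<forall>n. candidate_set \<alpha> \<rho> n (C n)) \<and> candidate_ordering C c \<and>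
        bij_betw \<xi> UNIV (c ` {i. retained \<alpha> a \<rho> c i}))"

definition spatial_node :: "real \<Rightarrow> real \<Rightarrow> real \<Rightarrow> real^'d::finite \<Rightarrow> int^'d \<Rightarrow> real^'d" where
  "spatial_node \<alpha> b \<rho> \<eta> j = (b * \<rho> * norm \<eta> powr (\<alpha> - 1)) *\<^sub>R (\<chi> i. real_of_int (j $ i))"

definition subdyadic_lattice ::
  "real \<Rightarrow> real \<Rightarrow> real \<Rightarrow> (nat \<Rightarrow> real^'d::finite) \<Rightarrow> ((real^'d) \<times> (real^'d)) set" where
  "subdyadic_lattice \<alpha> b \<rho> \<xi> = {(spatial_node \<alpha> b \<rho> (\<xi> k) j, \<xi> k) | k j. True}"

definition frequency_ball ::
  "real \<Rightarrow> real \<Rightarrow> real \<Rightarrow> (nat \<Rightarrow> real^'d::finite) \<Rightarrow> nat \<Rightarrow> (real^'d) set" where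
  "frequency_ball \<alpha> Acov \<rho> \<xi> k = cball (\<xi> k) (Acov * \<rho> * norm (\<xi> k) powr (1 - \<alpha>))"

section \<open>Wave packets and the adapted separation function\<close>

definition wave_packet ::
  "real \<Rightarrow> (real^'d::finite \<Rightarrow> real) \<Rightarrow> (real^'d) \<times> (real^'d) \<Rightarrow> real^'d \<Rightarrow> complex" where
  "wave_packet \<alpha> \<phi> = (\<lambda>(x, \<xi>) t.
     complex_of_real (norm \<xi> powr (real CARD('d) / 2 * (1 - \<alpha>)) *
       \<phi> ((norm \<xi> powr (1 - \<alpha>)) *\<^sub>R (t - x))) * cis (t \<bullet> \<xi>))"

definition sep_scale :: "(real^'d::finite) \<times> (real^'d) \<Rightarrow> (real^'d) \<times> (real^'d) \<Rightarrow> real" where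
  "sep_scale w z = 1 + min (norm (snd w)) (norm (snd z))"

definition separation ::
  "real \<Rightarrow> (real^'d::finite) \<times> (real^'d) \<Rightarrow> (real^'d) \<times> (real^'d) \<Rightarrow> real" where
  "separation \<alpha> w z =
     sep_scale w z powr (1 - \<alpha>) * norm (fst w - fst z) +
     sep_scale w z powr (\<alpha> - 1) * norm (snd w - snd z)"

end

theory Submission
  imports Defs
begin

text \<open>
  The system is a painless nonorthogonal expansion: on the Fourier side its frame operator is
  multiplication by a function.  Write \<open>s k = norm (\<xi> k) powr (1 - \<alpha>)\<close> for the frequency scale at
  \<open>\<xi> k\<close>.  The Fourier transform of the packet at \<open>(x, \<xi> k)\<close> is, up to a factor, the modulated bump
  \<open>cis (- x \<bullet> \<eta>) * \<phi>h ((\<eta> - \<xi> k) / s k)\<close>, which lives in the ball of radius \<open>R1 * s k\<close> about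
  \<open>\<xi> k\<close>, while the spatial nodes for \<open>\<xi> k\<close> form a grid of step \<open>b * \<rho> / s k\<close>.  If \<open>R1 * b * \<rho> < pi\<close>,
  the ball lies in a period cube of the exponentials of that grid, so Parseval's identity for
  Fourier series (\<open>fourier_series_parseval\<close>, applied in \<open>parseval_single\<close>) evaluates the sum over
  all nodes exactly.  Summing over \<open>k\<close>, the energy of the coefficients of \<open>f\<close> is the integral of the
  squared modulus of \<open>fourier f\<close> against
  \<open>symbol \<eta> = (b * \<rho>) ^ (- d) * (\<Sum>k. (cmod (\<phi>h ((\<eta> - \<xi> k) / s k)))\<^sup>2)\<close>
  (\<open>energy_identity\<close>), and Plancherel's theorem turns bounds on the symbol into frame bounds.

  The symbol is bounded because the disjointness of the small balls around retained frequencies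
  limits how many of the larger balls can meet (\<open>bounded_overlap\<close>): balls that meet have comparable
  scales (\<open>frequency_comparable\<close>), so volumes can be compared.  It is bounded below because the
  balls of radius \<open>R0 * s k\<close> cover everything: a rejected candidate is close to a retained
  frequency, which for small \<open>\<rho>\<close> covers \<open>norm \<eta> \<ge> 1\<close> (\<open>subdyadic_covering\<close>), and the first retained
  frequency has norm between 1 and 2, so \<open>R0 > 3 * 2 powr max (\<alpha> - 1) 0\<close> lets its ball contain the
  unit ball (\<open>low_frequencies_covered\<close>).

  Since the frame operator is a multiplier, the dual packet is the inverse Fourier transform of the
  packet's transform divided by the symbol.  To see that the frame series converge to the right
  limits it is enough to know the limits weakly against integrable functions: a Bessel bound
  upgrades weak identities to unconditional convergence (\<open>l2_has_sum_from_weak\<close>), because the limit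
  is known beforehand and no completeness argument has to produce it.

  Inner products of dual elements are oscillatory integrals of
  \<open>\<phi>h ((\<eta> - \<xi> k) / s k) * cnj (\<phi>h ((\<eta> - \<xi> l) / s l))\<close> over a power of the symbol, with phase
  \<open>(y - x) \<bullet> \<eta>\<close>.  They vanish unless the two balls meet.  If they meet, every derivative in a
  coordinate direction, taken at scale \<open>s k\<close>, is bounded uniformly in \<open>k\<close> and \<open>l\<close>
  (\<open>cross_term_dir_bounded\<close>), so repeated integration by parts gives decay of every order in
  \<open>s k * norm (x - y)\<close> (\<open>oscillatory_integral_decay\<close>).  On meeting balls the frequency part of the
  separation function is bounded, hence this quantity controls the separation
  (\<open>separation_bound\<close>).

  The analysis underneath is built from one source.  Density of trigonometric polynomials in the
  square-integrable functions on a cube gives Parseval's identity for Fourier series, and averaging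
  that identity over translates of a frequency grid gives Plancherel's theorem on the whole space.
\<close>

section \<open>The space of square-integrable functions\<close>

lemma L2_measurable [measurable_dest]: "f \<in> L2 \<Longrightarrow> f \<in> borel_measurable borel"
  by (simp add: L2_def)

lemma L2_integrable_sq: "f \<in> L2 \<Longrightarrow> integrable lborel (\<lambda>t. (cmod (f t))\<^sup>2)"
  by (simp add: L2_def)

lemma L2_I: "f \<in> borel_measurable borel \<Longrightarrow> integrable lborel (\<lambda>t. (cmod (f t))\<^sup>2) \<Longrightarrow> f \<in> L2"
  by (simp add: L2_def)

lemma L2_zero [simp]: "(\<lambda>t. 0) \<in> L2"
  by (simp add: L2_def)

lemma L2_bound:
  assumes "f \<in> borel_measurable borel" "g \<in> L2" "\<And>t. cmod (f t) \<le> C * cmod (g t)"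
  shows "f \<in> L2"
proof (rule L2_I[OF assms(1)])
  show "integrable lborel (\<lambda>t. (cmod (f t))\<^sup>2)"
  proof (rule Bochner_Integration.integrable_bound)
    show "integrable lborel (\<lambda>t. C\<^sup>2 * (cmod (g t))\<^sup>2)"
      using L2_integrable_sq[OF assms(2)] by simp
    show "AE t in lborel. norm ((cmod (f t))\<^sup>2) \<le> norm (C\<^sup>2 * (cmod (g t))\<^sup>2)"
      proof (rule AE_I2)
      fix t
      have "(cmod (f t))\<^sup>2 \<le> (C * cmod (g t))\<^sup>2"
        by (rule power_mono[OF assms(3)]) simp
      then show "norm ((cmod (f t))\<^sup>2) \<le> norm (C\<^sup>2 * (cmod (g t))\<^sup>2)"
        by (simp add: power_mult_distrib)
    qed
  qed (use assms in measurable)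
qed

lemma L2_cmult: "f \<in> L2 \<Longrightarrow> (\<lambda>t. c * f t) \<in> L2"
  by (rule L2_bound[where g=f and C="cmod c"]) (auto simp: norm_mult)

lemma cmod_add_sq_le: "(cmod (a + b))\<^sup>2 \<le> 2 * (cmod a)\<^sup>2 + 2 * (cmod b)\<^sup>2"
proof -
  have "(cmod (a + b))\<^sup>2 \<le> (cmod a + cmod b)\<^sup>2"
    by (intro power_mono norm_triangle_ineq) simp
  also have "\<dots> \<le> 2 * (cmod a)\<^sup>2 + 2 * (cmod b)\<^sup>2"
    using zero_le_power2[of "cmod a - cmod b"] by (simp add: power2_eq_square algebra_simps)
  finally show ?thesis .
qed

lemma L2_add: assumes "f \<in> L2" "g \<in> L2" shows "(\<lambda>t. f t + g t) \<in> L2"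
proof (rule L2_I)
  show "integrable lborel (\<lambda>t. (cmod (f t + g t))\<^sup>2)"
  proof (rule Bochner_Integration.integrable_bound)
    show "integrable lborel (\<lambda>t. 2 * (cmod (f t))\<^sup>2 + 2 * (cmod (g t))\<^sup>2)"
      using assms[THEN L2_integrable_sq] by simp
    show "AE t in lborel. norm ((cmod (f t + g t))\<^sup>2) \<le> norm (2 * (cmod (f t))\<^sup>2 + 2 * (cmod (g t))\<^sup>2)"
      using cmod_add_sq_le by (auto simp: abs_of_nonneg)
  qed (use assms in measurable)
qed (use assms in measurable)

lemma L2_diff: "f \<in> L2 \<Longrightarrow> g \<in> L2 \<Longrightarrow> (\<lambda>t. f t - g t) \<in> L2"
  using L2_add[of f "\<lambda>t. (-1) * g t"] L2_cmult[of g "-1"] by simp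

lemma L2_sum: "(\<And>w. w \<in> X \<Longrightarrow> F w \<in> L2) \<Longrightarrow> (\<lambda>t. \<Sum>w\<in>X. F w t) \<in> L2"
  by (induction X rule: infinite_finite_induct) (auto intro: L2_add)

lemma borel_measurable_cnj [measurable (raw)]:
  "f \<in> borel_measurable M \<Longrightarrow> (\<lambda>x. cnj (f x)) \<in> borel_measurable M"
  by (rule measurable_compose[OF _ borel_measurable_continuous_onI[where f=cnj]])
     (auto intro: continuous_intros)

lemma L2_inner_integrable: assumes "f \<in> L2" "g \<in> L2"
  shows "integrable lborel (\<lambda>t. f t * cnj (g t))"
proof (rule Bochner_Integration.integrable_bound)
  show "integrable lborel (\<lambda>t. (cmod (f t))\<^sup>2 + (cmod (g t))\<^sup>2)"
    using assms[THEN L2_integrable_sq] by simp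
  show "AE t in lborel. norm (f t * cnj (g t)) \<le> norm ((cmod (f t))\<^sup>2 + (cmod (g t))\<^sup>2)"
  proof (rule AE_I2)
    fix t
    have "0 \<le> (cmod (f t) - cmod (g t))\<^sup>2" "0 \<le> cmod (f t) * cmod (g t)" by auto
    then have "cmod (f t) * cmod (g t) \<le> (cmod (f t))\<^sup>2 + (cmod (g t))\<^sup>2"
      unfolding power2_diff by linarith
    then show "norm (f t * cnj (g t)) \<le> norm ((cmod (f t))\<^sup>2 + (cmod (g t))\<^sup>2)"
      by (simp add: norm_mult)
  qed
qed (use assms in measurable)

lemma l2_inner_add_left:
  "f \<in> L2 \<Longrightarrow> g \<in> L2 \<Longrightarrow> h \<in> L2 \<Longrightarrow> l2_inner (\<lambda>t. f t + g t) h = l2_inner f h + l2_inner g h"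
  unfolding l2_inner_def using L2_inner_integrable[of f h] L2_inner_integrable[of g h]
  by (simp add: algebra_simps)

lemma l2_inner_cmult_left: "l2_inner (\<lambda>t. c * f t) h = c * l2_inner f h"
  unfolding l2_inner_def by (simp add: mult.assoc)

lemma l2_inner_diff_left:
  "f \<in> L2 \<Longrightarrow> g \<in> L2 \<Longrightarrow> h \<in> L2 \<Longrightarrow> l2_inner (\<lambda>t. f t - g t) h = l2_inner f h - l2_inner g h"
  unfolding l2_inner_def using L2_inner_integrable[of f h] L2_inner_integrable[of g h]
  by (simp add: algebra_simps)

lemma l2_inner_zero_left [simp]: "l2_inner (\<lambda>t. 0) h = 0"
  by (simp add: l2_inner_def)

lemma l2_inner_sum_left:
  "h \<in> L2 \<Longrightarrow> (\<And>w. w \<in> X \<Longrightarrow> F w \<in> L2) \<Longrightarrow>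
    l2_inner (\<lambda>t. \<Sum>w\<in>X. F w t) h = (\<Sum>w\<in>X. l2_inner (F w) h)"
  by (induction X rule: infinite_finite_induct) (auto simp: l2_inner_add_left L2_sum)

lemma l2_inner_commute: "l2_inner g f = cnj (l2_inner f g)"
  unfolding l2_inner_def by (simp flip: Bochner_Integration.integral_cnj add: mult.commute)

lemma l2_norm_nonneg [simp]: "0 \<le> l2_norm f"
  by (simp add: l2_norm_def)

lemma l2_norm_sq: "(l2_norm f)\<^sup>2 = (LINT t|lborel. (cmod (f t))\<^sup>2)"
  by (simp add: l2_norm_def)

lemma l2_inner_self: "l2_inner f f = complex_of_real ((l2_norm f)\<^sup>2)"
  unfolding l2_norm_sq l2_inner_def complex_norm_square[symmetric]
  by (simp add: of_real_power[symmetric] del: of_real_power)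

lemma l2_norm_cmult: "l2_norm (\<lambda>t. c * f t) = cmod c * l2_norm f"
  unfolding l2_norm_def by (simp add: norm_mult power_mult_distrib real_sqrt_mult)

lemma l2_norm_sq_expand:
  assumes "f \<in> L2" "g \<in> L2"
  shows "(l2_norm (\<lambda>t. f t + g t))\<^sup>2 = (l2_norm f)\<^sup>2 + 2 * Re (l2_inner f g) + (l2_norm g)\<^sup>2"
proof -
  have *: "(cmod (f t + g t))\<^sup>2 = (cmod (f t))\<^sup>2 + 2 * Re (f t * cnj (g t)) + (cmod (g t))\<^sup>2" for t
    unfolding cmod_power2 by (simp add: power2_eq_square algebra_simps)
  have "Re (l2_inner f g) = (LINT t|lborel. Re (f t * cnj (g t)))"
    unfolding l2_inner_def using L2_inner_integrable[OF assms] by (simp only: integral_Re)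
  then show ?thesis
    unfolding l2_norm_sq * using L2_inner_integrable[OF assms] assms[THEN L2_integrable_sq]
    by (subst Bochner_Integration.integral_add; (subst Bochner_Integration.integral_add)?)
       (auto intro!: integrable_Re Bochner_Integration.integrable_add integrable_mult_right simp del: times_complex.sel)
qed

lemma l2_cauchy_schwarz:
  assumes "f \<in> L2" "g \<in> L2"
  shows "cmod (l2_inner f g) \<le> l2_norm f * l2_norm g"
proof -
  define z where "z = l2_inner f g"
  have *: "0 \<le> (l2_norm f)\<^sup>2 - 2 * c * (cmod z)\<^sup>2 + c\<^sup>2 * (cmod z)\<^sup>2 * (l2_norm g)\<^sup>2" for c :: real
  proof -
    have "0 \<le> (l2_norm (\<lambda>t. f t + (- (of_real c * z)) * g t))\<^sup>2" by simp
    also have "\<dots> = (l2_norm f)\<^sup>2 + 2 * Re (l2_inner f (\<lambda>t. (- (of_real c * z)) * g t))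
        + (l2_norm (\<lambda>t. (- (of_real c * z)) * g t))\<^sup>2"
      by (intro l2_norm_sq_expand L2_cmult assms)
    also have "l2_inner f (\<lambda>t. (- (of_real c * z)) * g t) = cnj (- (of_real c * z)) * z"
      by (subst l2_inner_commute, subst l2_inner_cmult_left, subst l2_inner_commute) (simp add: z_def)
    also have "Re (cnj (- (of_real c * z)) * z) = - c * (cmod z)\<^sup>2"
      unfolding cmod_power2 by (simp add: power2_eq_square algebra_simps)
    finally show ?thesis
      by (simp only: l2_norm_cmult) (simp add: norm_mult power_mult_distrib)
  qed
  show ?thesis
  proof (cases "l2_norm g = 0")
    case True
    have "z = 0"
    proof (rule ccontr)
      assume "z \<noteq> 0"
      then have "(cmod z)\<^sup>2 > 0" by simp
      then obtain c :: real where "2 * c * (cmod z)\<^sup>2 > (l2_norm f)\<^sup>2"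
        by (intro that[of "((l2_norm f)\<^sup>2 + 1) / (2 * (cmod z)\<^sup>2)"]) (simp add: field_simps)
      with *[of c] True show False by simp
    qed
    then show ?thesis using True by (simp add: z_def)
  next
    case False
    then have g: "(l2_norm g)\<^sup>2 > 0" by simp
    have "0 \<le> (l2_norm f)\<^sup>2 - (cmod z)\<^sup>2 / (l2_norm g)\<^sup>2"
      using *[of "1 / (l2_norm g)\<^sup>2"] False by (simp add: field_simps power2_eq_square)
    then have "(cmod z)\<^sup>2 \<le> (l2_norm f * l2_norm g)\<^sup>2"
      using g by (simp add: field_simps)
    then show ?thesis
      unfolding z_def by (rule power2_le_imp_le) simp
  qed
qed

lemma l2_norm_triangle:
  assumes "f \<in> L2" "g \<in> L2"
  shows "l2_norm (\<lambda>t. f t + g t) \<le> l2_norm f + l2_norm g"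
proof (rule power2_le_imp_le)
  show "(l2_norm (\<lambda>t. f t + g t))\<^sup>2 \<le> (l2_norm f + l2_norm g)\<^sup>2"
    using l2_norm_sq_expand[OF assms] l2_cauchy_schwarz[OF assms] complex_Re_le_cmod[of "l2_inner f g"]
    by (simp add: power2_sum)
qed (simp add: add_nonneg_nonneg)

lemma l2_norm_diff_commute: "l2_norm (\<lambda>t. f t - g t) = l2_norm (\<lambda>t. g t - f t)"
  by (simp add: l2_norm_def norm_minus_commute)

lemma l2_norm_triangle_diff:
  assumes "f \<in> L2" "g \<in> L2"
  shows "l2_norm f \<le> l2_norm g + l2_norm (\<lambda>t. f t - g t)"
  using l2_norm_triangle[OF assms(2) L2_diff[OF assms]] by simp

lemma l2_norm_zero_AE:
  assumes "f \<in> L2" "l2_norm f = 0"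
  shows "AE t in lborel. f t = 0"
proof -
  have "(LINT t|lborel. (cmod (f t))\<^sup>2) = 0" using assms l2_norm_sq[of f] by simp
  then have "AE t in lborel. (cmod (f t))\<^sup>2 = 0"
    using L2_integrable_sq[OF assms(1)] by (subst (asm) integral_nonneg_eq_0_iff_AE) auto
  then show ?thesis by simp
qed

text \<open>
  Dominated convergence in mean square, the source of the density statements below.
\<close>

lemma l2_norm_dominated:
  fixes F :: "nat \<Rightarrow> 'a::euclidean_space \<Rightarrow> complex"
  assumes f: "\<And>n. F n \<in> L2" and g: "g \<in> L2"
    and lim: "\<And>t. (\<lambda>n. F n t) \<longlonglongrightarrow> 0" and bd: "\<And>n t. cmod (F n t) \<le> cmod (g t)"
  shows "(\<lambda>n. l2_norm (F n)) \<longlonglongrightarrow> 0"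
proof -
  have "(\<lambda>n. LINT t|lborel. (cmod (F n t))\<^sup>2) \<longlonglongrightarrow> (LINT t|lborel. (\<lambda>t::'a. 0::real) t)"
  proof (rule integral_dominated_convergence[where w="\<lambda>t. (cmod (g t))\<^sup>2"])
    show "integrable lborel (\<lambda>t. (cmod (g t))\<^sup>2)" by (rule L2_integrable_sq[OF g])
    show "AE t in lborel. (\<lambda>i. (cmod (F i t))\<^sup>2) \<longlonglongrightarrow> 0"
    proof (rule AE_I2)
      fix t
      show "(\<lambda>i. (cmod (F i t))\<^sup>2) \<longlonglongrightarrow> 0"
        using tendsto_power[OF tendsto_norm[OF lim[of t]], of 2] by simp
    qed
    show "AE t in lborel. norm ((cmod (F i t))\<^sup>2) \<le> (cmod (g t))\<^sup>2" for i
      using bd by (auto intro!: power_mono)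
  qed (use f in measurable)
  then show ?thesis
    unfolding l2_norm_def using tendsto_real_sqrt by force
qed

text \<open>
  Truncations are integrable as well as square-integrable, so they carry statements from the
  class where Fourier transforms are given by integrals over to all square-integrable functions.
\<close>

definition truncate :: "nat \<Rightarrow> ('v::euclidean_space \<Rightarrow> complex) \<Rightarrow> 'v \<Rightarrow> complex" where
  "truncate n f t = indicator (cball 0 (real n)) t * f t"

lemma truncate_measurable [measurable]:
  "f \<in> borel_measurable borel \<Longrightarrow> truncate n f \<in> borel_measurable borel"
  unfolding truncate_def[abs_def]
  by (intro borel_measurable_times borel_measurable_indicator) auto

lemma cmod_truncate: "cmod (truncate n f t) \<le> cmod (f t)"
  by (simp add: truncate_def norm_mult indicator_def)

lemma truncate_L2: "f \<in> L2 \<Longrightarrow> truncate n f \<in> L2"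
  by (rule L2_bound[where g=f and C=1]) (auto simp: cmod_truncate)

lemma truncate_pointwise: "(\<lambda>n. truncate n f t) \<longlonglongrightarrow> f t"
proof (rule tendsto_eventually)
  show "\<forall>\<^sub>F n in sequentially. truncate n f t = f t"
    using eventually_ge_at_top[of "nat \<lceil>norm t\<rceil>"]
    by eventually_elim (simp add: truncate_def nat_ceiling_le_eq)
qed

lemma L2_truncate_tendsto:
  assumes "f \<in> L2" shows "(\<lambda>n. l2_norm (\<lambda>t. f t - truncate n f t)) \<longlonglongrightarrow> 0"
proof (rule l2_norm_dominated[OF _ assms])
  show "(\<lambda>n. f t - truncate n f t) \<longlonglongrightarrow> 0" for t
    using tendsto_diff[OF tendsto_const truncate_pointwise, of "f t" f t] by simp
  show "(\<lambda>t. f t - truncate n f t) \<in> L2" for n by (intro L2_diff truncate_L2 assms)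
qed (auto simp: truncate_def indicator_def)

lemma bounded_support_L2_integrable:
  fixes f :: "'v::euclidean_space \<Rightarrow> complex"
  assumes "f \<in> L2" "\<And>t. t \<notin> cball 0 R \<Longrightarrow> f t = 0"
  shows "integrable lborel f"
proof (rule Bochner_Integration.integrable_bound)
  show "integrable lborel (\<lambda>t. indicator (cball 0 R) t + (cmod (f t))\<^sup>2 :: real)"
    using L2_integrable_sq[OF assms(1)] emeasure_bounded_finite[of "cball 0 R :: 'v set"] by simp
  show "AE t in lborel. norm (f t) \<le> norm (indicator (cball 0 R) t + (cmod (f t))\<^sup>2)"
  proof (rule AE_I2)
    fix t
    have "0 \<le> (cmod (f t) - 1)\<^sup>2" "0 \<le> (cmod (f t))\<^sup>2" "0 \<le> cmod (f t)" by auto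
    then have "2 * cmod (f t) \<le> 1 + (cmod (f t))\<^sup>2" unfolding power2_diff by simp
    with \<open>0 \<le> cmod (f t)\<close> have "cmod (f t) \<le> 1 + (cmod (f t))\<^sup>2" by linarith
    then show "norm (f t) \<le> norm (indicator (cball 0 R) t + (cmod (f t))\<^sup>2)"
      using assms(2)[of t] by (cases "t \<in> cball 0 R") auto
  qed
qed (use assms in measurable)

lemma truncate_integrable: "f \<in> L2 \<Longrightarrow> integrable lborel (truncate n f)"
  by (rule bounded_support_L2_integrable[where R=n]) (auto simp: truncate_L2 truncate_def)

section \<open>Characters on a cube\<close>

lemma lborel_real_eq: "interval_measure (\<lambda>x. x) = (lborel :: real measure)"
  by (rule sym) (rule lborel_eq_real)

lemma axis_index_axis: "axis_index (axis i (1::real)) = (i::'d::finite)"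
  unfolding axis_index_def by (rule some_equality) (auto simp: axis_eq_axis)

text \<open>
  Lebesgue measure on vectors is the image of the product of the coordinate measures, so integrals
  of products of functions of single coordinates factor.
\<close>

lemma integral_lborel_prod:
  fixes f :: "'d::finite \<Rightarrow> real \<Rightarrow> complex"
  assumes f: "\<And>i. integrable lborel (f i)"
  shows "(integral\<^sup>L lborel (\<lambda>x::real^'d. \<Prod>i\<in>UNIV. f i (x $ i))) = (\<Prod>i\<in>UNIV. LINT x|lborel. f i x)"
proof -
  let ?P = "\<Pi>\<^sub>M b\<in>(Basis::(real^'d) set). (lborel :: real measure)"
  let ?T = "\<lambda>f. \<Sum>b\<in>(Basis::(real^'d) set). f b *\<^sub>R b"
  interpret product_sigma_finite "\<lambda>b::real^'d. lborel :: real measure" by standard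
  have lb: "lborel = distr ?P borel ?T"
    by (subst lborel_def) (simp only: lborel_real_eq)
  have T[measurable]: "?T \<in> measurable ?P borel" by measurable
  have Tn: "?T g $ i = g (axis i 1)" for g i
  proof -
    have "?T g $ i = ?T g \<bullet> axis i 1" by (simp add: inner_axis)
    then show ?thesis by (simp add: inner_sum_left inner_Basis if_distrib[of "\<lambda>x. _ * x"] cong: if_cong)
  qed
  have inj: "inj_on (\<lambda>i::'d. axis i (1::real)) UNIV" by (auto simp: inj_on_def axis_eq_axis)
  have B: "(Basis :: (real^'d) set) = (\<lambda>i. axis i 1) ` UNIV" by (auto simp: Basis_vec_def)
  have pr: "(\<Prod>i\<in>UNIV. f i (?T g $ i)) = (\<Prod>b\<in>Basis. f (axis_index b) (g b))" for g
    unfolding Tn by (subst B, subst prod.reindex[OF inj]) (simp add: axis_index_axis)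
  have pr2: "(\<Prod>i\<in>UNIV. LINT x|lborel. f i x) = (\<Prod>b\<in>(Basis::(real^'d) set). LINT x|lborel. f (axis_index b) x)"
    unfolding B by (subst prod.reindex[OF inj]) (simp add: axis_index_axis)
  have fm[measurable]: "f i \<in> borel_measurable borel" for i using f[of i] by auto
  have m[measurable]: "(\<lambda>x::real^'d. \<Prod>i\<in>UNIV. f i (x $ i)) \<in> borel_measurable borel"
    by measurable
  show "(integral\<^sup>L lborel (\<lambda>x::real^'d. \<Prod>i\<in>UNIV. f i (x $ i))) = (\<Prod>i\<in>UNIV. LINT x|lborel. f i x)"
    unfolding lb by (subst integral_distr[OF T m], unfold pr pr2)
      (rule product_integral_prod[OF finite_Basis f])
qed

definition ivec :: "int^'d::finite \<Rightarrow> real^'d" where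
  "ivec j = (\<chi> i. real_of_int (j $ i))"

text \<open>
  The cube is open because the step function used for approximation is the indicator of the positive
  numbers and therefore produces open boxes.
\<close>

definition cube :: "real \<Rightarrow> (real^'d::finite) set" where
  "cube L = box (\<chi> i. - L) (\<chi> i. L)"

definition torus_char :: "real \<Rightarrow> int^'d::finite \<Rightarrow> real^'d \<Rightarrow> complex" where
  "torus_char L j \<eta> = cis (pi / L * (ivec j \<bullet> \<eta>))"

lemma mem_cube: "x \<in> cube L \<longleftrightarrow> (\<forall>i. \<bar>x $ i\<bar> < L)"
proof -
  have "- L < a \<and> a < L \<longleftrightarrow> \<bar>a\<bar> < L" for a by linarith
  then show ?thesis by (simp add: cube_def mem_box_cart)
qed

lemma cube_borel [measurable]: "cube L \<in> sets borel"
  by (simp add: cube_def)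

lemma torus_char_measurable [measurable]: "torus_char L j \<in> borel_measurable borel"
  unfolding torus_char_def[abs_def] by (intro borel_measurable_continuous_onI continuous_intros)

lemma indicator_cube: "(indicator (cube L) x :: complex) = (\<Prod>i\<in>UNIV. indicator {-L<..<L} (x $ i))"
proof (cases "x \<in> cube L")
  case True
  then show ?thesis 
    by (subst prod.neutral) (auto simp: mem_cube indicator_def abs_less_iff minus_less_iff)
next
  case False
  then obtain i where "\<not> \<bar>x $ i\<bar> < L" by (auto simp: mem_cube)
  then have "indicator {-L<..<L} (x $ i) = (0::complex)" by (auto simp: indicator_def)
  then have "(\<Prod>i\<in>UNIV. indicator {-L<..<L} (x $ i)) = (0::complex)"
    by (intro prod_zero) auto
  then show ?thesis using False by simp
qed

lemma emeasure_cube_finite: "emeasure lborel (cube L) < \<infinity>"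
  unfolding cube_def by (rule emeasure_bounded_finite) simp

lemma integral_exp_period:
  fixes n :: int
  assumes "0 < L"
  shows "(LINT x|lborel. indicator {-L<..<L} x * cis (pi / L * (real_of_int n * x))) =
     (if n = 0 then complex_of_real (2 * L) else 0)"
proof (cases "n = 0")
  case True
  have "(LINT x|lborel. indicator {-L<..<L} x *\<^sub>R (1::complex)) = measure lborel {-L<..<L} *\<^sub>R 1"
    by (subst integral_scaleR_left) (use emeasure_bounded_finite[of "{-L<..<L}"] in \<open>auto simp: less_top\<close>)
  moreover have "(\<lambda>x. indicator {-L<..<L} x *\<^sub>R (1::complex)) = indicator {-L<..<L}"
    by (auto simp: indicator_def)
  ultimately have "(LINT x|lborel. (indicator {-L<..<L} x :: complex)) = measure lborel {-L<..<L} *\<^sub>R 1"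
    by (simp only:)
  then show ?thesis using True assms by (simp add: scaleR_conv_of_real)
next
  case False
  define w where "w = pi * real_of_int n / L"
  have w: "w \<noteq> 0" using False assms by (simp add: w_def)
  define F where "F x = cis (w * x) / (\<i> * of_real w)" for x
  have "(LINT x|lborel. indicator {-L..L} x *\<^sub>R cis (w * x)) = F L - F (-L)"
  proof (rule integral_FTC_Icc[where F=F])
    show "- L \<le> L" using assms by simp
    show "(F has_vector_derivative cis (w * x)) (at x within {- L..L})" for x
    proof -
      have "((\<lambda>x. cis (w * x)) has_vector_derivative (w *\<^sub>R (\<i> * cis (w * x)))) (at x within {- L..L})"
        unfolding has_vector_derivative_def
        by (rule has_derivative_eq_rhs, (rule derivative_intros)+) (auto simp: fun_eq_iff)
      then show ?thesis
        unfolding F_def using w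
        by (intro has_vector_derivative_eq_rhs[OF has_vector_derivative_divide]) (auto simp: scaleR_conv_of_real)
    qed
  qed (auto intro!: continuous_intros)
  also have "F L - F (-L) = 0"
  proof -
    have "cis (w * L) = cis (w * (-L))"
    proof -
      have "w * L = w * (-L) + 2 * pi * real_of_int n" using assms by (simp add: w_def field_simps)
      then show ?thesis by (simp only: cis_mult[symmetric]) (simp add: cis_multiple_2pi)
    qed
    then show ?thesis by (simp add: F_def)
  qed
  finally have "(LINT x|lborel. indicator {-L..L} x *\<^sub>R cis (w * x)) = 0" .
  moreover have "(LINT x|lborel. indicator {-L..L} x *\<^sub>R cis (w * x)) =
      (LINT x|lborel. indicator {-L<..<L} x * cis (pi / L * (real_of_int n * x)))"
  proof (rule integral_cong_AE)
    have "AE x in lborel. x \<noteq> L \<and> x \<noteq> - L"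
      using AE_lborel_singleton[of L] AE_lborel_singleton[of "-L"] by eventually_elim auto
    then show "AE x in lborel. indicator {-L..L} x *\<^sub>R cis (w * x) = indicator {-L<..<L} x * cis (pi / L * (real_of_int n * x))"
      by eventually_elim (auto simp: indicator_def w_def field_simps)
  qed (unfold measurable_lborel2, (intro borel_measurable_times borel_measurable_scaleR borel_measurable_indicator borel_measurable_continuous_onI continuous_intros; simp)+)
  ultimately show ?thesis using False by simp
qed

lemma ivec_add: "ivec (j + l) = ivec j + ivec l" and ivec_minus: "ivec (- j) = - ivec j"
  and ivec_zero [simp]: "ivec 0 = 0"
  by (auto simp: ivec_def vec_eq_iff)

lemma torus_char_mult: "torus_char L j \<eta> * torus_char L l \<eta> = torus_char L (j + l) \<eta>"
  unfolding torus_char_def cis_mult ivec_add inner_add_left distrib_left ..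

lemma cnj_torus_char: "cnj (torus_char L j \<eta>) = torus_char L (- j) \<eta>"
  by (simp add: torus_char_def cis_cnj ivec_minus)

lemma norm_torus_char [simp]: "cmod (torus_char L j \<eta>) = 1"
  by (simp add: torus_char_def)

lemma cis_sum: "finite A \<Longrightarrow> cis (sum f A) = (\<Prod>i\<in>A. cis (f i))"
  by (induction A rule: finite_induct) (auto simp flip: cis_mult)

lemma torus_char_prod: "torus_char L j \<eta> = (\<Prod>i\<in>UNIV. cis (pi / L * (real_of_int (j $ i) * \<eta> $ i)))"
  unfolding torus_char_def ivec_def inner_vec_def sum_distrib_left
  by (subst cis_sum) (auto intro!: prod.cong)

lemma integral_torus_char:
  assumes "0 < L"
  shows "(LINT \<eta>|lborel. indicator (cube L) \<eta> * torus_char L (j::int^'d::finite) \<eta>) =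
    (if j = 0 then complex_of_real ((2 * L) ^ CARD('d)) else 0)"
proof -
  let ?f = "\<lambda>i x. indicator {-L<..<L} x * cis (pi / L * (real_of_int (j $ i) * x))"
  have int: "integrable lborel (?f i)" for i
  proof (rule Bochner_Integration.integrable_bound)
    show "integrable lborel (indicator {-L<..<L} :: real \<Rightarrow> real)"
      using emeasure_bounded_finite[of "{-L<..<L}"] by (intro integrable_real_indicator) auto
    show "?f i \<in> borel_measurable lborel"
      unfolding measurable_lborel2
      by (intro borel_measurable_times borel_measurable_indicator borel_measurable_continuous_onI continuous_intros) auto
  qed (auto simp: indicator_def norm_mult)
  have "indicator (cube L) \<eta> * torus_char L j \<eta> = (\<Prod>i\<in>UNIV. ?f i (\<eta> $ i))" for \<eta>
    unfolding prod.distrib indicator_cube torus_char_prod ..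
  then have "(LINT \<eta>|lborel. indicator (cube L) \<eta> * torus_char L j \<eta>) =
      (integral\<^sup>L lborel (\<lambda>\<eta>::real^'d. \<Prod>i\<in>UNIV. ?f i (\<eta> $ i)))" by simp
  also have "\<dots> = (\<Prod>i\<in>UNIV. LINT x|lborel. ?f i x)"
    by (rule integral_lborel_prod[OF int])
  also have "\<dots> = (\<Prod>i\<in>(UNIV::'d set). if j $ i = 0 then complex_of_real (2 * L) else 0)"
    by (simp only: integral_exp_period[OF assms])
  also have "\<dots> = (if j = 0 then complex_of_real ((2 * L) ^ CARD('d)) else 0)"
  proof (cases "j = 0")
    case False
    then obtain i where "j $ i \<noteq> 0" by (metis vec_eq_iff zero_index)
    then show ?thesis using False by (subst prod_zero[where A=UNIV]) auto
  qed simp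
  finally show ?thesis .
qed

text \<open>
  The cut-off makes the characters square-integrable on the whole space, so that Fourier
  coefficients of functions on the cube are values of the one inner product in use.
\<close>

definition cube_char :: "real \<Rightarrow> int^'d::finite \<Rightarrow> real^'d \<Rightarrow> complex" where
  "cube_char L j \<eta> = indicator (cube L) \<eta> * torus_char L j \<eta>"

lemma indicator_cube_L2: "(\<lambda>\<eta>. indicator (cube L) \<eta>) \<in> L2"
proof (rule L2_I)
  have "integrable lborel (indicator (cube L) :: real^'a \<Rightarrow> real)"
    using emeasure_cube_finite by (intro integrable_real_indicator) auto
  then show "integrable lborel (\<lambda>t::real^'a. (cmod (indicator (cube L) t))\<^sup>2)"
    by (rule Bochner_Integration.integrable_cong[THEN iffD1, rotated 2]) (auto simp: indicator_def)
qed auto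

lemma L2_bounded_cube:
  assumes "p \<in> borel_measurable borel" "\<And>\<eta>. cmod (p \<eta>) \<le> C"
  shows "(\<lambda>\<eta>. indicator (cube L) \<eta> * p \<eta>) \<in> L2"
  by (rule L2_bound[OF _ indicator_cube_L2[of L], where C=C])
     (use assms in \<open>auto simp: indicator_def norm_mult intro!: borel_measurable_times borel_measurable_indicator\<close>)

lemma cube_char_L2: "cube_char L j \<in> L2"
  unfolding cube_char_def[abs_def] by (rule L2_bounded_cube[where C=1]) auto

lemma cube_char_orthogonal:
  fixes j l :: "int^'d::finite"
  assumes "0 < L"
  shows "l2_inner (cube_char L j) (cube_char L l) = (if j = l then complex_of_real ((2 * L) ^ CARD('d)) else 0)"
proof -
  have *: "cube_char L j \<eta> * cnj (cube_char L l \<eta>) = indicator (cube L) \<eta> * torus_char L (j - l) \<eta>" for \<eta>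
    using torus_char_mult[of L j \<eta> "- l"]
    by (cases "\<eta> \<in> cube L") (simp_all add: cube_char_def cnj_torus_char)
  then have "l2_inner (cube_char L j) (cube_char L l) = (LINT \<eta>|lborel. indicator (cube L) \<eta> * torus_char L (j - l) \<eta>)"
    unfolding l2_inner_def by (simp only: *)
  also have "\<dots> = (if j = l then complex_of_real ((2 * L) ^ CARD('d)) else 0)"
    unfolding integral_torus_char[OF assms] by (cases "j = l") auto
  finally show ?thesis .
qed

section \<open>Density of trigonometric polynomials\<close>

inductive trig_poly :: "real \<Rightarrow> (real^'d::finite \<Rightarrow> complex) \<Rightarrow> bool" for L where
  char: "trig_poly L (\<lambda>\<eta>. a * torus_char L j \<eta>)"
| add: "trig_poly L p \<Longrightarrow> trig_poly L q \<Longrightarrow> trig_poly L (\<lambda>\<eta>. p \<eta> + q \<eta>)"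

lemma trig_poly_measurable: "trig_poly L p \<Longrightarrow> p \<in> borel_measurable borel"
  by (induction rule: trig_poly.induct) auto

lemma trig_poly_bounded: "trig_poly L p \<Longrightarrow> \<exists>C. \<forall>\<eta>. cmod (p \<eta>) \<le> C"
proof (induction rule: trig_poly.induct)
  case (char a j)
  show ?case by (rule exI[of _ "cmod a"]) (simp add: norm_mult)
next
  case (add p q)
  then obtain C D where "\<And>\<eta>. cmod (p \<eta>) \<le> C" "\<And>\<eta>. cmod (q \<eta>) \<le> D" by blast
  then show ?case by (intro exI[of _ "C + D"]) (auto intro: order_trans[OF norm_triangle_ineq add_mono])
qed

lemma trig_poly_const: "trig_poly L (\<lambda>\<eta>. a)"
  using trig_poly.char[of L a 0] by (simp add: torus_char_def)

lemma trig_poly_char_mult: "trig_poly L p \<Longrightarrow> trig_poly L (\<lambda>\<eta>. a * torus_char L j \<eta> * p \<eta>)"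
proof (induction rule: trig_poly.induct)
  case (char b l)
  have "(\<lambda>\<eta>. a * torus_char L j \<eta> * (b * torus_char L l \<eta>)) = (\<lambda>\<eta>. (a * b) * torus_char L (j + l) \<eta>)"
    by (simp add: torus_char_mult[symmetric] ac_simps)
  then show ?case using trig_poly.char[of L "a * b" "j + l"] by (simp only:)
next
  case (add p q)
  then show ?case using trig_poly.add[OF add.IH] by (simp add: distrib_left)
qed

lemma trig_poly_mult: "trig_poly L p \<Longrightarrow> trig_poly L q \<Longrightarrow> trig_poly L (\<lambda>\<eta>. p \<eta> * q \<eta>)"
proof (induction rule: trig_poly.induct)
  case (char a j)
  then show ?case by (rule trig_poly_char_mult)
next
  case (add p p')
  then show ?case using trig_poly.add[OF add.IH(1,2)] by (simp add: distrib_right)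
qed

lemma trig_poly_prod: "(\<And>i. i \<in> A \<Longrightarrow> trig_poly L (p i)) \<Longrightarrow> trig_poly L (\<lambda>\<eta>. \<Prod>i\<in>A. p i \<eta>)"
proof (induction A rule: infinite_finite_induct)
  case (insert i A)
  then show ?case using trig_poly_mult[of L "p i" "\<lambda>\<eta>. \<Prod>i\<in>A. p i \<eta>"] by simp
qed (simp_all add: trig_poly_const)

text \<open>
  Trigonometric polynomials form an algebra, so a polynomial in one of them is another.
\<close>

lemma trig_poly_polynomial:
  assumes "real_polynomial_function (g :: real \<Rightarrow> real)" "trig_poly L (\<lambda>\<eta>. complex_of_real (q \<eta>))"
  shows "trig_poly L (\<lambda>\<eta>. complex_of_real (g (q \<eta>)))"
  using assms(1)
proof (induction rule: real_polynomial_function.induct)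
  case (linear f)
  then have "f (q \<eta>) = f 1 * q \<eta>" for \<eta>
    using linear_scale[OF bounded_linear.linear[OF linear], of "q \<eta>" 1] by simp
  then show ?case using trig_poly_mult[OF trig_poly_const[of L "complex_of_real (f 1)"] assms(2)] by simp
next
  case (const c)
  then show ?case by (simp add: trig_poly_const)
next
  case (add f g)
  then show ?case using trig_poly.add[OF add.IH] by simp
next
  case (mult f g)
  then show ?case using trig_poly_mult[OF mult.IH] by simp
qed

lemma trig_poly_cos: "trig_poly L (\<lambda>\<eta>. complex_of_real (cos (pi / L * (\<eta> $ i - c)) + b))"
proof -
  have e: "ivec (axis i 1) \<bullet> \<eta> = \<eta> $ i" for \<eta> :: "real^'a"
  proof -
    have "ivec (axis i 1) = axis i (1::real)" by (auto simp: ivec_def axis_def vec_eq_iff)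
    then show ?thesis by (simp add: inner_axis' inner_axis)
  qed
  have *: "complex_of_real (cos (A - B)) = cis (- B) / 2 * cis A + cis B / 2 * cis (- A)" for A B
    by (simp add: complex_eq_iff cos_diff field_simps)
  have "complex_of_real (cos (pi / L * (\<eta> $ i - c)) + b) =
     (cis (- (pi / L * c)) / 2 * torus_char L (axis i 1) \<eta> + cis (pi / L * c) / 2 * torus_char L (- axis i 1) \<eta>) + of_real b" for \<eta>
    unfolding torus_char_def e ivec_minus inner_minus_left right_diff_distrib of_real_add * by simp
  then show ?thesis by (simp only:) (intro trig_poly.intros trig_poly_const)
qed

definition cube_approx :: "real \<Rightarrow> (real^'d::finite \<Rightarrow> complex) \<Rightarrow> bool" where
  "cube_approx L u \<longleftrightarrow> u \<in> L2 \<and>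
    (\<forall>\<epsilon>>0. \<exists>p. trig_poly L p \<and> l2_norm (\<lambda>\<eta>. u \<eta> - indicator (cube L) \<eta> * p \<eta>) < \<epsilon>)"

lemma trig_poly_cube_L2: "trig_poly L p \<Longrightarrow> (\<lambda>\<eta>. indicator (cube L) \<eta> * p \<eta>) \<in> L2"
proof -
  assume p: "trig_poly L p"
  then obtain C where "\<And>\<eta>. cmod (p \<eta>) \<le> C" using trig_poly_bounded by blast
  then show ?thesis by (rule L2_bounded_cube[OF trig_poly_measurable[OF p]])
qed

lemma l2_norm_zero [simp]: "l2_norm (\<lambda>t. 0) = 0"
  by (simp add: l2_norm_def)

lemma cube_approx_trig_poly:
  assumes "trig_poly L p"
  shows "cube_approx L (\<lambda>\<eta>. indicator (cube L) \<eta> * p \<eta>)"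
  unfolding cube_approx_def
proof (intro conjI allI impI)
  fix \<epsilon> :: real assume "\<epsilon> > 0"
  then show "\<exists>q. trig_poly L q \<and> l2_norm (\<lambda>\<eta>. indicator (cube L) \<eta> * p \<eta> - indicator (cube L) \<eta> * q \<eta>) < \<epsilon>"
    using assms by (intro exI[of _ p]) simp
qed (rule trig_poly_cube_L2[OF assms])

lemma cube_approx_add:
  assumes "cube_approx L u" "cube_approx L v"
  shows "cube_approx L (\<lambda>\<eta>. u \<eta> + v \<eta>)"
  unfolding cube_approx_def
proof (intro conjI allI impI)
  show "(\<lambda>\<eta>. u \<eta> + v \<eta>) \<in> L2" using assms by (auto simp: cube_approx_def L2_add)
  fix \<epsilon> :: real assume "\<epsilon> > 0"
  then have "\<epsilon> / 2 > 0" by simp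
  then obtain p q where p: "trig_poly L p" "l2_norm (\<lambda>\<eta>. u \<eta> - indicator (cube L) \<eta> * p \<eta>) < \<epsilon> / 2"
    and q: "trig_poly L q" "l2_norm (\<lambda>\<eta>. v \<eta> - indicator (cube L) \<eta> * q \<eta>) < \<epsilon> / 2"
    using assms unfolding cube_approx_def by blast
  have "l2_norm (\<lambda>\<eta>. (u \<eta> - indicator (cube L) \<eta> * p \<eta>) + (v \<eta> - indicator (cube L) \<eta> * q \<eta>)) < \<epsilon> / 2 + \<epsilon> / 2"
    by (rule le_less_trans[OF l2_norm_triangle add_strict_mono])
       (use p q assms in \<open>auto simp: cube_approx_def intro!: L2_diff trig_poly_cube_L2\<close>)
  then show "\<exists>p. trig_poly L p \<and> l2_norm (\<lambda>\<eta>. u \<eta> + v \<eta> - indicator (cube L) \<eta> * p \<eta>) < \<epsilon>"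
    using p q by (intro exI[of _ "\<lambda>\<eta>. p \<eta> + q \<eta>"]) (auto simp: algebra_simps intro: trig_poly.add)
qed

lemma cube_approx_cmult:
  assumes "cube_approx L u"
  shows "cube_approx L (\<lambda>\<eta>. c * u \<eta>)"
  unfolding cube_approx_def
proof (intro conjI allI impI)
  show "(\<lambda>\<eta>. c * u \<eta>) \<in> L2" using assms by (auto simp: cube_approx_def L2_cmult)
  fix \<epsilon> :: real assume "\<epsilon> > 0"
  then have "\<epsilon> / (cmod c + 1) > 0" by (simp add: add_nonneg_pos)
  then obtain p where p: "trig_poly L p" "l2_norm (\<lambda>\<eta>. u \<eta> - indicator (cube L) \<eta> * p \<eta>) < \<epsilon> / (cmod c + 1)"
    using assms unfolding cube_approx_def by blast
  have "l2_norm (\<lambda>\<eta>. c * (u \<eta> - indicator (cube L) \<eta> * p \<eta>)) \<le> (cmod c + 1) * l2_norm (\<lambda>\<eta>. u \<eta> - indicator (cube L) \<eta> * p \<eta>)"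
    unfolding l2_norm_cmult by (intro mult_right_mono) auto
  also have "\<dots> < \<epsilon>"
    using p(2) by (simp add: pos_less_divide_eq add_nonneg_pos mult.commute)
  finally show "\<exists>p. trig_poly L p \<and> l2_norm (\<lambda>\<eta>. c * u \<eta> - indicator (cube L) \<eta> * p \<eta>) < \<epsilon>"
    using p by (intro exI[of _ "\<lambda>\<eta>. c * p \<eta>"]) (auto simp: algebra_simps intro: trig_poly_mult trig_poly_const)
qed

lemma cube_approx_zero: "cube_approx L (\<lambda>\<eta>. 0)"
  using cube_approx_trig_poly[OF trig_poly_const[of L 0]] by simp

lemma cube_approx_sum: "(\<And>w. w \<in> X \<Longrightarrow> cube_approx L (F w)) \<Longrightarrow> cube_approx L (\<lambda>\<eta>. \<Sum>w\<in>X. F w \<eta>)"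
proof (induction X rule: infinite_finite_induct)
  case (insert w X)
  then show ?case using cube_approx_add[of L "F w" "\<lambda>\<eta>. \<Sum>w\<in>X. F w \<eta>"] by simp
qed (simp_all add: cube_approx_zero)

lemma cube_approx_limit:
  assumes u: "\<And>n. cube_approx L (u n)" and v: "v \<in> L2"
    and lim: "(\<lambda>n. l2_norm (\<lambda>\<eta>. v \<eta> - u n \<eta>)) \<longlonglongrightarrow> 0"
  shows "cube_approx L v"
  unfolding cube_approx_def
proof (intro conjI allI impI v)
  fix \<epsilon> :: real assume "\<epsilon> > 0"
  then have "\<epsilon> / 2 > 0" by simp
  from order_tendstoD(2)[OF lim this] obtain n where n: "l2_norm (\<lambda>\<eta>. v \<eta> - u n \<eta>) < \<epsilon> / 2"
    by (auto simp: eventually_sequentially)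
  obtain p where p: "trig_poly L p" "l2_norm (\<lambda>\<eta>. u n \<eta> - indicator (cube L) \<eta> * p \<eta>) < \<epsilon> / 2"
    using u[of n] \<open>\<epsilon> / 2 > 0\<close> unfolding cube_approx_def by blast
  have "l2_norm (\<lambda>\<eta>. (v \<eta> - u n \<eta>) + (u n \<eta> - indicator (cube L) \<eta> * p \<eta>)) < \<epsilon> / 2 + \<epsilon> / 2"
    by (rule le_less_trans[OF l2_norm_triangle add_strict_mono])
       (use p n v u in \<open>auto simp: cube_approx_def intro!: L2_diff trig_poly_cube_L2\<close>)
  then show "\<exists>p. trig_poly L p \<and> l2_norm (\<lambda>\<eta>. v \<eta> - indicator (cube L) \<eta> * p \<eta>) < \<epsilon>"
    using p by auto
qed

text \<open>
  Weierstrass approximation of the ramps \<open>max 0 (min 1 (n * t))\<close>, which increase to the step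
  function at 0.  Together with \<open>cos_gt_iff_abs_less\<close> this turns a cosine into the indicator of an
  interval.
\<close>

lemma polynomials_to_step:
  obtains g :: "nat \<Rightarrow> real \<Rightarrow> real" where
    "\<And>n. real_polynomial_function (g n)"
    "\<And>n t. \<bar>t\<bar> \<le> 2 \<Longrightarrow> \<bar>g n t\<bar> \<le> 2"
    "\<And>t. \<bar>t\<bar> \<le> 2 \<Longrightarrow> (\<lambda>n. g n t) \<longlonglongrightarrow> (if t > 0 then 1 else 0)"
proof -
  define f :: "nat \<Rightarrow> real \<Rightarrow> real" where "f n t = max 0 (min 1 (real n * t))" for n t
  have "\<exists>g. real_polynomial_function g \<and> (\<forall>x\<in>{-2..2}. \<bar>f n x - g x\<bar> < 1 / real (Suc n))" for n
    by (rule Stone_Weierstrass_real_polynomial_function[of "{-2..2}" "f n" "1 / real (Suc n)"])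
       (auto simp: f_def intro!: continuous_intros)
  then obtain g where g: "\<And>n. real_polynomial_function (g n)"
    and gb: "\<And>n x. x \<in> {-2..2} \<Longrightarrow> \<bar>f n x - g n x\<bar> < 1 / real (Suc n)" by metis
  show ?thesis
  proof (rule that[OF g])
    fix n and t :: real assume t: "\<bar>t\<bar> \<le> 2"
    have "1 / real (Suc n) \<le> 1" by simp
    moreover have "\<bar>f n t\<bar> \<le> 1" by (auto simp: f_def)
    moreover have "\<bar>f n t - g n t\<bar> < 1 / real (Suc n)" using t by (intro gb) auto
    ultimately show "\<bar>g n t\<bar> \<le> 2" by linarith
  next
    fix t :: real assume t: "\<bar>t\<bar> \<le> 2"
    have "(\<lambda>n. f n t) \<longlonglongrightarrow> (if t > 0 then 1 else 0)"
    proof (rule tendsto_eventually)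
      show "\<forall>\<^sub>F n in sequentially. f n t = (if 0 < t then 1 else 0)"
      proof (cases "t > 0")
        case True
        obtain N :: nat where "1 / t < real N" using reals_Archimedean2 by blast
        show ?thesis using eventually_ge_at_top[of N]
        proof eventually_elim
          case (elim n)
          then have "1 / t < real n" using \<open>1 / t < real N\<close> by linarith
          then show ?case using True by (simp add: f_def field_simps)
        qed
      next
        case False
        then have "real n * t \<le> 0" for n by (simp add: mult_nonneg_nonpos)
        then have "f n t = 0" for n unfolding f_def by (intro max_absorb1 min.coboundedI2)
        then show ?thesis using False by simp
      qed
    qed
    moreover have "(\<lambda>n. f n t - g n t) \<longlonglongrightarrow> 0"
    proof (rule tendsto_rabs_zero_cancel, rule tendsto_sandwich[OF _ _ tendsto_const LIMSEQ_inverse_real_of_nat])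
      show "\<forall>\<^sub>F n in sequentially. \<bar>f n t - g n t\<bar> \<le> inverse (real (Suc n))"
      proof (intro always_eventually allI)
        fix n
        have "t \<in> {-2..2}" using t by auto
        from gb[OF this, of n] show "\<bar>f n t - g n t\<bar> \<le> inverse (real (Suc n))"
          by (simp add: inverse_eq_divide)
      qed
    qed auto
    ultimately show "(\<lambda>n. g n t) \<longlonglongrightarrow> (if t > 0 then 1 else 0)"
      using tendsto_diff by fastforce
  qed
qed

text \<open>
  The range of \<open>y\<close> stops where the next period of the interval would begin.
\<close>

lemma cos_gt_iff_abs_less:
  assumes "0 \<le> r" "r \<le> pi" "\<bar>y\<bar> < 2 * pi - r"
  shows "cos r < cos y \<longleftrightarrow> \<bar>y\<bar> < r"
proof (cases "\<bar>y\<bar> \<le> pi")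
  case True
  then show ?thesis using cos_mono_less_eq[of r "\<bar>y\<bar>"] assms by simp
next
  case False
  have "cos y = cos (2 * pi - \<bar>y\<bar>)" by (simp add: cos_diff)
  also have "\<dots> < cos r" using cos_monotone_0_pi[of r "2 * pi - \<bar>y\<bar>"] assms False by auto
  finally show ?thesis using False assms by auto
qed

text \<open>
  A box inside the cube is the product of conditions \<open>cos (pi / L * r) < cos (pi / L * (x - c))\<close> on
  the coordinates.  The polynomials of \<open>polynomials_to_step\<close>, applied to the differences of the two
  sides and multiplied over the coordinates, are bounded trigonometric polynomials converging to
  its indicator.
\<close>

lemma cube_approx_box:
  fixes a b :: "real^'d::finite"
  assumes L: "0 < L"
  shows "cube_approx L (indicator (box a b \<inter> cube L))"
proof -
  define a' where "a' i = max (a $ i) (- L)" for i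
  define b' where "b' i = min (b $ i) L" for i
  \<comment> \<open>Centre and half side of the part of the box inside the cube.\<close>
  define c where "c i = (a' i + b' i) / 2" for i
  define r where "r i = (b' i - a' i) / 2" for i
  have mem: "x \<in> box a b \<inter> cube L \<longleftrightarrow> (\<forall>i. \<bar>x $ i - c i\<bar> < r i)" for x
  proof -
    have "\<bar>x $ i - c i\<bar> < r i \<longleftrightarrow> a' i < x $ i \<and> x $ i < b' i" for i
      unfolding c_def r_def by (simp add: abs_less_iff field_simps) linarith
    moreover have "a' i < x $ i \<and> x $ i < b' i \<longleftrightarrow> (a $ i < x $ i \<and> x $ i < b $ i) \<and> \<bar>x $ i\<bar> < L" for i
      unfolding a'_def b'_def by auto
    ultimately show ?thesis by (auto simp: mem_cube mem_box_cart)
  qed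
  show ?thesis
  proof (cases "\<forall>i. 0 < r i")
    case False
    then obtain i where "r i \<le> 0" by (auto simp: not_less)
    then have "\<not> \<bar>x $ i - c i\<bar> < r i" for x :: "real^'d" by simp
    then have "box a b \<inter> cube L = {}" using mem by blast
    then show ?thesis using cube_approx_zero[of L] by (simp add: indicator_def[abs_def])
  next
    case True
    have cr: "\<bar>c i\<bar> + r i \<le> L" for i
    proof -
      have "- L \<le> a' i" "b' i \<le> L" by (auto simp: a'_def b'_def)
      then have "\<bar>c i\<bar> \<le> L - r i" unfolding c_def r_def by (intro abs_leI) (simp_all add: field_simps)
      then show ?thesis by simp
    qed
    obtain g :: "nat \<Rightarrow> real \<Rightarrow> real" where g: "\<And>n. real_polynomial_function (g n)"
      and gb: "\<And>n t. \<bar>t::real\<bar> \<le> 2 \<Longrightarrow> \<bar>g n t\<bar> \<le> 2"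
      and gl: "\<And>t. \<bar>t::real\<bar> \<le> 2 \<Longrightarrow> (\<lambda>n. g n t) \<longlonglongrightarrow> (if t > 0 then 1 else 0)"
      using polynomials_to_step by metis
    define q where "q i \<eta> = cos (pi / L * (\<eta> $ i - c i)) + (- cos (pi / L * r i))" for i and \<eta> :: "real^'d"
    have qb: "\<bar>q i \<eta>\<bar> \<le> 2" for i \<eta>
      unfolding q_def using abs_cos_le_one[of "pi / L * (\<eta> $ i - c i)"] abs_cos_le_one[of "pi / L * r i"] by linarith
    define p where "p n \<eta> = (\<Prod>i\<in>UNIV. complex_of_real (g n (q i \<eta>)))" for n \<eta>
    have p: "trig_poly L (p n)" for n
    proof -
      have "trig_poly L (\<lambda>\<eta>. complex_of_real (q i \<eta>))" for i unfolding q_def by (rule trig_poly_cos)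
      from trig_poly_prod[OF trig_poly_polynomial[OF g[of n] this]] show ?thesis
        unfolding p_def[abs_def] .
    qed
    have pb: "cmod (p n \<eta>) \<le> 2 ^ CARD('d)" for n \<eta>
    proof -
      have "cmod (p n \<eta>) = (\<Prod>i\<in>UNIV. \<bar>g n (q i \<eta>)\<bar>)" by (simp add: p_def prod_norm[symmetric])
      also have "\<dots> \<le> (\<Prod>i\<in>(UNIV::'d set). 2)" by (intro prod_mono) (auto simp: gb qb)
      finally show ?thesis by simp
    qed
    have qpos: "0 < q i \<eta> \<longleftrightarrow> \<bar>\<eta> $ i - c i\<bar> < r i" if "\<eta> \<in> cube L" for i \<eta>
    proof -
      have e: "\<bar>\<eta> $ i - c i\<bar> < 2 * L - r i" 
      proof -
        have "\<bar>\<eta> $ i\<bar> < L" using that by (simp add: mem_cube)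
        with cr[of i] show ?thesis by linarith
      qed
      have "\<bar>pi / L * (\<eta> $ i - c i)\<bar> = pi / L * \<bar>\<eta> $ i - c i\<bar>" using L by (simp add: abs_mult)
      also have "\<dots> < pi / L * (2 * L - r i)" using e L by (intro mult_strict_left_mono) auto
      also have "\<dots> = 2 * pi - pi / L * r i" using L by (simp add: field_simps)
      finally have "\<bar>pi / L * (\<eta> $ i - c i)\<bar> < 2 * pi - pi / L * r i" .
      moreover have "pi / L * r i \<le> pi / L * L" using cr[of i] L by (intro mult_left_mono) auto
      ultimately have "cos (pi / L * r i) < cos (pi / L * (\<eta> $ i - c i)) \<longleftrightarrow> \<bar>pi / L * (\<eta> $ i - c i)\<bar> < pi / L * r i"
        using True L by (intro cos_gt_iff_abs_less) (auto simp: less_imp_le)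
      also have "\<dots> \<longleftrightarrow> pi / L * \<bar>\<eta> $ i - c i\<bar> < pi / L * r i" using L by (simp add: abs_mult)
      also have "\<dots> \<longleftrightarrow> \<bar>\<eta> $ i - c i\<bar> < r i" using L by (intro mult_less_cancel_left_pos) auto
      finally show ?thesis by (simp add: q_def)
    qed
    let ?u = "\<lambda>n \<eta>. indicator (cube L) \<eta> * p n \<eta>"
    have lim: "(\<lambda>n. ?u n \<eta>) \<longlonglongrightarrow> indicator (box a b \<inter> cube L) \<eta>" for \<eta>
    proof (cases "\<eta> \<in> cube L")
      case True
      have "(\<lambda>n. p n \<eta>) \<longlonglongrightarrow> (\<Prod>i\<in>UNIV. complex_of_real (if q i \<eta> > 0 then 1 else 0))"
        unfolding p_def by (intro tendsto_prod tendsto_of_real gl qb)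
      also have "(\<Prod>i\<in>UNIV. complex_of_real (if q i \<eta> > 0 then 1 else 0)) = indicator (box a b \<inter> cube L) \<eta>"
      proof (cases "\<eta> \<in> box a b \<inter> cube L")
        case T: True
        then have "0 < q i \<eta>" for i using qpos[OF True] mem by blast
        then show ?thesis using T by simp
      next
        case F: False
        then obtain i where "\<not> 0 < q i \<eta>" using qpos[OF True] mem by blast
        then have "(\<Prod>i\<in>UNIV. complex_of_real (if q i \<eta> > 0 then 1 else 0)) = 0" by (intro prod_zero) auto
        then show ?thesis using F by simp
      qed
      finally show ?thesis using True by simp
    qed simp
    have boxL2: "(indicator (box a b \<inter> cube L) :: real^'d \<Rightarrow> complex) \<in> L2"
      by (rule L2_bound[OF _ indicator_cube_L2[of L], where C=1]) (auto simp: indicator_def)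
    show ?thesis
    proof (rule cube_approx_limit[where u="?u"])
      show "cube_approx L (?u n)" for n by (intro cube_approx_trig_poly p)
      show "(\<lambda>n. l2_norm (\<lambda>\<eta>. indicator (box a b \<inter> cube L) \<eta> - ?u n \<eta>)) \<longlonglongrightarrow> 0"
      proof (rule l2_norm_dominated[where g="\<lambda>\<eta>. (1 + 2 ^ CARD('d)) * indicator (cube L) \<eta>"])
        show "(\<lambda>\<eta>. indicator (box a b \<inter> cube L) \<eta> - ?u n \<eta>) \<in> L2" for n
          by (intro L2_diff boxL2 trig_poly_cube_L2 p)
        show "(\<lambda>\<eta>::real^'d. (1 + 2 ^ CARD('d)) * indicator (cube L) \<eta>) \<in> L2"
          by (intro L2_cmult indicator_cube_L2)
        show "(\<lambda>n. indicator (box a b \<inter> cube L) \<eta> - ?u n \<eta>) \<longlonglongrightarrow> 0" for \<eta>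
          using tendsto_diff[OF tendsto_const lim[of \<eta>], of "indicator (box a b \<inter> cube L) \<eta>"] by simp
        show "cmod (indicator (box a b \<inter> cube L) \<eta> - ?u n \<eta>) \<le> cmod ((1 + 2 ^ CARD('d)) * indicator (cube L) \<eta>)" for n \<eta>
        proof (cases "\<eta> \<in> cube L")
          case True
          have n1: "cmod (1 + 2 ^ CARD('d)) = 1 + 2 ^ CARD('d)"
            using norm_of_real[of "1 + 2 ^ CARD('d)", where 'a=complex] by simp
          have "cmod (indicator (box a b \<inter> cube L) \<eta> - p n \<eta>) \<le> 1 + 2 ^ CARD('d)"
            by (rule order_trans[OF norm_triangle_ineq4 add_mono[OF _ pb]]) (auto simp: indicator_def)
          then show ?thesis using True n1 by simp
        qed simp
      qed
    qed (rule boxL2)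
  qed
qed

text \<open>
  The boxes are stable under intersection and generate the Borel sets, and the approximable sets
  are closed under complements and disjoint unions.
\<close>

lemma cube_approx_indicator:
  fixes A :: "(real^'d::finite) set"
  assumes L: "0 < L" and A: "A \<in> sets borel"
  shows "cube_approx L (indicator (A \<inter> cube L))"
proof -
  let ?G = "range (\<lambda>(a, b). box a b :: (real^'d) set)"
  have cl2: "(indicator (B \<inter> cube L) :: real^'d \<Rightarrow> complex) \<in> L2" if [measurable]: "B \<in> sets borel" for B
    by (rule L2_bound[OF _ indicator_cube_L2[of L], where C=1]) (auto simp: indicator_def)
  have A': "A \<in> sigma_sets UNIV ?G" using A by (simp add: borel_eq_box)
  have bor: "B \<in> sets borel" if "B \<in> sigma_sets UNIV ?G" for B using that by (simp add: borel_eq_box)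
  have "Int_stable ?G" by (auto simp: Int_stable_def box_Int_box)
  moreover have "?G \<subseteq> Pow UNIV" by auto
  ultimately show ?thesis using A'
  proof (induction rule: sigma_sets_induct_disjoint)
    case (basic B)
    then show ?case using cube_approx_box[OF L] by auto
  next
    case empty
    then show ?case using cube_approx_zero[of L] by (simp add: indicator_def[abs_def])
  next
    case (compl B)
    have "cube_approx L (\<lambda>\<eta>. indicator (cube L) \<eta> * 1 + (-1) * indicator (B \<inter> cube L) \<eta> :: complex)"
      by (intro cube_approx_add cube_approx_cmult compl cube_approx_trig_poly trig_poly_const)
    also have "(\<lambda>\<eta>. indicator (cube L) \<eta> * 1 + (-1) * indicator (B \<inter> cube L) \<eta> :: complex) = indicator ((UNIV - B) \<inter> cube L)"
      by (auto simp: indicator_def fun_eq_iff)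
    finally show ?case .
  next
    case (union B)
    then have Bm [measurable]: "B i \<in> sets borel" for i using bor by blast
    let ?U = "\<Union>i. B i"
    have fin: "(\<Sum>i<n. indicator (B i \<inter> cube L) \<eta>) = (indicator ((\<Union>i<n. B i) \<inter> cube L) \<eta> :: complex)" for n \<eta>
      using union(1)
    proof (induction n)
      case (Suc n)
      have "B n \<inter> B i = {}" if "i < n" for i using Suc(2) that by (auto simp: disjoint_family_on_def)
      then have "indicator ((\<Union>i<Suc n. B i) \<inter> cube L) \<eta> =
          (indicator ((\<Union>i<n. B i) \<inter> cube L) \<eta> + indicator (B n \<inter> cube L) \<eta> :: complex)"
        by (cases "\<eta> \<in> B n \<inter> cube L") (auto simp: indicator_def less_Suc_eq)
      then show ?case using Suc by simp
    qed simp
    show ?case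
    proof (rule cube_approx_limit[where u="\<lambda>n \<eta>. \<Sum>i<n. indicator (B i \<inter> cube L) \<eta>"])
      show "cube_approx L (\<lambda>\<eta>. \<Sum>i<n. indicator (B i \<inter> cube L) \<eta>)" for n
        by (intro cube_approx_sum union)
      show "(\<lambda>n. l2_norm (\<lambda>\<eta>. indicator (?U \<inter> cube L) \<eta> - (\<Sum>i<n. indicator (B i \<inter> cube L) \<eta>))) \<longlonglongrightarrow> 0"
        unfolding fin
      proof (rule l2_norm_dominated[where g="indicator (cube L)"])
        show "(\<lambda>\<eta>. indicator (?U \<inter> cube L) \<eta> - indicator ((\<Union>i<n. B i) \<inter> cube L) \<eta> :: complex) \<in> L2" for n
          by (intro L2_diff cl2) measurable
        show "(\<lambda>n. indicator (?U \<inter> cube L) \<eta> - indicator ((\<Union>i<n. B i) \<inter> cube L) \<eta> :: complex) \<longlonglongrightarrow> 0" for \<eta>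
        proof (rule tendsto_eventually, cases "\<eta> \<in> ?U \<inter> cube L")
          case True
          then obtain i where i: "\<eta> \<in> B i" by blast
          show "\<forall>\<^sub>F n in sequentially. indicator (?U \<inter> cube L) \<eta> - indicator ((\<Union>i<n. B i) \<inter> cube L) \<eta> = (0::complex)"
            using eventually_gt_at_top[of i] by eventually_elim (use i True in \<open>auto simp: indicator_def\<close>)
        next
          case False
          then have "\<eta> \<notin> (\<Union>i<n. B i) \<inter> cube L" for n by auto
          then show "\<forall>\<^sub>F n in sequentially. indicator (?U \<inter> cube L) \<eta> - indicator ((\<Union>i<n. B i) \<inter> cube L) \<eta> = (0::complex)"
            using False by (intro always_eventually allI) (simp only: indicator_simps(2) not_False_eq_True diff_self)
        qed
        show "cmod (indicator (?U \<inter> cube L) \<eta> - indicator ((\<Union>i<n. B i) \<inter> cube L) \<eta>) \<le> cmod (indicator (cube L) \<eta>)" for n \<eta>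
          by (auto simp: indicator_def)
      qed (rule indicator_cube_L2)
    qed (rule cl2, measurable)
  qed
qed

lemma cube_approx_L2:
  fixes u :: "real^'d::finite \<Rightarrow> complex"
  assumes L: "0 < L" and u: "u \<in> L2" and supp: "\<And>\<eta>. \<eta> \<notin> cube L \<Longrightarrow> u \<eta> = 0"
  shows "cube_approx L u"
proof -
  have um: "u \<in> borel_measurable borel" using u by auto
  from borel_measurable_implies_sequence_metric[OF um, of 0] obtain F
    where F: "\<And>i. simple_function borel (F i)" "\<And>x. (\<lambda>i. F i x) \<longlonglongrightarrow> u x"
      and bd: "\<And>i x. cmod (F i x) \<le> 2 * cmod (u x)" by auto
  have Fs: "F i \<eta> = (\<Sum>y\<in>range (F i). y * indicator (F i -` {y} \<inter> cube L) \<eta>)" for i \<eta>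
  proof (cases "\<eta> \<in> cube L")
    case True
    have "finite (range (F i))" using F(1)[of i] by (simp add: simple_function_def)
    then have "(\<Sum>y\<in>range (F i). y * indicator (F i -` {y} \<inter> cube L) \<eta>) = (\<Sum>y\<in>range (F i). if F i \<eta> = y then y else 0)"
      using True by (intro sum.cong) (auto simp: indicator_def)
    also have "\<dots> = F i \<eta>" using \<open>finite (range (F i))\<close> by (simp add: sum.delta)
    finally show ?thesis by simp
  next
    case False
    then have "F i \<eta> = 0" using bd[of i \<eta>] supp[of \<eta>] by simp
    then show ?thesis using False by simp
  qed
  have FA: "cube_approx L (F i)" for i
  proof -
    have "cube_approx L (\<lambda>\<eta>. \<Sum>y\<in>range (F i). y * indicator (F i -` {y} \<inter> cube L) \<eta>)"
    proof (intro cube_approx_sum cube_approx_cmult cube_approx_indicator L)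
      fix y show "F i -` {y} \<in> sets borel"
        using measurable_sets[OF borel_measurable_simple_function[OF F(1)[of i]], of "{y}"] by simp
    qed
    then show ?thesis by (simp add: Fs[symmetric])
  qed
  show ?thesis
  proof (rule cube_approx_limit[OF FA u])
    show "(\<lambda>n. l2_norm (\<lambda>\<eta>. u \<eta> - F n \<eta>)) \<longlonglongrightarrow> 0"
    proof (rule l2_norm_dominated[where g="\<lambda>\<eta>. 3 * u \<eta>"])
      show "(\<lambda>n. u \<eta> - F n \<eta>) \<longlonglongrightarrow> 0" for \<eta>
        using tendsto_diff[OF tendsto_const F(2)[of \<eta>], of "u \<eta>"] by simp
      show "cmod (u \<eta> - F n \<eta>) \<le> cmod (3 * u \<eta>)" for n \<eta>
        using norm_triangle_ineq4[of "u \<eta>" "F n \<eta>"] bd[of n \<eta>] by (simp add: norm_mult)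
      show "(\<lambda>\<eta>. u \<eta> - F n \<eta>) \<in> L2" for n
        using FA[of n] by (intro L2_diff u) (simp add: cube_approx_def)
    qed (intro L2_cmult u)
  qed
qed

section \<open>Parseval for Fourier series\<close>

lemma has_sum_nonneg_realI:
  fixes f :: "'a \<Rightarrow> real"
  assumes nn: "\<And>x. x \<in> A \<Longrightarrow> 0 \<le> f x"
    and up: "\<And>F. finite F \<Longrightarrow> F \<subseteq> A \<Longrightarrow> sum f F \<le> S"
    and low: "\<And>\<epsilon>. 0 < \<epsilon> \<Longrightarrow> \<exists>F. finite F \<and> F \<subseteq> A \<and> S - \<epsilon> < sum f F"
  shows "(f has_sum S) A"
  unfolding has_sum_def
proof (rule tendstoI)
  fix \<epsilon> :: real assume "0 < \<epsilon>"
  then obtain F where F: "finite F" "F \<subseteq> A" "S - \<epsilon> < sum f F" using low by blast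
  show "\<forall>\<^sub>F X in finite_subsets_at_top A. dist (sum f X) S < \<epsilon>"
    unfolding eventually_finite_subsets_at_top
  proof (intro exI[of _ F] conjI allI impI F)
    fix X assume X: "finite X \<and> F \<subseteq> X \<and> X \<subseteq> A"
    then have "sum f F \<le> sum f X" by (intro sum_mono2) (auto intro: nn)
    moreover have "sum f X \<le> S" using X by (intro up) auto
    ultimately show "dist (sum f X) S < \<epsilon>" using F by (simp add: dist_real_def)
  qed
qed

text \<open>
  Pythagoras for an orthogonal family whose members all have squared norm \<open>(2 * L) ^ CARD('d)\<close>.
\<close>

lemma l2_norm_sq_diff_orthogonal:
  fixes F :: "(int^'d::finite) set" and c :: "int^'d \<Rightarrow> complex"
  assumes L: "0 < L" and u: "u \<in> L2" and F: "finite F"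
  shows "(l2_norm (\<lambda>\<eta>. u \<eta> - (\<Sum>j\<in>F. c j * cube_char L j \<eta>)))\<^sup>2 = (l2_norm u)\<^sup>2 +
     (\<Sum>j\<in>F. (2 * L) ^ CARD('d) * (cmod (c j))\<^sup>2 - 2 * Re (cnj (c j) * l2_inner u (cube_char L j)))"
proof -
  define V where "V = (2 * L) ^ CARD('d)"
  let ?P = "\<lambda>\<eta>. \<Sum>j\<in>F. c j * cube_char L j \<eta>"
  have PL: "?P \<in> L2" by (intro L2_sum L2_cmult cube_char_L2)
  have uP: "l2_inner v ?P = (\<Sum>j\<in>F. cnj (c j) * l2_inner v (cube_char L j))" if "v \<in> L2" for v
  proof -
    have "l2_inner v ?P = cnj (l2_inner ?P v)" by (rule l2_inner_commute)
    also have "l2_inner ?P v = (\<Sum>j\<in>F. l2_inner (\<lambda>\<eta>. c j * cube_char L j \<eta>) v)"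
      by (intro l2_inner_sum_left that L2_cmult cube_char_L2)
    also have "\<dots> = (\<Sum>j\<in>F. c j * cnj (l2_inner v (cube_char L j)))"
      by (simp add: l2_inner_cmult_left l2_inner_commute[of _ v])
    finally show ?thesis by simp
  qed
  have "l2_inner ?P (cube_char L j) = c j * of_real V" if "j \<in> F" for j
  proof -
    have "l2_inner ?P (cube_char L j) = (\<Sum>l\<in>F. l2_inner (\<lambda>\<eta>. c l * cube_char L l \<eta>) (cube_char L j))"
      by (intro l2_inner_sum_left L2_cmult cube_char_L2)
    also have "\<dots> = (\<Sum>l\<in>F. if l = j then c l * of_real V else 0)"
      by (intro sum.cong refl) (simp add: l2_inner_cmult_left cube_char_orthogonal[OF L] V_def)
    finally show ?thesis using F that by simp
  qed
  then have "l2_inner ?P ?P = (\<Sum>j\<in>F. cnj (c j) * (c j * of_real V))"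
    by (simp add: uP[OF PL])
  also have "\<dots> = of_real (\<Sum>j\<in>F. V * (cmod (c j))\<^sup>2)"
    by (simp only: of_real_sum of_real_mult complex_norm_square) (simp add: ac_simps)
  finally have PP: "(l2_norm ?P)\<^sup>2 = (\<Sum>j\<in>F. V * (cmod (c j))\<^sup>2)"
    unfolding l2_inner_self of_real_eq_iff .
  have "(l2_norm (\<lambda>\<eta>. u \<eta> + (- 1) * ?P \<eta>))\<^sup>2 = (l2_norm u)\<^sup>2 + 2 * Re (l2_inner u (\<lambda>\<eta>. (-1) * ?P \<eta>)) + (l2_norm (\<lambda>\<eta>. (-1) * ?P \<eta>))\<^sup>2"
    by (intro l2_norm_sq_expand u L2_cmult PL)
  also have "l2_inner u (\<lambda>\<eta>. (-1) * ?P \<eta>) = - l2_inner u ?P"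
    by (subst (1 2) l2_inner_commute, subst l2_inner_cmult_left) simp
  also have "l2_norm (\<lambda>\<eta>. (-1) * ?P \<eta>) = l2_norm ?P"
    unfolding l2_norm_cmult by simp
  finally show ?thesis
    unfolding V_def[symmetric]
    by (simp add: uP[OF u] PP sum_subtractf sum_distrib_left[symmetric] sum_negf Re_sum[symmetric] del: Re_sum times_complex.sel)
qed

lemma trig_poly_sum_form:
  "trig_poly L p \<Longrightarrow> \<exists>F c. finite F \<and> (\<forall>\<eta>. p \<eta> = (\<Sum>j\<in>F. c j * torus_char L j \<eta>))"
proof (induction rule: trig_poly.induct)
  case (char a j)
  show ?case by (rule exI[of _ "{j}"], rule exI[of _ "\<lambda>_. a"]) simp
next
  case (add p q)
  then obtain F c G d where F: "finite F" "\<And>\<eta>. p \<eta> = (\<Sum>j\<in>F. c j * torus_char L j \<eta>)"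
    and G: "finite G" "\<And>\<eta>. q \<eta> = (\<Sum>j\<in>G. d j * torus_char L j \<eta>)" by blast
  have "p \<eta> + q \<eta> = (\<Sum>j\<in>F\<union>G. ((if j \<in> F then c j else 0) + (if j \<in> G then d j else 0)) * torus_char L j \<eta>)" for \<eta>
  proof -
    have "p \<eta> = (\<Sum>j\<in>F\<union>G. (if j \<in> F then c j else 0) * torus_char L j \<eta>)"
      unfolding F using F(1) G(1) by (intro sum.mono_neutral_cong_left) auto
    moreover have "q \<eta> = (\<Sum>j\<in>F\<union>G. (if j \<in> G then d j else 0) * torus_char L j \<eta>)"
      unfolding G using F(1) G(1) by (intro sum.mono_neutral_cong_left) auto
    ultimately show ?thesis by (simp add: distrib_right sum.distrib)
  qed
  then show ?case using F(1) G(1)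
    by (intro exI[of _ "F \<union> G"] exI[of _ "\<lambda>j. (if j \<in> F then c j else 0) + (if j \<in> G then d j else 0)"]) simp
qed

text \<open>
  The upper bound for finite partial sums is Bessel's inequality.  For the lower bound, a
  trigonometric polynomial close to \<open>u\<close> uses finitely many characters, and the optimal
  coefficients for these characters approximate at least as well.
\<close>

theorem fourier_series_parseval:
  fixes u :: "real^'d::finite \<Rightarrow> complex"
  assumes L: "0 < L" and u: "u \<in> L2" and supp: "\<And>\<eta>. \<eta> \<notin> cube L \<Longrightarrow> u \<eta> = 0"
  shows "((\<lambda>j::int^'d. (cmod (l2_inner u (cube_char L j)))\<^sup>2) has_sum ((2 * L) ^ CARD('d) * (l2_norm u)\<^sup>2)) UNIV"
proof -
  define V where "V = (2 * L) ^ CARD('d)"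
  let ?c = "\<lambda>j. l2_inner u (cube_char L j)"
  have V: "0 < V" using L by (simp add: V_def)
  note expand = l2_norm_sq_diff_orthogonal[OF L u, folded V_def]
  have "((\<lambda>j. (cmod (?c j))\<^sup>2) has_sum (V * (l2_norm u)\<^sup>2)) UNIV"
  proof (rule has_sum_nonneg_realI)
  show "(\<Sum>j\<in>F. (cmod (?c j))\<^sup>2) \<le> V * (l2_norm u)\<^sup>2" if "finite F" for F
  proof -
    have "0 \<le> (l2_norm (\<lambda>\<eta>. u \<eta> - (\<Sum>j\<in>F. (?c j / of_real V) * cube_char L j \<eta>)))\<^sup>2" by simp
    also have "\<dots> = (l2_norm u)\<^sup>2 + (\<Sum>j\<in>F. V * (cmod (?c j / of_real V))\<^sup>2 - 2 * Re (cnj (?c j / of_real V) * ?c j))"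
      by (rule expand[OF that])
    also have "(\<lambda>j. V * (cmod (?c j / of_real V))\<^sup>2 - 2 * Re (cnj (?c j / of_real V) * ?c j)) = (\<lambda>j. - (cmod (?c j))\<^sup>2 / V)"
    proof
      fix j
      have a: "Re (cnj (?c j / of_real V) * ?c j) = (cmod (?c j))\<^sup>2 / V"
        unfolding cmod_power2 by (simp add: power2_eq_square add_divide_distrib del: of_real_power of_real_mult)
      have b: "V * (cmod (?c j / of_real V))\<^sup>2 = (cmod (?c j))\<^sup>2 / V"
        using V by (simp add: norm_divide power_divide power2_eq_square[of V])
      show "V * (cmod (?c j / of_real V))\<^sup>2 - 2 * Re (cnj (?c j / of_real V) * ?c j) = - (cmod (?c j))\<^sup>2 / V"
        unfolding a b by simp
    qed
    also have "(l2_norm u)\<^sup>2 + (\<Sum>j\<in>F. - (cmod (?c j))\<^sup>2 / V) = (l2_norm u)\<^sup>2 - (\<Sum>j\<in>F. (cmod (?c j))\<^sup>2) / V"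
      by (simp add: sum_negf sum_divide_distrib)
    finally show ?thesis using V by (simp add: pos_divide_le_eq mult.commute)
  qed
  fix \<epsilon> :: real assume "0 < \<epsilon>"
  then have "0 < sqrt (\<epsilon> / V)" using V by simp
  then obtain p where p: "trig_poly L p" and pe: "l2_norm (\<lambda>\<eta>. u \<eta> - indicator (cube L) \<eta> * p \<eta>) < sqrt (\<epsilon> / V)"
    using cube_approx_L2[OF assms] unfolding cube_approx_def by blast
  obtain F c where F: "finite F" and pF: "\<And>\<eta>. p \<eta> = (\<Sum>j\<in>F. c j * torus_char L j \<eta>)"
    using trig_poly_sum_form[OF p] by blast
  have "(l2_norm (\<lambda>\<eta>. u \<eta> - indicator (cube L) \<eta> * p \<eta>))\<^sup>2 < (sqrt (\<epsilon> / V))\<^sup>2"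
    using pe by (intro power_strict_mono) auto
  also have "(\<lambda>\<eta>. u \<eta> - indicator (cube L) \<eta> * p \<eta>) = (\<lambda>\<eta>. u \<eta> - (\<Sum>j\<in>F. c j * cube_char L j \<eta>))"
    by (simp add: pF cube_char_def sum_distrib_left ac_simps)
  also have "(l2_norm \<dots>)\<^sup>2 = (l2_norm u)\<^sup>2 + (\<Sum>j\<in>F. V * (cmod (c j))\<^sup>2 - 2 * Re (cnj (c j) * ?c j))"
    by (rule expand[OF F])
  also have "(sqrt (\<epsilon> / V))\<^sup>2 = \<epsilon> / V" using \<open>0 < \<epsilon>\<close> V by simp
  finally have A: "(l2_norm u)\<^sup>2 + (\<Sum>j\<in>F. V * (cmod (c j))\<^sup>2 - 2 * Re (cnj (c j) * ?c j)) < \<epsilon> / V" .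
  have B: "- (cmod (?c j))\<^sup>2 / V \<le> V * (cmod (c j))\<^sup>2 - 2 * Re (cnj (c j) * ?c j)" for j
  proof -
    have "Re (cnj (c j) * ?c j) \<le> cmod (c j) * cmod (?c j)"
      by (metis complex_Re_le_cmod norm_mult complex_mod_cnj)
    moreover have "0 \<le> (V * cmod (c j) - cmod (?c j))\<^sup>2 / V" using V by simp
    moreover have "(V * cmod (c j) - cmod (?c j))\<^sup>2 / V = V * (cmod (c j))\<^sup>2 - 2 * (cmod (c j) * cmod (?c j)) + (cmod (?c j))\<^sup>2 / V"
      using V by (simp add: power2_eq_square field_simps)
    ultimately show ?thesis by simp
  qed
  have "(\<Sum>j\<in>F. - (cmod (?c j))\<^sup>2 / V) \<le> (\<Sum>j\<in>F. V * (cmod (c j))\<^sup>2 - 2 * Re (cnj (c j) * ?c j))"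
    by (intro sum_mono B)
  then have "(l2_norm u)\<^sup>2 - (\<Sum>j\<in>F. (cmod (?c j))\<^sup>2) / V < \<epsilon> / V"
    using A by (simp add: sum_negf sum_divide_distrib)
  then have "V * ((l2_norm u)\<^sup>2 - (\<Sum>j\<in>F. (cmod (?c j))\<^sup>2) / V) < V * (\<epsilon> / V)"
    by (intro mult_strict_left_mono V)
  then have "V * (l2_norm u)\<^sup>2 - \<epsilon> < (\<Sum>j\<in>F. (cmod (?c j))\<^sup>2)"
    using V by (simp add: right_diff_distrib)
  then show "\<exists>F. finite F \<and> F \<subseteq> UNIV \<and> V * (l2_norm u)\<^sup>2 - \<epsilon> < (\<Sum>j\<in>F. (cmod (?c j))\<^sup>2)"
    using F by blast
qed simp
  then show ?thesis by (simp only: V_def)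
qed

section \<open>Plancherel's theorem\<close>

lemma has_sum_nn_integral:
  fixes f :: "'a \<Rightarrow> real"
  assumes "(f has_sum S) A" "\<And>x. x \<in> A \<Longrightarrow> 0 \<le> f x"
  shows "(\<integral>\<^sup>+x. ennreal (f x) \<partial>count_space A) = ennreal S"
proof -
  have "(\<lambda>x. norm (f x)) summable_on A"
    using assms by (subst summable_on_cong[of A _ f]) (auto intro: has_sum_imp_summable)
  then have s: "Infinite_Set_Sum.abs_summable_on f A"
    by (rule iffD1[OF abs_summable_equivalent])
  have "(\<integral>\<^sup>+x. ennreal (f x) \<partial>count_space A) = ennreal (infsetsum f A)"
    by (rule nn_integral_conv_infsetsum[OF s assms(2)])
  also have "infsetsum f A = S"
    unfolding infsetsum_infsum[OF s] using assms(1) by (rule infsumI)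
  finally show ?thesis .
qed

lemma nn_integral_lborel_shift:
  fixes c :: "'a::euclidean_space"
  assumes [measurable]: "g \<in> borel_measurable borel"
  shows "(\<integral>\<^sup>+x. g (x + c) \<partial>lborel) = (\<integral>\<^sup>+x. g x \<partial>lborel)"
proof -
  have "(\<integral>\<^sup>+x. g x \<partial>lborel) = (\<integral>\<^sup>+x. g x \<partial>(distr lborel borel ((+) c)))"
    by (simp add: lborel_distr_plus)
  also have "\<dots> = (\<integral>\<^sup>+x. g (x + c) \<partial>lborel)"
    by (subst nn_integral_distr) (auto simp: add.commute)
  finally show ?thesis by simp
qed

lemma half_open_cube_measurable [measurable]: "half_open_cube c h \<in> sets borel"
proof -
  have "half_open_cube c h = {x. \<forall>i. x \<in> {x. c $ i \<le> x $ i \<and> x $ i < c $ i + h}}"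
    by (auto simp: half_open_cube_def)
  also have "\<dots> = (\<Inter>i. {x. c $ i \<le> x $ i} \<inter> {x. x $ i < c $ i + h})" by auto
  also have "\<dots> \<in> sets borel"
    by (intro sets.countable_INT'' sets.Int borel_closed borel_open)
       (auto simp: closed_Collect_le open_Collect_less continuous_on_component)
  finally show ?thesis .
qed

lemma unique_tile:
  assumes "0 < h"
  shows "x - h *\<^sub>R ivec j \<in> half_open_cube 0 h \<longleftrightarrow> j = (\<chi> i. \<lfloor>x $ i / h\<rfloor>)"
proof -
  have "0 \<le> x $ i - h * of_int (j $ i) \<and> x $ i - h * of_int (j $ i) < h \<longleftrightarrow> \<lfloor>x $ i / h\<rfloor> = j $ i" for i
    using assms by (auto simp: floor_eq_iff field_simps)
  then show ?thesis by (auto simp: half_open_cube_def ivec_def vec_eq_iff)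
qed

lemma emeasure_half_open_cube:
  assumes "0 < h"
  shows "emeasure lborel (half_open_cube (0::real^'d::finite) h) = ennreal (h ^ CARD('d))"
proof (rule antisym)
  have "0 \<in> cbox 0 (\<chi> i. h :: real^'d)" using assms by (simp add: mem_box_cart)
  then have ne: "cbox 0 (\<chi> i. h :: real^'d) \<noteq> {}" by blast
  have vol: "emeasure lborel (cbox 0 (\<chi> i. h :: real^'d)) = ennreal (h ^ CARD('d))"
    by (subst emeasure_eq_ennreal_measure) (use emeasure_lborel_cbox_finite[of 0 "\<chi> i. h :: real^'d"] in \<open>auto simp: content_cbox_cart[OF ne] less_top[symmetric]\<close>)
  have "half_open_cube 0 h \<subseteq> cbox 0 (\<chi> i. h :: real^'d)"
    by (auto simp: half_open_cube_def mem_box_cart less_imp_le)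
  then have "emeasure lborel (half_open_cube (0::real^'d) h) \<le> emeasure lborel (cbox 0 (\<chi> i. h :: real^'d))"
    by (intro emeasure_mono) auto
  also have "\<dots> = ennreal (h ^ CARD('d))"
    by (rule vol)
  finally show "emeasure lborel (half_open_cube (0::real^'d) h) \<le> ennreal (h ^ CARD('d))" .
  have "box 0 (\<chi> i. h :: real^'d) \<subseteq> half_open_cube 0 h"
    by (auto simp: half_open_cube_def mem_box_cart less_imp_le)
  then have "emeasure lborel (box 0 (\<chi> i. h :: real^'d)) \<le> emeasure lborel (half_open_cube (0::real^'d) h)"
    by (intro emeasure_mono) auto
  moreover have "emeasure lborel (box 0 (\<chi> i. h :: real^'d)) = emeasure lborel (cbox 0 (\<chi> i. h :: real^'d))"
    by (simp add: emeasure_lborel_box_eq emeasure_lborel_cbox_eq)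
  moreover have "emeasure lborel (cbox 0 (\<chi> i. h :: real^'d)) = ennreal (h ^ CARD('d))"
    by (rule vol)
  ultimately show "ennreal (h ^ CARD('d)) \<le> emeasure lborel (half_open_cube (0::real^'d) h)" by simp
qed

text \<open>
  Every point lies in exactly one translate of the half-open cube by the grid.
\<close>

lemma nn_integral_tiling:
  fixes g :: "real^'d::finite \<Rightarrow> ennreal"
  assumes [measurable]: "g \<in> borel_measurable borel" and h: "0 < h"
  shows "(\<integral>\<^sup>+x. g x \<partial>lborel) =
    (\<integral>\<^sup>+x. (\<integral>\<^sup>+j. g (x + h *\<^sub>R ivec j) \<partial>count_space (UNIV::(int^'d) set)) * indicator (half_open_cube 0 h) x \<partial>lborel)"
proof -
  let ?T = "half_open_cube (0::real^'d) h"
  have one: "(\<integral>\<^sup>+j. indicator ?T (x - h *\<^sub>R ivec j) \<partial>count_space (UNIV::(int^'d) set)) = (1::ennreal)" for x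
  proof -
    have "(\<integral>\<^sup>+j. indicator ?T (x - h *\<^sub>R ivec j) \<partial>count_space (UNIV::(int^'d) set)) =
      (\<integral>\<^sup>+j. indicator {\<chi> i. \<lfloor>x $ i / h\<rfloor>} j \<partial>count_space (UNIV::(int^'d) set))"
      by (intro nn_integral_cong) (simp add: indicator_def unique_tile[OF h])
    then show ?thesis by simp
  qed
  have sh[measurable]: "(\<lambda>x. x - h *\<^sub>R ivec j) \<in> borel_measurable borel" "(\<lambda>x. x + h *\<^sub>R ivec j) \<in> borel_measurable borel" for j :: "int^'d"
    by measurable
  have "(\<integral>\<^sup>+x. g x \<partial>lborel) = (\<integral>\<^sup>+x. (\<integral>\<^sup>+j. g x * indicator ?T (x - h *\<^sub>R ivec j) \<partial>count_space (UNIV::(int^'d) set)) \<partial>lborel)"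
    by (subst nn_integral_cmult) (auto simp: one)
  also have "\<dots> = (\<integral>\<^sup>+j. (\<integral>\<^sup>+x. g x * indicator ?T (x - h *\<^sub>R ivec j) \<partial>lborel) \<partial>count_space (UNIV::(int^'d) set))"
    by (rule nn_integral_count_space_nn_integral) auto
  also have "\<dots> = (\<integral>\<^sup>+j. (\<integral>\<^sup>+x. g (x + h *\<^sub>R ivec j) * indicator ?T x \<partial>lborel) \<partial>count_space (UNIV::(int^'d) set))"
  proof (rule nn_integral_cong)
    fix j :: "int^'d"
    show "(\<integral>\<^sup>+x. g x * indicator ?T (x - h *\<^sub>R ivec j) \<partial>lborel) = (\<integral>\<^sup>+x. g (x + h *\<^sub>R ivec j) * indicator ?T x \<partial>lborel)"
      by (subst nn_integral_lborel_shift[symmetric, where c="h *\<^sub>R ivec j"]) auto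
  qed
  also have "\<dots> = (\<integral>\<^sup>+x. (\<integral>\<^sup>+j. g (x + h *\<^sub>R ivec j) * indicator ?T x \<partial>count_space (UNIV::(int^'d) set)) \<partial>lborel)"
    by (rule nn_integral_count_space_nn_integral[symmetric]) auto
  also have "\<dots> = (\<integral>\<^sup>+x. (\<integral>\<^sup>+j. g (x + h *\<^sub>R ivec j) \<partial>count_space (UNIV::(int^'d) set)) * indicator ?T x \<partial>lborel)"
    by (subst nn_integral_multc) auto
  finally show ?thesis .
qed

lemma fourier_measurable [measurable]:
  fixes f :: "'v::euclidean_space \<Rightarrow> complex"
  assumes [measurable]: "f \<in> borel_measurable borel"
  shows "fourier f \<in> borel_measurable borel"
proof -
  have [measurable]: "(\<lambda>x::'v\<times>'v. cis (- (snd x \<bullet> fst x))) \<in> borel_measurable (borel \<Otimes>\<^sub>M borel)"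
    unfolding borel_prod by (intro borel_measurable_continuous_onI continuous_intros)
  have "(\<lambda>\<eta>. LINT t|lborel. f t * cis (- (t \<bullet> \<eta>))) \<in> borel_measurable borel"
  proof (rule lborel.borel_measurable_lebesgue_integral)
    have "(\<lambda>x::'v\<times>'v. f (snd x) * cis (- (snd x \<bullet> fst x))) \<in> borel_measurable (borel \<Otimes>\<^sub>M lborel)"
      by measurable
    then show "(\<lambda>(\<eta>, t). f t * cis (- (t \<bullet> \<eta>))) \<in> borel_measurable (borel \<Otimes>\<^sub>M lborel)"
      by (simp add: case_prod_beta')
  qed
  then show ?thesis by (simp add: fourier_def[abs_def])
qed

lemma L2_nn_integral:
  assumes "f \<in> L2"
  shows "(\<integral>\<^sup>+t. ennreal ((cmod (f t))\<^sup>2) \<partial>lborel) = ennreal ((l2_norm f)\<^sup>2)"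
  unfolding l2_norm_sq by (rule nn_integral_eq_integral[OF L2_integrable_sq[OF assms]]) simp

lemma L2_from_nn_integral:
  assumes "f \<in> borel_measurable borel" "(\<integral>\<^sup>+t. ennreal ((cmod (f t))\<^sup>2) \<partial>lborel) \<le> ennreal (r\<^sup>2)" "0 \<le> r"
  shows "f \<in> L2" "l2_norm f \<le> r"
proof -
  show L: "f \<in> L2"
  proof (rule L2_I[OF assms(1)])
    show "integrable lborel (\<lambda>t. (cmod (f t))\<^sup>2)"
      using assms(1) le_less_trans[OF assms(2)] by (intro integrableI_bounded) auto
  qed
  have "(l2_norm f)\<^sup>2 \<le> r\<^sup>2"
    using assms(2) unfolding L2_nn_integral[OF L] by simp
  then show "l2_norm f \<le> r" using assms(3) by (rule power2_le_imp_le)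
qed

lemma cis_mult_integrable:
  fixes f :: "'v::euclidean_space \<Rightarrow> complex"
  assumes "integrable lborel f"
  shows "integrable lborel (\<lambda>t. f t * cis (- (t \<bullet> \<eta>)))"
proof (rule Bochner_Integration.integrable_bound[OF assms])
  have [measurable]: "(\<lambda>t::'v. cis (- (t \<bullet> \<eta>))) \<in> borel_measurable borel"
    by (intro borel_measurable_continuous_onI continuous_intros)
  show "(\<lambda>t. f t * cis (- (t \<bullet> \<eta>))) \<in> borel_measurable lborel"
    using assms by measurable
qed (simp add: norm_mult)

text \<open>
  With \<open>h = pi / L\<close>, the values of \<open>fourier f\<close> on the shifted grid \<open>\<theta> + h *\<^sub>R ivec j\<close> are the Fourier
  coefficients of \<open>f\<close> modulated by \<open>\<theta>\<close>.  By Parseval's identity the sum of their squares does not depend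
  on \<open>\<theta>\<close>, and integrating over one tile of the grid yields the integral over the whole space.
\<close>

lemma plancherel_cube:
  fixes f :: "real^'d::finite \<Rightarrow> complex"
  assumes L: "0 < L" and f: "f \<in> L2" and supp: "\<And>t. t \<notin> cube L \<Longrightarrow> f t = 0"
  shows "(\<integral>\<^sup>+\<eta>. ennreal ((cmod (fourier f \<eta>))\<^sup>2) \<partial>lborel) = ennreal ((2 * pi) ^ CARD('d) * (l2_norm f)\<^sup>2)"
proof -
  define h where "h = pi / L"
  have h: "0 < h" using L by (simp add: h_def)
  let ?T = "half_open_cube (0::real^'d) h" and ?V = "(2 * L) ^ CARD('d)"
  have [measurable]: "(\<lambda>t::real^'d. cis (- (t \<bullet> \<theta>))) \<in> borel_measurable borel" for \<theta>
    by (intro borel_measurable_continuous_onI continuous_intros)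
  have [measurable]: "f \<in> borel_measurable borel" using f by auto
  have key: "(\<integral>\<^sup>+j. ennreal ((cmod (fourier f (\<theta> + h *\<^sub>R ivec j)))\<^sup>2) \<partial>count_space (UNIV::(int^'d) set)) = ennreal (?V * (l2_norm f)\<^sup>2)" for \<theta>
  proof -
    let ?u = "\<lambda>t. f t * cis (- (t \<bullet> \<theta>))"
    have u: "?u \<in> L2" by (rule L2_bound[OF _ f, where C=1]) (auto simp: norm_mult)
    have nu: "l2_norm ?u = l2_norm f" by (simp add: l2_norm_def norm_mult)
    have c: "l2_inner ?u (cube_char L j) = fourier f (\<theta> + h *\<^sub>R ivec j)" for j
      unfolding l2_inner_def fourier_def
    proof (intro Bochner_Integration.integral_cong refl)
      fix t
      have "t \<bullet> (\<theta> + h *\<^sub>R ivec j) = t \<bullet> \<theta> + h * (ivec j \<bullet> t)" by (simp add: inner_add_right inner_commute)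
      then show "?u t * cnj (cube_char L j t) = f t * cis (- (t \<bullet> (\<theta> + h *\<^sub>R ivec j)))"
        using supp[of t] by (cases "t \<in> cube L") (simp_all add: cube_char_def torus_char_def h_def cis_cnj cis_mult)
    qed
    have "((\<lambda>j::int^'d. (cmod (fourier f (\<theta> + h *\<^sub>R ivec j)))\<^sup>2) has_sum (?V * (l2_norm f)\<^sup>2)) UNIV"
      using fourier_series_parseval[OF L u] supp unfolding c nu by simp
    then show ?thesis by (rule has_sum_nn_integral) simp
  qed
  have "(\<integral>\<^sup>+\<eta>. ennreal ((cmod (fourier f \<eta>))\<^sup>2) \<partial>lborel) = (\<integral>\<^sup>+\<theta>. ennreal (?V * (l2_norm f)\<^sup>2) * indicator ?T \<theta> \<partial>lborel)"
    by (subst nn_integral_tiling[OF _ h]) (simp_all add: key)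
  also have "\<dots> = ennreal (?V * (l2_norm f)\<^sup>2) * ennreal (h ^ CARD('d))"
    by (subst nn_integral_cmult_indicator) (auto simp: emeasure_half_open_cube[OF h])
  also have "\<dots> = ennreal (?V * (l2_norm f)\<^sup>2 * h ^ CARD('d))"
    using L h by (subst ennreal_mult) auto
  also have "?V * (l2_norm f)\<^sup>2 * h ^ CARD('d) = (2 * pi) ^ CARD('d) * (l2_norm f)\<^sup>2"
  proof -
    have "?V * h ^ CARD('d) = (2 * pi) ^ CARD('d)"
      unfolding power_mult_distrib[symmetric] h_def using L by simp
    then show ?thesis by (simp add: ac_simps)
  qed
  finally show ?thesis .
qed

definition L1L2 :: "('v::euclidean_space \<Rightarrow> complex) set" where
  "L1L2 = {f \<in> L2. integrable lborel f}"

lemma L1L2_D: "f \<in> L1L2 \<Longrightarrow> f \<in> L2" "f \<in> L1L2 \<Longrightarrow> integrable lborel f"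
  by (auto simp: L1L2_def)

lemma L1L2_diff: "f \<in> L1L2 \<Longrightarrow> g \<in> L1L2 \<Longrightarrow> (\<lambda>t. f t - g t) \<in> L1L2"
  by (auto simp: L1L2_def L2_diff)

lemma L1L2_add: "f \<in> L1L2 \<Longrightarrow> g \<in> L1L2 \<Longrightarrow> (\<lambda>t. f t + g t) \<in> L1L2"
  by (auto simp: L1L2_def L2_add)

lemma L1L2_cmult: "f \<in> L1L2 \<Longrightarrow> (\<lambda>t. c * f t) \<in> L1L2"
  by (auto simp: L1L2_def L2_cmult)

lemma truncate_L1L2: "f \<in> L2 \<Longrightarrow> truncate n f \<in> L1L2"
  by (simp add: L1L2_def truncate_L2 truncate_integrable)

lemma fourier_add: "integrable lborel f \<Longrightarrow> integrable lborel g \<Longrightarrow>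
    fourier (\<lambda>t. f t + g t) \<eta> = fourier f \<eta> + fourier g \<eta>"
  unfolding fourier_def by (simp add: distrib_right cis_mult_integrable)

lemma fourier_diff: "integrable lborel f \<Longrightarrow> integrable lborel g \<Longrightarrow>
    fourier (\<lambda>t. f t - g t) \<eta> = fourier f \<eta> - fourier g \<eta>"
  unfolding fourier_def by (simp add: left_diff_distrib cis_mult_integrable)

lemma fourier_cmult: "fourier (\<lambda>t. c * f t) \<eta> = c * fourier f \<eta>"
  unfolding fourier_def by (simp add: mult.assoc)

lemma fourier_truncate_tendsto:
  assumes "integrable lborel f"
  shows "(\<lambda>n. fourier (truncate n f) \<eta>) \<longlonglongrightarrow> fourier f \<eta>"
proof -
  have [measurable]: "f \<in> borel_measurable borel" using assms by auto
  have [measurable]: "(\<lambda>t. cis (- (t \<bullet> \<eta>))) \<in> borel_measurable borel"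
    by (intro borel_measurable_continuous_onI continuous_intros)
  show ?thesis
    unfolding fourier_def
  proof (rule integral_dominated_convergence[where w="\<lambda>t. cmod (f t)"])
    show "AE t in lborel. (\<lambda>n. truncate n f t * cis (- (t \<bullet> \<eta>))) \<longlonglongrightarrow> f t * cis (- (t \<bullet> \<eta>))"
      by (intro AE_I2 tendsto_mult truncate_pointwise tendsto_const)
    show "AE t in lborel. norm (truncate n f t * cis (- (t \<bullet> \<eta>))) \<le> cmod (f t)" for n
      by (intro AE_I2) (simp add: norm_mult cmod_truncate)
    show "integrable lborel (\<lambda>t. cmod (f t))" using assms by (rule integrable_norm)
  qed measurable
qed

lemma cball_subset_cube: "cball 0 r \<subseteq> cube (r + 1)"
proof
  fix x :: "real^'a" assume "x \<in> cball 0 r"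
  then have "norm x \<le> r" by simp
  then show "x \<in> cube (r + 1)"
    unfolding mem_cube using component_le_norm_cart[of x] by (meson le_less_trans less_add_one order_trans)
qed

lemma plancherel_bounded_support:
  fixes f :: "real^'d::finite \<Rightarrow> complex"
  assumes f: "f \<in> L2" and supp: "\<And>t. t \<notin> cball 0 r \<Longrightarrow> f t = 0" and r: "0 \<le> r"
  shows "fourier f \<in> L2" "l2_norm (fourier f) = sqrt ((2 * pi) ^ CARD('d)) * l2_norm f"
proof -
  have [measurable]: "f \<in> borel_measurable borel" using f by auto
  have e: "(\<integral>\<^sup>+\<eta>. ennreal ((cmod (fourier f \<eta>))\<^sup>2) \<partial>lborel) = ennreal ((sqrt ((2 * pi) ^ CARD('d)) * l2_norm f)\<^sup>2)"
    using plancherel_cube[of "r + 1" f] f supp cball_subset_cube[of r] r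
    by (auto simp: power_mult_distrib subset_iff)
  show L: "fourier f \<in> L2"
    by (rule L2_from_nn_integral[OF _ eq_refl[OF e]]) auto
  have "(l2_norm (fourier f))\<^sup>2 = (sqrt ((2 * pi) ^ CARD('d)) * l2_norm f)\<^sup>2"
    using e unfolding L2_nn_integral[OF L] by simp
  then show "l2_norm (fourier f) = sqrt ((2 * pi) ^ CARD('d)) * l2_norm f"
    by (subst (asm) power2_eq_iff_nonneg) auto
qed

text \<open>
  The truncations have pointwise convergent transforms, so Fatou's lemma applies; the equality is
  recovered in \<open>plancherel_norm\<close> by applying this bound to the truncation error.
\<close>

lemma fourier_L2_bound:
  fixes f :: "real^'d::finite \<Rightarrow> complex"
  assumes f: "f \<in> L1L2"
  shows "fourier f \<in> L2" "l2_norm (fourier f) \<le> sqrt ((2 * pi) ^ CARD('d)) * l2_norm f"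
proof -
  note f2 = L1L2_D(1)[OF f] and f1 = L1L2_D(2)[OF f]
  have [measurable]: "f \<in> borel_measurable borel" using f2 by auto
  let ?C = "sqrt ((2 * pi) ^ CARD('d))"
  have tr: "fourier (truncate n f) \<in> L2" "l2_norm (fourier (truncate n f)) = ?C * l2_norm (truncate n f)" for n
    by (rule plancherel_bounded_support[where r=n]; auto simp: truncate_L2 f2 truncate_def)+
  have mono: "l2_norm (truncate n f) \<le> l2_norm f" for n
    unfolding l2_norm_def by (intro real_sqrt_le_mono integral_mono L2_integrable_sq truncate_L2 f2 power_mono cmod_truncate) auto
  have lim: "(\<lambda>n. ennreal ((cmod (fourier (truncate n f) \<eta>))\<^sup>2)) \<longlonglongrightarrow> ennreal ((cmod (fourier f \<eta>))\<^sup>2)" for \<eta>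
    by (intro tendsto_ennrealI tendsto_power tendsto_norm fourier_truncate_tendsto f1)
  have "(\<integral>\<^sup>+\<eta>. ennreal ((cmod (fourier f \<eta>))\<^sup>2) \<partial>lborel) =
      (\<integral>\<^sup>+\<eta>. liminf (\<lambda>n. ennreal ((cmod (fourier (truncate n f) \<eta>))\<^sup>2)) \<partial>lborel)"
    by (intro nn_integral_cong lim_imp_Liminf[symmetric] lim) simp
  also have "\<dots> \<le> liminf (\<lambda>n. \<integral>\<^sup>+\<eta>. ennreal ((cmod (fourier (truncate n f) \<eta>))\<^sup>2) \<partial>lborel)"
    by (rule nn_integral_liminf) measurable
  also have "\<dots> \<le> liminf (\<lambda>n. ennreal ((?C * l2_norm f)\<^sup>2))"
  proof (intro Liminf_mono always_eventually allI)
    fix n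
    have "(\<integral>\<^sup>+\<eta>. ennreal ((cmod (fourier (truncate n f) \<eta>))\<^sup>2) \<partial>lborel) = ennreal ((?C * l2_norm (truncate n f))\<^sup>2)"
      unfolding L2_nn_integral[OF tr(1)] tr(2) ..
    also have "\<dots> \<le> ennreal ((?C * l2_norm f)\<^sup>2)"
      by (intro ennreal_leI power_mono mult_left_mono mono) auto
    finally show "(\<integral>\<^sup>+\<eta>. ennreal ((cmod (fourier (truncate n f) \<eta>))\<^sup>2) \<partial>lborel) \<le> ennreal ((?C * l2_norm f)\<^sup>2)" .
  qed
  also have "\<dots> = ennreal ((?C * l2_norm f)\<^sup>2)" by (simp add: Liminf_const)
  finally have "(\<integral>\<^sup>+\<eta>. ennreal ((cmod (fourier f \<eta>))\<^sup>2) \<partial>lborel) \<le> ennreal ((?C * l2_norm f)\<^sup>2)" .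
  note L2_from_nn_integral[OF _ this]
  then show "fourier f \<in> L2" "l2_norm (fourier f) \<le> ?C * l2_norm f" by auto
qed

theorem plancherel_norm:
  fixes f :: "real^'d::finite \<Rightarrow> complex"
  assumes f: "f \<in> L1L2"
  shows "l2_norm (fourier f) = sqrt ((2 * pi) ^ CARD('d)) * l2_norm f"
proof (rule antisym)
  let ?C = "sqrt ((2 * pi) ^ CARD('d))"
  note f2 = L1L2_D(1)[OF f] and f1 = L1L2_D(2)[OF f]
  show "l2_norm (fourier f) \<le> ?C * l2_norm f" by (rule fourier_L2_bound[OF f])
  have C: "0 \<le> ?C" by simp
  have step: "?C * l2_norm f \<le> l2_norm (fourier f) + 2 * ?C * l2_norm (\<lambda>t. f t - truncate n f t)" for n
  proof -
    let ?fn = "truncate n f"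
    have e: "fourier (\<lambda>t. f t - ?fn t) = (\<lambda>\<eta>. fourier f \<eta> - fourier ?fn \<eta>)"
      by (rule ext, rule fourier_diff[OF f1 truncate_integrable[OF f2]])
    have d: "(\<lambda>t. f t - ?fn t) \<in> L1L2" by (intro L1L2_diff f truncate_L1L2 f2)
    have "l2_norm f \<le> l2_norm ?fn + l2_norm (\<lambda>t. f t - ?fn t)"
      by (intro l2_norm_triangle_diff f2 truncate_L2)
    then have "?C * l2_norm f \<le> ?C * l2_norm ?fn + ?C * l2_norm (\<lambda>t. f t - ?fn t)"
      using mult_left_mono[OF _ C] by (metis distrib_left)
    also have "?C * l2_norm ?fn = l2_norm (fourier ?fn)"
      by (rule plancherel_bounded_support(2)[where r=n, symmetric]) (auto simp: truncate_L2 f2 truncate_def)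
    also have "l2_norm (fourier ?fn) \<le> l2_norm (fourier f) + l2_norm (\<lambda>\<eta>. fourier ?fn \<eta> - fourier f \<eta>)"
      by (intro l2_norm_triangle_diff fourier_L2_bound f truncate_L1L2 f2)
    also have "l2_norm (\<lambda>\<eta>. fourier ?fn \<eta> - fourier f \<eta>) = l2_norm (fourier (\<lambda>t. f t - ?fn t))"
      by (subst l2_norm_diff_commute) (simp add: e)
    also have "l2_norm (fourier (\<lambda>t. f t - ?fn t)) \<le> ?C * l2_norm (\<lambda>t. f t - ?fn t)"
      by (rule fourier_L2_bound[OF d])
    finally show ?thesis by (simp add: ac_simps)
  qed
  have "(\<lambda>n. l2_norm (fourier f) + 2 * ?C * l2_norm (\<lambda>t. f t - truncate n f t)) \<longlonglongrightarrow> l2_norm (fourier f) + 2 * ?C * 0"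
    by (intro tendsto_intros L2_truncate_tendsto f2)
  then show "?C * l2_norm f \<le> l2_norm (fourier f)"
    using step by (intro LIMSEQ_le_const) auto
qed

lemma l2_inner_polarization:
  assumes "f \<in> L2" "g \<in> L2"
  shows "l2_inner f g = complex_of_real (((l2_norm (\<lambda>t. f t + g t))\<^sup>2 - (l2_norm f)\<^sup>2 - (l2_norm g)\<^sup>2) / 2)
     + \<i> * complex_of_real (((l2_norm (\<lambda>t. f t + \<i> * g t))\<^sup>2 - (l2_norm f)\<^sup>2 - (l2_norm g)\<^sup>2) / 2)"
proof -
  have "l2_inner f (\<lambda>t. \<i> * g t) = - \<i> * l2_inner f g"
    by (subst (1 2) l2_inner_commute, subst l2_inner_cmult_left) simp
  then show ?thesis
    using l2_norm_sq_expand[OF assms] l2_norm_sq_expand[OF assms(1) L2_cmult[OF assms(2), of \<i>]]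
    by (simp add: complex_eq_iff l2_norm_cmult)
qed

theorem plancherel:
  fixes f g :: "real^'d::finite \<Rightarrow> complex"
  assumes f: "f \<in> L1L2" and g: "g \<in> L1L2"
  shows "l2_inner (fourier f) (fourier g) = of_real ((2 * pi) ^ CARD('d)) * l2_inner f g"
proof -
  define K where "K = (2 * pi) ^ CARD('d)"
  have K: "0 \<le> K" by (simp add: K_def)
  have n: "(l2_norm (fourier h))\<^sup>2 = K * (l2_norm h)\<^sup>2" if "h \<in> L1L2" for h :: "real^'d \<Rightarrow> complex"
    using plancherel_norm[OF that] K by (simp add: power_mult_distrib K_def)
  have ig: "(\<lambda>t. \<i> * g t) \<in> L1L2" by (rule L1L2_cmult[OF g])
  have "fourier (\<lambda>t. f t + g t) = (\<lambda>\<eta>. fourier f \<eta> + fourier g \<eta>)"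
    using fourier_add[OF L1L2_D(2)[OF f] L1L2_D(2)[OF g]] by auto
  with n[OF L1L2_add[OF f g]] have 1: "(l2_norm (\<lambda>\<eta>. fourier f \<eta> + fourier g \<eta>))\<^sup>2 = K * (l2_norm (\<lambda>t. f t + g t))\<^sup>2" by simp
  have "fourier (\<lambda>t. f t + \<i> * g t) = (\<lambda>\<eta>. fourier f \<eta> + \<i> * fourier g \<eta>)"
    using fourier_add[OF L1L2_D(2)[OF f] L1L2_D(2)[OF ig]] by (auto simp: fourier_cmult)
  with n[OF L1L2_add[OF f ig]] have 2: "(l2_norm (\<lambda>\<eta>. fourier f \<eta> + \<i> * fourier g \<eta>))\<^sup>2 = K * (l2_norm (\<lambda>t. f t + \<i> * g t))\<^sup>2" by simp
  show ?thesis
    unfolding K_def[symmetric] l2_inner_polarization[OF L1L2_D(1)[OF f] L1L2_D(1)[OF g]]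
      l2_inner_polarization[OF fourier_L2_bound(1)[OF f] fourier_L2_bound(1)[OF g]] 1 2 n[OF f] n[OF g]
    by (simp add: complex_eq_iff right_diff_distrib diff_divide_distrib)
qed

definition inv_fourier :: "(real^'d::finite \<Rightarrow> complex) \<Rightarrow> real^'d \<Rightarrow> complex" where
  "inv_fourier v t = of_real (1 / (2 * pi) ^ CARD('d)) * fourier v (- t)"

lemma lborel_integral_uminus:
  fixes f :: "'a::euclidean_space \<Rightarrow> 'b::{banach, second_countable_topology}"
  assumes [measurable]: "f \<in> borel_measurable borel"
  shows "(LINT x|lborel. f (- x)) = (LINT x|lborel. f x)"
    and "integrable lborel (\<lambda>x. f (- x)) \<longleftrightarrow> integrable lborel f"
proof -
  have e: "lborel = distr lborel borel (uminus :: 'a \<Rightarrow> 'a)"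
    using lborel_affine[of "-1" "0::'a"] by (simp add: density_1)
  have "(LINT x|lborel. f x) = (LINT x|distr lborel borel uminus. f x)" using e by simp
  also have "\<dots> = (LINT x|lborel. f (- x))" by (subst integral_distr) auto
  finally show "(LINT x|lborel. f (- x)) = (LINT x|lborel. f x)" by simp
  have "integrable lborel f \<longleftrightarrow> integrable (distr lborel borel uminus) f" using e by simp
  also have "\<dots> \<longleftrightarrow> integrable lborel (\<lambda>x. f (- x))" by (subst integrable_distr_eq) auto
  finally show "integrable lborel (\<lambda>x. f (- x)) \<longleftrightarrow> integrable lborel f" by simp
qed

lemma inv_fourier_L2:
  assumes "v \<in> L1L2"
  shows "inv_fourier v \<in> L2"
proof -
  have F: "fourier v \<in> L2" by (rule fourier_L2_bound[OF assms])
  have [measurable]: "fourier v \<in> borel_measurable borel" using F by auto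
  have "(\<lambda>t. fourier v (- t)) \<in> L2"
    using L2_integrable_sq[OF F] lborel_integral_uminus(2)[of "\<lambda>t. (cmod (fourier v t))\<^sup>2"]
    by (intro L2_I) auto
  from L2_cmult[OF this] show ?thesis unfolding inv_fourier_def[abs_def] .
qed

lemma l2_inner_inv_fourier_inv_fourier:
  fixes v w :: "real^'d::finite \<Rightarrow> complex"
  assumes "v \<in> L1L2" "w \<in> L1L2"
  shows "l2_inner (inv_fourier v) (inv_fourier w) = of_real (1 / (2 * pi) ^ CARD('d)) * l2_inner v w"
proof -
  define K where "K = (2 * pi) ^ CARD('d)"
  have K: "K \<noteq> 0" by (simp add: K_def)
  have [measurable]: "fourier v \<in> borel_measurable borel" "fourier w \<in> borel_measurable borel"
    using fourier_L2_bound(1)[OF assms(1)] fourier_L2_bound(1)[OF assms(2)] by auto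
  have "l2_inner (\<lambda>t. fourier v (- t)) (\<lambda>t. fourier w (- t)) = l2_inner (fourier v) (fourier w)"
    unfolding l2_inner_def by (rule lborel_integral_uminus(1)) measurable
  also have "\<dots> = of_real K * l2_inner v w" unfolding K_def by (rule plancherel[OF assms])
  finally have *: "l2_inner (\<lambda>t. fourier v (- t)) (\<lambda>t. fourier w (- t)) = of_real K * l2_inner v w" .
  show ?thesis
    unfolding inv_fourier_def[abs_def] K_def[symmetric] l2_inner_cmult_left
    by (subst l2_inner_commute, subst l2_inner_cmult_left, subst l2_inner_commute) (use K in \<open>simp add: *\<close>)
qed

text \<open>
  Fubini's theorem; the inverse transform itself need not be integrable.
\<close>

lemma l2_inner_inv_fourier:
  fixes v g :: "real^'d::finite \<Rightarrow> complex"
  assumes v: "integrable lborel v" and g: "integrable lborel g"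
  shows "l2_inner (inv_fourier v) g = of_real (1 / (2 * pi) ^ CARD('d)) * l2_inner v (fourier g)"
proof -
  have [measurable]: "v \<in> borel_measurable borel" "g \<in> borel_measurable borel" using v g by auto
  have [measurable]: "(\<lambda>x::(real^'d)\<times>(real^'d). cis (fst x \<bullet> snd x)) \<in> borel_measurable (borel \<Otimes>\<^sub>M borel)"
    unfolding borel_prod by (intro borel_measurable_continuous_onI continuous_intros)
  let ?F = "\<lambda>\<eta> t. v \<eta> * cnj (g t) * cis (\<eta> \<bullet> t)"
  have m: "case_prod ?F \<in> borel_measurable (lborel \<Otimes>\<^sub>M lborel)"
  proof -
    have "(\<lambda>x. v (fst x) * cnj (g (snd x)) * cis (fst x \<bullet> snd x)) \<in> borel_measurable (lborel \<Otimes>\<^sub>M lborel)"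
      by measurable
    then show ?thesis by (simp add: case_prod_beta')
  qed
  have i2: "integrable lborel (?F \<eta>)" for \<eta>
  proof (rule Bochner_Integration.integrable_bound)
    show "integrable lborel (\<lambda>t. v \<eta> * cnj (g t))" using g by simp
    have [measurable]: "(\<lambda>t. cis (\<eta> \<bullet> t)) \<in> borel_measurable borel"
      by (intro borel_measurable_continuous_onI continuous_intros)
    show "?F \<eta> \<in> borel_measurable lborel" by measurable
  qed (simp add: norm_mult)
  have int: "integrable (lborel \<Otimes>\<^sub>M lborel) (case_prod ?F)"
  proof (rule lborel_pair.Fubini_integrable[OF m])
    have "integrable lborel (\<lambda>\<eta>. cmod (v \<eta>) * (LINT t|lborel. cmod (g t)))" using v by simp
    then show "integrable lborel (\<lambda>\<eta>. LINT t|lborel. norm (case (\<eta>, t) of (\<eta>, t) \<Rightarrow> ?F \<eta> t))"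
      by (simp add: norm_mult)
    show "AE \<eta> in lborel. integrable lborel (\<lambda>t. case (\<eta>, t) of (\<eta>, t) \<Rightarrow> ?F \<eta> t)"
      using i2 by simp
  qed
  have "l2_inner (\<lambda>t. fourier v (- t)) g = (LINT t|lborel. LINT \<eta>|lborel. ?F \<eta> t)"
    unfolding l2_inner_def fourier_def
  proof (intro Bochner_Integration.integral_cong refl)
    fix t
    have "(LINT \<eta>|lborel. ?F \<eta> t) = (LINT \<eta>|lborel. (v \<eta> * cis (- (\<eta> \<bullet> - t))) * cnj (g t))"
      by (simp add: ac_simps)
    then show "(LINT ta|lborel. v ta * cis (- (ta \<bullet> - t))) * cnj (g t) = (LINT \<eta>|lborel. ?F \<eta> t)"
      by simp
  qed
  also have "\<dots> = (LINT \<eta>|lborel. LINT t|lborel. ?F \<eta> t)"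
    by (rule lborel_pair.Fubini_integral[OF int])
  also have "\<dots> = l2_inner v (fourier g)"
    unfolding l2_inner_def fourier_def
  proof (intro Bochner_Integration.integral_cong refl)
    fix \<eta>
    have "cnj (LINT t|lborel. g t * cis (- (t \<bullet> \<eta>))) = (LINT t|lborel. cnj (g t) * cis (\<eta> \<bullet> t))"
      by (simp add: cis_cnj inner_commute flip: Bochner_Integration.integral_cnj)
    then show "(LINT t|lborel. ?F \<eta> t) = v \<eta> * cnj (LINT t|lborel. g t * cis (- (t \<bullet> \<eta>)))"
      by (simp add: mult.assoc)
  qed
  finally show ?thesis
    unfolding inv_fourier_def[abs_def] l2_inner_cmult_left by simp
qed

section \<open>Frames from identities on a dense class\<close>

lemma has_sum_diff_real:
  fixes f g :: "'a \<Rightarrow> real"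
  assumes "(f has_sum a) A" "(g has_sum b) A"
  shows "((\<lambda>x. f x - g x) has_sum (a - b)) A"
  using has_sum_add[OF assms(1) has_sum_cmult_right[OF assms(2), of "-1"]] by simp

lemma l2_norm_truncate_le:
  assumes "f \<in> L2" shows "l2_norm (truncate n f) \<le> l2_norm f"
  unfolding l2_norm_def
  by (intro real_sqrt_le_mono integral_mono L2_integrable_sq truncate_L2 assms power_mono cmod_truncate) auto

lemma l2_inner_truncate_tendsto:
  assumes f: "f \<in> L2" and g: "g \<in> L2"
  shows "(\<lambda>n. l2_inner (truncate n f) g) \<longlonglongrightarrow> l2_inner f g"
proof -
  have "(\<lambda>n. l2_norm (\<lambda>t. f t - truncate n f t) * l2_norm g) \<longlonglongrightarrow> 0"
    using tendsto_mult_right[OF L2_truncate_tendsto[OF f], of "l2_norm g"] by simp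
  then have "(\<lambda>n. l2_inner f g - l2_inner (truncate n f) g) \<longlonglongrightarrow> 0"
  proof (rule Lim_null_comparison[rotated])
    show "\<forall>\<^sub>F n in sequentially. norm (l2_inner f g - l2_inner (truncate n f) g) \<le> l2_norm (\<lambda>t. f t - truncate n f t) * l2_norm g"
      using l2_cauchy_schwarz[OF L2_diff[OF f truncate_L2[OF f]] g]
      by (intro always_eventually) (simp add: l2_inner_diff_left f g truncate_L2)
  qed
  from tendsto_diff[OF tendsto_const this, of "l2_inner f g"] show ?thesis by simp
qed

text \<open>
  The Bessel inequality is stated for finite partial sums and relative to a class \<open>D\<close> of test
  functions, so that it can be established on the class where Fourier transforms are integrals.
\<close>

definition bessel_on :: "('v::euclidean_space \<Rightarrow> complex) set \<Rightarrow> real \<Rightarrow> 'i set \<Rightarrow> ('i \<Rightarrow> 'v \<Rightarrow> complex) \<Rightarrow> bool" where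
  "bessel_on D B W \<theta> \<longleftrightarrow> 0 \<le> B \<and> (\<forall>w\<in>W. \<theta> w \<in> L2) \<and>
     (\<forall>h\<in>D. \<forall>F. finite F \<longrightarrow> F \<subseteq> W \<longrightarrow> (\<Sum>w\<in>F. (cmod (l2_inner h (\<theta> w)))\<^sup>2) \<le> B * (l2_norm h)\<^sup>2)"

lemma bessel_onD:
  assumes "bessel_on D B W \<theta>"
  shows "0 \<le> B" "w \<in> W \<Longrightarrow> \<theta> w \<in> L2"
    "h \<in> D \<Longrightarrow> finite F \<Longrightarrow> F \<subseteq> W \<Longrightarrow> (\<Sum>w\<in>F. (cmod (l2_inner h (\<theta> w)))\<^sup>2) \<le> B * (l2_norm h)\<^sup>2"
  using assms by (auto simp: bessel_on_def)

lemma bessel_L2_set: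
  assumes "bessel_on D B W \<theta>" "h \<in> D" "F \<subseteq> W"
  shows "L2_set (\<lambda>w. cmod (l2_inner h (\<theta> w))) F \<le> sqrt B * l2_norm h"
proof (cases "finite F")
  case True
  have "L2_set (\<lambda>w. cmod (l2_inner h (\<theta> w))) F \<le> sqrt (B * (l2_norm h)\<^sup>2)"
    unfolding L2_set_def using bessel_onD(3)[OF assms(1,2) True assms(3)] by simp
  then show ?thesis by (simp add: real_sqrt_mult)
qed (use bessel_onD(1)[OF assms(1)] in simp)

lemma bessel_extend:
  assumes "bessel_on L1L2 B W \<theta>"
  shows "bessel_on L2 B W \<theta>"
  unfolding bessel_on_def
proof (intro conjI ballI allI impI)
  show "0 \<le> B" by (rule bessel_onD[OF assms])
  show "\<theta> w \<in> L2" if "w \<in> W" for w using bessel_onD(2)[OF assms that] .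
  fix f :: "'a \<Rightarrow> complex" and F assume f: "f \<in> L2" and F: "finite F" "F \<subseteq> W"
  have lim: "(\<lambda>n. \<Sum>w\<in>F. (cmod (l2_inner (truncate n f) (\<theta> w)))\<^sup>2) \<longlonglongrightarrow> (\<Sum>w\<in>F. (cmod (l2_inner f (\<theta> w)))\<^sup>2)"
    using F bessel_onD(2)[OF assms] f by (intro tendsto_intros l2_inner_truncate_tendsto) auto
  show "(\<Sum>w\<in>F. (cmod (l2_inner f (\<theta> w)))\<^sup>2) \<le> B * (l2_norm f)\<^sup>2"
  proof (rule LIMSEQ_le_const2[OF lim], intro exI allI impI)
    fix n
    have "(\<Sum>w\<in>F. (cmod (l2_inner (truncate n f) (\<theta> w)))\<^sup>2) \<le> B * (l2_norm (truncate n f))\<^sup>2"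
      by (rule bessel_onD(3)[OF assms truncate_L1L2[OF f] F])
    also have "\<dots> \<le> B * (l2_norm f)\<^sup>2"
      by (intro mult_left_mono power_mono l2_norm_truncate_le f bessel_onD(1)[OF assms]) simp
    finally show "(\<Sum>w\<in>F. (cmod (l2_inner (truncate n f) (\<theta> w)))\<^sup>2) \<le> B * (l2_norm f)\<^sup>2" .
  qed
qed

lemma bessel_summable:
  assumes "bessel_on D B W \<theta>" "h \<in> D"
  shows "(\<lambda>w. (cmod (l2_inner h (\<theta> w)))\<^sup>2) summable_on W"
    "(\<Sum>\<^sub>\<infinity>w\<in>W. (cmod (l2_inner h (\<theta> w)))\<^sup>2) \<le> B * (l2_norm h)\<^sup>2"
proof -
  show s: "(\<lambda>w. (cmod (l2_inner h (\<theta> w)))\<^sup>2) summable_on W"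
    using bessel_onD(3)[OF assms]
    by (intro nonneg_bdd_above_summable_on bdd_aboveI2[where M="B * (l2_norm h)\<^sup>2"]) auto
  show "(\<Sum>\<^sub>\<infinity>w\<in>W. (cmod (l2_inner h (\<theta> w)))\<^sup>2) \<le> B * (l2_norm h)\<^sup>2"
    by (rule infsum_le_finite_sums[OF s]) (rule bessel_onD(3)[OF assms])
qed

text \<open>
  The coefficient map is bounded into the square-summable families by the Bessel inequality, hence
  continuous, so the lower bound survives truncation in the limit.
\<close>

lemma frame_from_dense:
  assumes A: "0 \<le> A" and bes: "bessel_on L1L2 B W \<psi>"
    and low: "\<And>f. f \<in> L1L2 \<Longrightarrow> A * (l2_norm f)\<^sup>2 \<le> (\<Sum>\<^sub>\<infinity>w\<in>W. (cmod (l2_inner f (\<psi> w)))\<^sup>2)"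
  shows "frame_with_bounds A B W \<psi>"
  unfolding frame_with_bounds_def
proof (intro conjI ballI)
  note bes2 = bessel_extend[OF bes]
  show L: "\<psi> w \<in> L2" if "w \<in> W" for w using bessel_onD(2)[OF bes that] .
  fix f :: "'a \<Rightarrow> complex" assume f: "f \<in> L2"
  let ?S = "\<Sum>\<^sub>\<infinity>w\<in>W. (cmod (l2_inner f (\<psi> w)))\<^sup>2"
  show s: "(\<lambda>w. (cmod (l2_inner f (\<psi> w)))\<^sup>2) summable_on W" by (rule bessel_summable[OF bes2 f])
  show "?S \<le> B * (l2_norm f)\<^sup>2" by (rule bessel_summable[OF bes2 f])
  have S0: "0 \<le> ?S" by (intro infsum_nonneg) simp
  let ?e = "\<lambda>n. l2_norm (\<lambda>t. f t - truncate n f t)"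
  have step: "sqrt A * l2_norm (truncate n f) \<le> sqrt ?S + sqrt B * ?e n" for n
  proof -
    let ?g = "truncate n f"
    have gL: "?g \<in> L1L2" "?g \<in> L2" using truncate_L1L2[OF f] truncate_L2[OF f] by auto
    let ?K = "sqrt ?S + sqrt B * ?e n"
    have K0: "0 \<le> ?K" using S0 bessel_onD(1)[OF bes] by simp
    have "(\<Sum>\<^sub>\<infinity>w\<in>W. (cmod (l2_inner ?g (\<psi> w)))\<^sup>2) \<le> ?K\<^sup>2"
    proof (rule infsum_le_finite_sums)
      show "(\<lambda>w. (cmod (l2_inner ?g (\<psi> w)))\<^sup>2) summable_on W" by (rule bessel_summable[OF bes gL(1)])
      fix F assume F: "finite F" "F \<subseteq> W"
      have "L2_set (\<lambda>w. cmod (l2_inner ?g (\<psi> w))) F \<le>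
          L2_set (\<lambda>w. cmod (l2_inner f (\<psi> w)) + cmod (l2_inner (\<lambda>t. f t - ?g t) (\<psi> w))) F"
      proof (rule L2_set_mono)
        fix w assume "w \<in> F"
        then have "l2_inner (\<lambda>t. f t - ?g t) (\<psi> w) = l2_inner f (\<psi> w) - l2_inner ?g (\<psi> w)"
          using F L by (intro l2_inner_diff_left f gL) auto
        then show "cmod (l2_inner ?g (\<psi> w)) \<le> cmod (l2_inner f (\<psi> w)) + cmod (l2_inner (\<lambda>t. f t - ?g t) (\<psi> w))"
          using norm_triangle_ineq4[of "l2_inner f (\<psi> w)" "l2_inner f (\<psi> w) - l2_inner ?g (\<psi> w)"] by simp
      qed simp
      also have "\<dots> \<le> L2_set (\<lambda>w. cmod (l2_inner f (\<psi> w))) F + L2_set (\<lambda>w. cmod (l2_inner (\<lambda>t. f t - ?g t) (\<psi> w))) F"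
        by (rule L2_set_triangle_ineq)
      also have "L2_set (\<lambda>w. cmod (l2_inner f (\<psi> w))) F \<le> sqrt ?S"
        unfolding L2_set_def using F s by (intro real_sqrt_le_mono finite_sum_le_infsum) auto
      also have "L2_set (\<lambda>w. cmod (l2_inner (\<lambda>t. f t - ?g t) (\<psi> w))) F \<le> sqrt B * ?e n"
        by (rule bessel_L2_set[OF bes2 L2_diff[OF f gL(2)] F(2)])
      finally have "L2_set (\<lambda>w. cmod (l2_inner ?g (\<psi> w))) F \<le> ?K" by simp
      then have "(L2_set (\<lambda>w. cmod (l2_inner ?g (\<psi> w))) F)\<^sup>2 \<le> ?K\<^sup>2" by (intro power_mono) auto
      then show "(\<Sum>w\<in>F. (cmod (l2_inner ?g (\<psi> w)))\<^sup>2) \<le> ?K\<^sup>2" by (simp add: L2_set_def sum_nonneg)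
    qed
    with low[OF gL(1)] have "A * (l2_norm ?g)\<^sup>2 \<le> ?K\<^sup>2" by linarith
    then have "sqrt (A * (l2_norm ?g)\<^sup>2) \<le> ?K" using K0 by (intro real_le_lsqrt) auto
    then show ?thesis by (simp add: real_sqrt_mult)
  qed
  have "sqrt A * l2_norm f \<le> sqrt ?S"
  proof (rule LIMSEQ_le_const)
    have "(\<lambda>n. sqrt ?S + (sqrt B + sqrt A) * ?e n) \<longlonglongrightarrow> sqrt ?S + (sqrt B + sqrt A) * 0"
      by (intro tendsto_intros L2_truncate_tendsto f)
    then show "(\<lambda>n. sqrt ?S + (sqrt B + sqrt A) * ?e n) \<longlonglongrightarrow> sqrt ?S" by simp
    show "\<exists>N. \<forall>n\<ge>N. sqrt A * l2_norm f \<le> sqrt ?S + (sqrt B + sqrt A) * ?e n"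
    proof (intro exI allI impI)
      fix n
      have "sqrt A * l2_norm f \<le> sqrt A * (l2_norm (truncate n f) + ?e n)"
        using A by (intro mult_left_mono l2_norm_triangle_diff f truncate_L2) auto
      then show "sqrt A * l2_norm f \<le> sqrt ?S + (sqrt B + sqrt A) * ?e n"
        using step[of n] by (simp add: distrib_left distrib_right)
    qed
  qed
  then have "(sqrt A * l2_norm f)\<^sup>2 \<le> (sqrt ?S)\<^sup>2" using A by (intro power_mono) auto
  then show "A * (l2_norm f)\<^sup>2 \<le> ?S" using A S0 by (simp add: power_mult_distrib)
qed

lemma has_sum_norm_bound:
  fixes f :: "'a \<Rightarrow> complex"
  assumes "(f has_sum s) A" "\<And>F. finite F \<Longrightarrow> F \<subseteq> A \<Longrightarrow> cmod (sum f F) \<le> K"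
  shows "cmod s \<le> K"
proof (rule tendsto_upperbound)
  show "((\<lambda>F. cmod (sum f F)) \<longlongrightarrow> cmod s) (finite_subsets_at_top A)"
    using assms(1) unfolding has_sum_def by (rule tendsto_norm)
  show "\<forall>\<^sub>F F in finite_subsets_at_top A. cmod (sum f F) \<le> K"
    using assms(2) by (rule eventually_finite_subsets_at_top_weakI)
qed simp

text \<open>
  Testing against truncations of \<open>r\<close> itself recovers its norm.
\<close>

lemma l2_norm_weak_bound:
  assumes r: "r \<in> L2" and K: "0 \<le> K" and bd: "\<And>h. h \<in> L1L2 \<Longrightarrow> cmod (l2_inner r h) \<le> K * l2_norm h"
  shows "l2_norm r \<le> K"
proof (rule LIMSEQ_le_const)
  have "(\<lambda>n. K + l2_norm (\<lambda>t. r t - truncate n r t)) \<longlonglongrightarrow> K + 0"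
    by (intro tendsto_intros L2_truncate_tendsto r)
  then show "(\<lambda>n. K + l2_norm (\<lambda>t. r t - truncate n r t)) \<longlonglongrightarrow> K" by simp
  show "\<exists>N. \<forall>n\<ge>N. l2_norm r \<le> K + l2_norm (\<lambda>t. r t - truncate n r t)"
  proof (intro exI allI impI)
    fix n
    let ?h = "truncate n r"
    have "l2_inner r ?h = l2_inner ?h ?h"
      unfolding l2_inner_def by (intro Bochner_Integration.integral_cong) (auto simp: truncate_def indicator_def)
    then have "cmod (l2_inner r ?h) = (l2_norm ?h)\<^sup>2" unfolding l2_inner_self by (simp add: norm_power)
    then have "(l2_norm ?h)\<^sup>2 \<le> K * l2_norm ?h" using bd[OF truncate_L1L2[OF r, of n]] by simp
    have "l2_norm ?h \<le> K"
    proof (cases "l2_norm ?h = 0")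
      case False
      then have "0 < l2_norm ?h" by (simp add: less_le)
      then show ?thesis using \<open>(l2_norm ?h)\<^sup>2 \<le> K * l2_norm ?h\<close> by (simp add: power2_eq_square)
    qed (use K in simp)
    moreover have "l2_norm r \<le> l2_norm ?h + l2_norm (\<lambda>t. r t - ?h t)"
      by (intro l2_norm_triangle_diff r truncate_L2)
    ultimately show "l2_norm r \<le> K + l2_norm (\<lambda>t. r t - truncate n r t)" by simp
  qed
qed

text \<open>
  The remainder after a finite partial sum, tested against \<open>h\<close>, is the tail of the weakly convergent
  series.  Cauchy-Schwarz and the Bessel inequality bound it by \<open>l2_norm h\<close> times the tail of the
  square-summable coefficients, uniformly in \<open>h\<close>.
\<close>

theorem l2_has_sum_from_weak:
  assumes bes: "bessel_on L1L2 B W \<theta>" and g: "g \<in> L2"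
    and c: "(\<lambda>w. (cmod (c w))\<^sup>2) summable_on W"
    and weak: "\<And>h. h \<in> L1L2 \<Longrightarrow> ((\<lambda>w. c w * l2_inner (\<theta> w) h) has_sum l2_inner g h) W"
  shows "l2_has_sum (\<lambda>w t. c w * \<theta> w t) W g"
  unfolding l2_has_sum_def
proof (intro conjI ballI g)
  note B = bessel_onD(1)[OF bes] and \<theta> = bessel_onD(2)[OF bes]
  show cL: "(\<lambda>t. c w * \<theta> w t) \<in> L2" if "w \<in> W" for w by (intro L2_cmult \<theta> that)
  define T where "T = (\<Sum>\<^sub>\<infinity>w\<in>W. (cmod (c w))\<^sup>2)"
  let ?K = "\<lambda>X. sqrt (T - (\<Sum>w\<in>X. (cmod (c w))\<^sup>2)) * sqrt B"
  have fin: "(\<Sum>w\<in>X. (cmod (c w))\<^sup>2) \<le> T" if "finite X" "X \<subseteq> W" for X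
    unfolding T_def using that c by (intro finite_sum_le_infsum) auto
  have bound: "l2_norm (\<lambda>t. g t - (\<Sum>w\<in>X. c w * \<theta> w t)) \<le> ?K X" if X: "finite X" "X \<subseteq> W" for X
  proof (rule l2_norm_weak_bound)
    let ?r = "\<lambda>t. g t - (\<Sum>w\<in>X. c w * \<theta> w t)"
    have P: "(\<lambda>t. \<Sum>w\<in>X. c w * \<theta> w t) \<in> L2" using X by (intro L2_sum cL) auto
    show "?r \<in> L2" by (intro L2_diff g P)
    show "0 \<le> ?K X" using fin[OF X] B by simp
    fix h :: "'a \<Rightarrow> complex" assume h: "h \<in> L1L2"
    note h2 = L1L2_D(1)[OF h]
    have "l2_inner ?r h = l2_inner g h - l2_inner (\<lambda>t. \<Sum>w\<in>X. c w * \<theta> w t) h"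
      by (intro l2_inner_diff_left g P h2)
    also have "l2_inner (\<lambda>t. \<Sum>w\<in>X. c w * \<theta> w t) h = (\<Sum>w\<in>X. l2_inner (\<lambda>t. c w * \<theta> w t) h)"
      using X by (intro l2_inner_sum_left h2 cL) auto
    also have "\<dots> = (\<Sum>w\<in>X. c w * l2_inner (\<theta> w) h)" by (simp add: l2_inner_cmult_left)
    finally have r: "l2_inner ?r h = l2_inner g h - (\<Sum>w\<in>X. c w * l2_inner (\<theta> w) h)" .
    have "((\<lambda>w. c w * l2_inner (\<theta> w) h) has_sum l2_inner ?r h) (W - X)"
      unfolding r using X by (intro has_sum_Diff weak h has_sum_finite)
    then show "cmod (l2_inner ?r h) \<le> ?K X * l2_norm h"
    proof (rule has_sum_norm_bound)
      fix F assume F: "finite F" "F \<subseteq> W - X"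
      have "cmod (\<Sum>w\<in>F. c w * l2_inner (\<theta> w) h) \<le> (\<Sum>w\<in>F. \<bar>cmod (c w)\<bar> * \<bar>cmod (l2_inner h (\<theta> w))\<bar>)"
        by (rule order_trans[OF norm_sum sum_mono]) (simp add: norm_mult l2_inner_commute[of "\<theta> _" h])
      also have "\<dots> \<le> L2_set (\<lambda>w. cmod (c w)) F * L2_set (\<lambda>w. cmod (l2_inner h (\<theta> w))) F"
        by (rule L2_set_mult_ineq)
      also have "\<dots> \<le> sqrt (T - (\<Sum>w\<in>X. (cmod (c w))\<^sup>2)) * (sqrt B * l2_norm h)"
      proof (intro mult_mono)
        have "(\<Sum>w\<in>F. (cmod (c w))\<^sup>2) + (\<Sum>w\<in>X. (cmod (c w))\<^sup>2) = (\<Sum>w\<in>F \<union> X. (cmod (c w))\<^sup>2)"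
          using F X by (intro sum.union_disjoint[symmetric]) auto
        also have "\<dots> \<le> T" using F X by (intro fin) auto
        finally show "L2_set (\<lambda>w. cmod (c w)) F \<le> sqrt (T - (\<Sum>w\<in>X. (cmod (c w))\<^sup>2))"
          unfolding L2_set_def by simp
        show "L2_set (\<lambda>w. cmod (l2_inner h (\<theta> w))) F \<le> sqrt B * l2_norm h"
          using F by (intro bessel_L2_set[OF bes h]) auto
      qed (use fin[OF X] in \<open>auto simp: L2_set_nonneg\<close>)
      finally show "cmod (\<Sum>w\<in>F. c w * l2_inner (\<theta> w) h) \<le> ?K X * l2_norm h" by (simp add: mult.assoc)
    qed
  qed
  have "((\<lambda>X. \<Sum>w\<in>X. (cmod (c w))\<^sup>2) \<longlongrightarrow> T) (finite_subsets_at_top W)"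
    unfolding T_def using has_sum_infsum[OF c] by (simp add: has_sum_def)
  then have "(?K \<longlongrightarrow> sqrt (T - T) * sqrt B) (finite_subsets_at_top W)" by (intro tendsto_intros)
  then have "(?K \<longlongrightarrow> 0) (finite_subsets_at_top W)" by simp
  then show "((\<lambda>X. l2_norm (\<lambda>t. g t - (\<Sum>w\<in>X. c w * \<theta> w t))) \<longlongrightarrow> 0) (finite_subsets_at_top W)"
    by (rule tendsto_sandwich[OF _ _ tendsto_const, rotated 2])
       (auto intro: eventually_finite_subsets_at_top_weakI bound)
qed

text \<open>
  The synthesis map is the adjoint of the coefficient map and obeys the same norm bound.
\<close>

lemma bessel_synthesis:
  assumes bes: "bessel_on L2 B W \<theta>" and X: "finite X" "X \<subseteq> W"
  shows "l2_norm (\<lambda>t. \<Sum>w\<in>X. c w * \<theta> w t) \<le> sqrt B * L2_set (\<lambda>w. cmod (c w)) X"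
proof (rule l2_norm_weak_bound)
  note B = bessel_onD(1)[OF bes] and \<theta> = bessel_onD(2)[OF bes]
  show "(\<lambda>t. \<Sum>w\<in>X. c w * \<theta> w t) \<in> L2" using X by (intro L2_sum L2_cmult \<theta>) auto
  show "0 \<le> sqrt B * L2_set (\<lambda>w. cmod (c w)) X" using B by (simp add: L2_set_nonneg)
  fix h :: "'a \<Rightarrow> complex" assume "h \<in> L1L2"
  then have h: "h \<in> L2" by (rule L1L2_D)
  have "l2_inner (\<lambda>t. \<Sum>w\<in>X. c w * \<theta> w t) h = (\<Sum>w\<in>X. c w * l2_inner (\<theta> w) h)"
    using X by (subst l2_inner_sum_left) (auto simp: l2_inner_cmult_left intro!: h L2_cmult \<theta>)
  also have "cmod \<dots> \<le> (\<Sum>w\<in>X. \<bar>cmod (c w)\<bar> * \<bar>cmod (l2_inner h (\<theta> w))\<bar>)"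
    by (rule order_trans[OF norm_sum sum_mono]) (simp add: norm_mult l2_inner_commute[of "\<theta> _" h])
  also have "\<dots> \<le> L2_set (\<lambda>w. cmod (c w)) X * L2_set (\<lambda>w. cmod (l2_inner h (\<theta> w))) X"
    by (rule L2_set_mult_ineq)
  also have "\<dots> \<le> L2_set (\<lambda>w. cmod (c w)) X * (sqrt B * l2_norm h)"
    using X by (intro mult_left_mono bessel_L2_set[OF bes h]) (auto simp: L2_set_nonneg)
  finally show "cmod (l2_inner (\<lambda>t. \<Sum>w\<in>X. c w * \<theta> w t) h) \<le> sqrt B * L2_set (\<lambda>w. cmod (c w)) X * l2_norm h"
    by (simp add: ac_simps)
qed

text \<open>
  Replace \<open>f\<close> by a truncation: the change in \<open>f\<close> is small, and by \<open>bessel_synthesis\<close> so is the change in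
  every finite partial sum, uniformly in the sum.
\<close>

theorem reconstruction_extend:
  assumes bes: "bessel_on L1L2 B W \<psi>" and bes': "bessel_on L1L2 B' W \<theta>"
    and rec: "\<And>f. f \<in> L1L2 \<Longrightarrow> l2_has_sum (\<lambda>w t. l2_inner f (\<psi> w) * \<theta> w t) W f"
    and f: "f \<in> L2"
  shows "l2_has_sum (\<lambda>w t. l2_inner f (\<psi> w) * \<theta> w t) W f"
  unfolding l2_has_sum_def
proof (intro conjI ballI f)
  note bes2 = bessel_extend[OF bes] and bes2' = bessel_extend[OF bes']
  note \<theta> = bessel_onD(2)[OF bes'] and \<psi> = bessel_onD(2)[OF bes]
  note B = bessel_onD(1)[OF bes] and B' = bessel_onD(1)[OF bes']
  show L: "(\<lambda>t. l2_inner f (\<psi> w) * \<theta> w t) \<in> L2" if "w \<in> W" for w by (intro L2_cmult \<theta> that)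
  define M where "M = 1 + sqrt B' * sqrt B"
  have M: "0 < M" using B B' by (simp add: M_def add_pos_nonneg)
  show "((\<lambda>X. l2_norm (\<lambda>t. f t - (\<Sum>w\<in>X. l2_inner f (\<psi> w) * \<theta> w t))) \<longlongrightarrow> 0) (finite_subsets_at_top W)"
  proof (rule tendstoI)
    fix \<epsilon> :: real assume \<epsilon>: "0 < \<epsilon>"
    then have "0 < \<epsilon> / (2 * M)" using M by simp
    from order_tendstoD(2)[OF L2_truncate_tendsto[OF f] this]
    obtain n where n: "l2_norm (\<lambda>t. f t - truncate n f t) < \<epsilon> / (2 * M)" by (auto simp: eventually_sequentially)
    let ?g = "truncate n f"
    have g: "?g \<in> L1L2" "?g \<in> L2" using truncate_L1L2[OF f] truncate_L2[OF f] by auto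
    have "\<forall>\<^sub>F X in finite_subsets_at_top W. l2_norm (\<lambda>t. ?g t - (\<Sum>w\<in>X. l2_inner ?g (\<psi> w) * \<theta> w t)) < \<epsilon> / 2"
      using rec[OF g(1)] \<epsilon> unfolding l2_has_sum_def by (intro order_tendstoD(2)[where y=0]) auto
    moreover have "\<forall>\<^sub>F X in finite_subsets_at_top W. finite X \<and> X \<subseteq> W"
      by (rule eventually_finite_subsets_at_top_weakI) auto
    ultimately show "\<forall>\<^sub>F X in finite_subsets_at_top W. dist (l2_norm (\<lambda>t. f t - (\<Sum>w\<in>X. l2_inner f (\<psi> w) * \<theta> w t))) 0 < \<epsilon>"
    proof eventually_elim
      case (elim X)
      then have X: "finite X" "X \<subseteq> W" by auto
      let ?d = "\<lambda>t. f t - ?g t"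
      have dL: "?d \<in> L2" by (intro L2_diff f g)
      let ?a = "\<lambda>t. ?g t - (\<Sum>w\<in>X. l2_inner ?g (\<psi> w) * \<theta> w t)"
      let ?b = "\<lambda>t. \<Sum>w\<in>X. l2_inner ?d (\<psi> w) * \<theta> w t"
      have aL: "?a \<in> L2" and bL: "?b \<in> L2" using X by (auto intro!: L2_diff g L2_sum L2_cmult \<theta>)
      have "(\<lambda>t. f t - (\<Sum>w\<in>X. l2_inner f (\<psi> w) * \<theta> w t)) = (\<lambda>t. ?a t + (?d t - ?b t))"
      proof
        fix t
        have "l2_inner ?d (\<psi> w) = l2_inner f (\<psi> w) - l2_inner ?g (\<psi> w)" if "w \<in> X" for w
          using that X by (intro l2_inner_diff_left f g \<psi>) auto
        then have "?b t = (\<Sum>w\<in>X. l2_inner f (\<psi> w) * \<theta> w t) - (\<Sum>w\<in>X. l2_inner ?g (\<psi> w) * \<theta> w t)"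
          by (simp add: left_diff_distrib sum_subtractf)
        then show "f t - (\<Sum>w\<in>X. l2_inner f (\<psi> w) * \<theta> w t) = ?a t + (?d t - ?b t)" by simp
      qed
      then have "l2_norm (\<lambda>t. f t - (\<Sum>w\<in>X. l2_inner f (\<psi> w) * \<theta> w t)) = l2_norm (\<lambda>t. ?a t + (?d t - ?b t))" by simp
      also have "\<dots> \<le> l2_norm ?a + l2_norm (\<lambda>t. ?d t - ?b t)"
        by (intro l2_norm_triangle aL L2_diff dL bL)
      also have "l2_norm (\<lambda>t. ?d t - ?b t) \<le> l2_norm ?d + l2_norm ?b"
        using l2_norm_triangle[OF dL L2_cmult[OF bL, of "-1"]] l2_norm_cmult[of "-1" ?b] by simp
      also have "l2_norm ?b \<le> sqrt B' * L2_set (\<lambda>w. cmod (l2_inner ?d (\<psi> w))) X"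
        by (rule bessel_synthesis[OF bes2' X])
      also have "\<dots> \<le> sqrt B' * (sqrt B * l2_norm ?d)"
        using B' by (intro mult_left_mono bessel_L2_set[OF bes2 dL X(2)]) simp
      finally have "l2_norm (\<lambda>t. f t - (\<Sum>w\<in>X. l2_inner f (\<psi> w) * \<theta> w t)) \<le> l2_norm ?a + M * l2_norm ?d"
        by (simp add: M_def distrib_right)
      also have "\<dots> < \<epsilon> / 2 + M * (\<epsilon> / (2 * M))"
        using elim n M by (intro add_strict_mono mult_strict_left_mono) auto
      also have "\<dots> = \<epsilon>" using M by simp
      finally show ?case by simp
    qed
  qed
qed

text \<open>
  The solution of \<open>S f = \<psi> w\<close> is unique: the difference \<open>e\<close> of two solutions satisfies \<open>S e = 0\<close>, so
  all its coefficients vanish and the lower frame bound gives \<open>e = 0\<close>.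
\<close>

theorem canonical_dualI:
  assumes fr: "frame_with_bounds A B W \<psi>" and A: "0 < A"
    and dual: "\<And>w. w \<in> W \<Longrightarrow> frame_operator W \<psi> (\<psi>d w) (\<psi> w)"
  shows "canonical_dual W \<psi> \<psi>d"
  unfolding canonical_dual_def
proof (intro ballI conjI allI impI dual)
  fix w f assume w: "w \<in> W" and f: "frame_operator W \<psi> f (\<psi> w)"
  note \<psi> = fr[unfolded frame_with_bounds_def, THEN conjunct1, rule_format]
  let ?d = "\<psi>d w"
  have L: "f \<in> L2" "?d \<in> L2" using f dual[OF w] by (auto simp: frame_operator_def)
  let ?e = "\<lambda>t. f t - ?d t"
  have eL: "?e \<in> L2" by (intro L2_diff L)
  let ?P = "\<lambda>g X t. \<Sum>z\<in>X. l2_inner g (\<psi> z) * \<psi> z t"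
  have PL: "?P g X \<in> L2" if "X \<subseteq> W" for g X using that by (intro L2_sum L2_cmult \<psi>) auto
  have lim: "((\<lambda>X. l2_norm (\<lambda>t. \<psi> w t - ?P f X t) + l2_norm (\<lambda>t. \<psi> w t - ?P ?d X t)) \<longlongrightarrow> 0 + 0) (finite_subsets_at_top W)"
    using f dual[OF w] unfolding frame_operator_def l2_has_sum_def by (intro tendsto_add) auto
  have inner: "(\<Sum>z\<in>X. (cmod (l2_inner ?e (\<psi> z)))\<^sup>2) \<le>
      (l2_norm (\<lambda>t. \<psi> w t - ?P f X t) + l2_norm (\<lambda>t. \<psi> w t - ?P ?d X t)) * l2_norm ?e" if X: "finite X" "X \<subseteq> W" for X
  proof -
    have e: "l2_inner ?e (\<psi> z) = l2_inner f (\<psi> z) - l2_inner ?d (\<psi> z)" if "z \<in> X" for z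
      using that X by (intro l2_inner_diff_left L \<psi>) auto
    have "l2_inner (?P ?e X) ?e = (\<Sum>z\<in>X. l2_inner ?e (\<psi> z) * l2_inner (\<psi> z) ?e)"
      using X by (subst l2_inner_sum_left) (auto simp: l2_inner_cmult_left intro!: eL L2_cmult \<psi>)
    also have "\<dots> = of_real (\<Sum>z\<in>X. (cmod (l2_inner ?e (\<psi> z)))\<^sup>2)"
      by (simp add: complex_norm_square l2_inner_commute[of "\<psi> _" ?e] del: of_real_power)
    finally have "(\<Sum>z\<in>X. (cmod (l2_inner ?e (\<psi> z)))\<^sup>2) = cmod (l2_inner (?P ?e X) ?e)"
      by (simp add: sum_nonneg del: of_real_sum)
    also have "\<dots> \<le> l2_norm (?P ?e X) * l2_norm ?e" by (intro l2_cauchy_schwarz PL X eL)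
    also have "?P ?e X = (\<lambda>t. (\<psi> w t - ?P ?d X t) + (-1) * (\<psi> w t - ?P f X t))"
      using e by (auto simp: left_diff_distrib sum_subtractf fun_eq_iff cong: sum.cong)
    also have "l2_norm \<dots> \<le> l2_norm (\<lambda>t. \<psi> w t - ?P ?d X t) + l2_norm (\<lambda>t. (-1) * (\<psi> w t - ?P f X t))"
      by (intro l2_norm_triangle L2_cmult L2_diff PL X \<psi> w)
    also have "l2_norm (\<lambda>t. (-1) * (\<psi> w t - ?P f X t)) = l2_norm (\<lambda>t. \<psi> w t - ?P f X t)"
      by (subst l2_norm_cmult) simp
    finally show ?thesis by (simp add: mult_right_mono add.commute)
  qed
  have "(\<Sum>\<^sub>\<infinity>z\<in>W. (cmod (l2_inner ?e (\<psi> z)))\<^sup>2) \<le> 0"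
  proof (rule tendsto_le)
    show "((\<lambda>X. (l2_norm (\<lambda>t. \<psi> w t - ?P f X t) + l2_norm (\<lambda>t. \<psi> w t - ?P ?d X t)) * l2_norm ?e) \<longlongrightarrow> 0) (finite_subsets_at_top W)"
      using tendsto_mult_right[OF lim, of "l2_norm ?e"] by simp
    have "(\<lambda>z. (cmod (l2_inner ?e (\<psi> z)))\<^sup>2) summable_on W"
      using fr eL by (auto simp: frame_with_bounds_def)
    from has_sum_infsum[OF this]
    show "((\<lambda>X. \<Sum>z\<in>X. (cmod (l2_inner ?e (\<psi> z)))\<^sup>2) \<longlongrightarrow> (\<Sum>\<^sub>\<infinity>z\<in>W. (cmod (l2_inner ?e (\<psi> z)))\<^sup>2)) (finite_subsets_at_top W)"
      by (simp add: has_sum_def)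
    show "\<forall>\<^sub>F X in finite_subsets_at_top W. (\<Sum>z\<in>X. (cmod (l2_inner ?e (\<psi> z)))\<^sup>2) \<le>
      (l2_norm (\<lambda>t. \<psi> w t - ?P f X t) + l2_norm (\<lambda>t. \<psi> w t - ?P ?d X t)) * l2_norm ?e"
      by (rule eventually_finite_subsets_at_top_weakI) (rule inner)
  qed simp
  moreover have "A * (l2_norm ?e)\<^sup>2 \<le> (\<Sum>\<^sub>\<infinity>z\<in>W. (cmod (l2_inner ?e (\<psi> z)))\<^sup>2)"
    using fr eL by (auto simp: frame_with_bounds_def)
  ultimately have "A * (l2_norm ?e)\<^sup>2 \<le> 0" by linarith
  then have "l2_norm ?e = 0" using A by (auto simp: mult_le_0_iff)
  from l2_norm_zero_AE[OF eL this] show "AE t in lborel. f t = ?d t" by simp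
qed

section \<open>Geometry of subdyadic frequencies\<close>

text \<open>
  Bounds for the ratio of two frequencies, and of their scales, when balls of radius \<open>T\<close> times the
  scale meet.  Both increase with \<open>T\<close>, so bounds for the largest \<open>T\<close> in use serve for all.
\<close>

definition freq_ratio :: "real \<Rightarrow> real \<Rightarrow> real" where
  "freq_ratio \<alpha> T = 2 + 2 * T + (4 * T) powr (1 / \<alpha>)"

definition scale_ratio :: "real \<Rightarrow> real \<Rightarrow> real" where
  "scale_ratio \<alpha> T = freq_ratio \<alpha> T powr \<bar>1 - \<alpha>\<bar>"

lemma freq_ratio_ge: "0 \<le> T \<Longrightarrow> 2 \<le> freq_ratio \<alpha> T"
  by (simp add: freq_ratio_def)

lemma freq_ratio_mono: "0 < \<alpha> \<Longrightarrow> 0 \<le> T \<Longrightarrow> T \<le> T' \<Longrightarrow> freq_ratio \<alpha> T \<le> freq_ratio \<alpha> T'"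
  unfolding freq_ratio_def by (intro add_mono powr_mono2) auto

lemma scale_ratio_ge: "0 \<le> T \<Longrightarrow> 1 \<le> scale_ratio \<alpha> T"
  unfolding scale_ratio_def using freq_ratio_ge[of T \<alpha>] by (intro ge_one_powr_ge_zero) auto

text \<open>
  If \<open>\<alpha> \<ge> 1\<close> the scales are at most 1 and the distance is at most \<open>2 * T\<close>.  If \<open>\<alpha> < 1\<close> and \<open>y\<close> is the
  larger number, then either \<open>2 * T * y powr (1 - \<alpha>)\<close> is at most half of \<open>y\<close> and can be absorbed, or \<open>y\<close> itself
  is bounded by \<open>(4 * T) powr (1 / \<alpha>)\<close>.
\<close>

lemma frequency_comparable:
  assumes \<alpha>: "0 < \<alpha>" and x: "1 \<le> x" and y: "1 \<le> y" and T: "0 \<le> T"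
    and d: "\<bar>x - y\<bar> \<le> T * (x powr (1 - \<alpha>) + y powr (1 - \<alpha>))"
  shows "y \<le> freq_ratio \<alpha> T * x"
proof -
  have p: "0 \<le> (4 * T) powr (1 / \<alpha>)" by simp
  have R: "2 * x \<le> freq_ratio \<alpha> T * x" "(1 + 2 * T) * x \<le> freq_ratio \<alpha> T * x" "(4 * T) powr (1 / \<alpha>) * x \<le> freq_ratio \<alpha> T * x"
    unfolding freq_ratio_def using T x p by (intro mult_right_mono; simp)+
  show ?thesis
  proof (cases "y \<le> x")
    case True
    then show ?thesis using R(1) x by linarith
  next
    case False
    then have yx: "y \<le> x + T * (x powr (1 - \<alpha>) + y powr (1 - \<alpha>))" using d by linarith
    show ?thesis
    proof (cases "1 \<le> \<alpha>")
      case True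
      have "x powr (1 - \<alpha>) \<le> 1" "y powr (1 - \<alpha>) \<le> 1" using True x y powr_mono[of "1 - \<alpha>" 0 x] powr_mono[of "1 - \<alpha>" 0 y] by auto
      then have "T * (x powr (1 - \<alpha>) + y powr (1 - \<alpha>)) \<le> T * 2" using T by (intro mult_left_mono) auto
      moreover have "2 * T * 1 \<le> 2 * T * x" using T x by (intro mult_left_mono) auto
      ultimately have "y \<le> (1 + 2 * T) * x" using yx by (simp add: distrib_right)
      then show ?thesis using R(2) by linarith
    next
      case a1: False
      have "x powr (1 - \<alpha>) \<le> y powr (1 - \<alpha>)" using False x a1 by (intro powr_mono2) auto
      then have "T * (x powr (1 - \<alpha>) + y powr (1 - \<alpha>)) \<le> T * (2 * y powr (1 - \<alpha>))" using T by (intro mult_left_mono) auto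
      then have y2: "y \<le> x + 2 * T * y powr (1 - \<alpha>)" using yx by simp
      show ?thesis
      proof (cases "2 * T * y powr (1 - \<alpha>) \<le> y / 2")
        case True
        then have "y \<le> 2 * x" using y2 by simp
        then show ?thesis using R(1) by linarith
      next
        case False
        have "y powr \<alpha> * y powr (1 - \<alpha>) = y" using y by (simp flip: powr_add)
        then have "y powr \<alpha> * y powr (1 - \<alpha>) < (4 * T) * y powr (1 - \<alpha>)" using False by simp
        then have "y powr \<alpha> < 4 * T" using y by (simp add: mult_less_cancel_right)
        then have "(y powr \<alpha>) powr (1 / \<alpha>) \<le> (4 * T) powr (1 / \<alpha>)" using \<alpha> by (intro powr_mono2) auto
        then have "y \<le> (4 * T) powr (1 / \<alpha>)" using \<alpha> y by (simp add: powr_powr)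
        also have "\<dots> = (4 * T) powr (1 / \<alpha>) * 1" by simp
        also have "\<dots> \<le> (4 * T) powr (1 / \<alpha>) * x" using x p by (intro mult_left_mono) auto
        finally show ?thesis using R(3) by linarith
      qed
    qed
  qed
qed

lemma powr_comparable:
  fixes x y L \<beta> :: real
  assumes x: "0 < x" and y: "0 < y" and L: "1 \<le> L" and yx: "y \<le> L * x" and xy: "x \<le> L * y"
  shows "y powr \<beta> \<le> L powr \<bar>\<beta>\<bar> * x powr \<beta>"
proof (cases "0 \<le> \<beta>")
  case True
  then have "y powr \<beta> \<le> (L * x) powr \<beta>" using y yx by (intro powr_mono2) auto
  then show ?thesis using True x L by (simp add: powr_mult)
next
  case False
  have "x powr - \<beta> \<le> (L * y) powr - \<beta>" using False x xy by (intro powr_mono2) auto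
  then have "x powr - \<beta> \<le> L powr - \<beta> * y powr - \<beta>" using y L by (simp add: powr_mult)
  then have "y powr \<beta> * x powr \<beta> * x powr - \<beta> \<le> y powr \<beta> * x powr \<beta> * (L powr - \<beta> * y powr - \<beta>)"
    by (intro mult_left_mono) auto
  moreover have "y powr \<beta> * x powr \<beta> * x powr - \<beta> = y powr \<beta>" using x by (simp add: powr_minus)
  moreover have "y powr \<beta> * x powr \<beta> * (L powr - \<beta> * y powr - \<beta>) = L powr - \<beta> * x powr \<beta>" using y by (simp add: powr_minus)
  ultimately show ?thesis using False by simp
qed

definition fscale :: "real \<Rightarrow> 'v::real_normed_vector \<Rightarrow> real" where
  "fscale \<alpha> \<xi> = norm \<xi> powr (1 - \<alpha>)"

lemma fscale_pos: "1 \<le> norm \<xi> \<Longrightarrow> 0 < fscale \<alpha> \<xi>"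
  by (auto simp: fscale_def)

lemma fscale_comparable:
  assumes \<alpha>: "0 < \<alpha>" and x: "1 \<le> norm \<xi>" and y: "1 \<le> norm \<xi>'" and T: "0 \<le> T" "T \<le> T'"
    and d: "norm (\<xi> - \<xi>') \<le> T * (fscale \<alpha> \<xi> + fscale \<alpha> \<xi>')"
  shows "norm \<xi>' \<le> freq_ratio \<alpha> T' * norm \<xi>" "fscale \<alpha> \<xi>' \<le> scale_ratio \<alpha> T' * fscale \<alpha> \<xi>"
proof -
  have d1: "\<bar>norm \<xi> - norm \<xi>'\<bar> \<le> T * (norm \<xi> powr (1 - \<alpha>) + norm \<xi>' powr (1 - \<alpha>))"
    using d norm_triangle_ineq3[of \<xi> \<xi>'] by (simp add: fscale_def)
  then have d2: "\<bar>norm \<xi>' - norm \<xi>\<bar> \<le> T * (norm \<xi>' powr (1 - \<alpha>) + norm \<xi> powr (1 - \<alpha>))"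
    by (simp add: abs_minus_commute add.commute)
  note m = freq_ratio_mono[OF \<alpha> T]
  have a: "norm \<xi>' \<le> freq_ratio \<alpha> T' * norm \<xi>"
    using frequency_comparable[OF \<alpha> x y T(1) d1] mult_right_mono[OF m, of "norm \<xi>"] by simp
  have b: "norm \<xi> \<le> freq_ratio \<alpha> T' * norm \<xi>'"
    using frequency_comparable[OF \<alpha> y x T(1) d2] mult_right_mono[OF m, of "norm \<xi>'"] by simp
  show "norm \<xi>' \<le> freq_ratio \<alpha> T' * norm \<xi>" by (rule a)
  show "fscale \<alpha> \<xi>' \<le> scale_ratio \<alpha> T' * fscale \<alpha> \<xi>"
    unfolding fscale_def scale_ratio_def
    using x y a b T freq_ratio_ge[of T' \<alpha>] by (intro powr_comparable) linarith+
qed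

text \<open>
  Disjoint balls of radius \<open>r\<close> inside a ball of radius \<open>R + r\<close>: compare volumes.
\<close>

lemma packing_bound:
  fixes p :: "'i \<Rightarrow> 'v::euclidean_space"
  assumes r: "0 < r" and R: "0 \<le> R" and near: "\<And>k. k \<in> K \<Longrightarrow> norm (p k - c) \<le> R"
    and disj: "\<And>k l. k \<in> K \<Longrightarrow> l \<in> K \<Longrightarrow> k \<noteq> l \<Longrightarrow> ball (p k) r \<inter> ball (p l) r = {}"
  shows "finite K \<and> card K \<le> nat \<lfloor>((R + r) / r) ^ DIM('v)\<rfloor>"
proof (rule finite_if_finite_subsets_card_bdd)
  fix F assume F: "F \<subseteq> K" "finite F"
  let ?U = "unit_ball_vol (real DIM('v))"
  have dd: "disjoint_family_on (\<lambda>k. ball (p k) r) F"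
    unfolding disjoint_family_on_def using F(1) disj by (meson subsetD)
  have "(\<Sum>k\<in>F. measure lborel (ball (p k) r)) = measure lborel (\<Union>k\<in>F. ball (p k) r)"
    using F(2) dd emeasure_bounded_finite[of "ball (p _) r"]
    by (intro measure_finite_Union[symmetric]) (auto simp: less_top)
  also have "\<dots> \<le> measure lborel (ball c (R + r))"
  proof (rule measure_mono_fmeasurable)
    show "(\<Union>k\<in>F. ball (p k) r) \<subseteq> ball c (R + r)"
    proof
      fix x assume "x \<in> (\<Union>k\<in>F. ball (p k) r)"
      then obtain k where k: "k \<in> F" "dist (p k) x < r" by auto
      have "dist c x \<le> dist c (p k) + dist (p k) x" by (rule dist_triangle)
      moreover have "dist c (p k) \<le> R" using near[of k] F k by (auto simp: dist_norm norm_minus_commute)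
      ultimately show "x \<in> ball c (R + r)" using k by simp
    qed
    show "ball c (R + r) \<in> fmeasurable lborel"
      using emeasure_bounded_finite[of "ball c (R + r)"] by (intro fmeasurableI) auto
  qed (use F in auto)
  finally have "real (card F) * (?U * r ^ DIM('v)) \<le> ?U * (R + r) ^ DIM('v)"
    using r R by (simp add: content_ball)
  moreover have "0 < ?U" by simp
  ultimately have "?U * (real (card F) * r ^ DIM('v)) \<le> ?U * (R + r) ^ DIM('v)" by (simp add: ac_simps)
  then have "real (card F) * r ^ DIM('v) \<le> (R + r) ^ DIM('v)" using \<open>0 < ?U\<close> by (simp add: mult_le_cancel_left)
  then have "real (card F) \<le> ((R + r) / r) ^ DIM('v)" using r by (simp add: power_divide pos_le_divide_eq)
  then show "card F \<le> nat \<lfloor>((R + r) / r) ^ DIM('v)\<rfloor>" by linarith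
qed

definition separated_frequencies :: "real \<Rightarrow> real \<Rightarrow> (nat \<Rightarrow> 'v::euclidean_space) \<Rightarrow> bool" where
  "separated_frequencies \<alpha> \<delta> \<xi> \<longleftrightarrow> inj \<xi> \<and> (\<forall>k. 1 \<le> norm (\<xi> k)) \<and>
     (\<forall>k l. k \<noteq> l \<longrightarrow> ball (\<xi> k) (\<delta> * fscale \<alpha> (\<xi> k)) \<inter> ball (\<xi> l) (\<delta> * fscale \<alpha> (\<xi> l)) = {})"

definition overlap_bound :: "'v::euclidean_space itself \<Rightarrow> real \<Rightarrow> real \<Rightarrow> real \<Rightarrow> nat" where
  "overlap_bound _ \<alpha> q T = nat \<lfloor>(q * (scale_ratio \<alpha> T)\<^sup>2 + 1) ^ DIM('v)\<rfloor>"

text \<open>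
  All scales involved agree up to the factor \<open>scale_ratio\<close>, so the balls of radius \<open>\<delta>\<close> times the scale
  may be shrunk to one common radius and packed.
\<close>

lemma bounded_overlap:
  fixes \<xi> :: "nat \<Rightarrow> 'v::euclidean_space"
  assumes \<alpha>: "0 < \<alpha>" and \<delta>: "0 < \<delta>" and sep: "separated_frequencies \<alpha> \<delta> \<xi>"
    and T: "0 \<le> T" "T \<le> T'" "T = q * \<delta>"
  shows "finite {k. norm (\<eta> - \<xi> k) \<le> T * fscale \<alpha> (\<xi> k)} \<and>
    card {k. norm (\<eta> - \<xi> k) \<le> T * fscale \<alpha> (\<xi> k)} \<le> overlap_bound TYPE('v) \<alpha> q T'"
proof (cases "{k. norm (\<eta> - \<xi> k) \<le> T * fscale \<alpha> (\<xi> k)} = {}")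
  case False
  let ?K = "{k. norm (\<eta> - \<xi> k) \<le> T * fscale \<alpha> (\<xi> k)}"
  define \<kappa> where "\<kappa> = scale_ratio \<alpha> T'"
  have \<kappa>: "1 \<le> \<kappa>" unfolding \<kappa>_def using T by (intro scale_ratio_ge) auto
  from False obtain m where m: "m \<in> ?K" by blast
  have n1: "1 \<le> norm (\<xi> k)" for k using sep by (auto simp: separated_frequencies_def)
  let ?s = "\<lambda>k. fscale \<alpha> (\<xi> k)"
  have s0: "0 < ?s k" for k by (rule fscale_pos[OF n1])
  have cmp: "?s k \<le> \<kappa> * ?s l" if "k \<in> ?K" "l \<in> ?K" for k l
    unfolding \<kappa>_def
  proof (rule fscale_comparable[OF \<alpha> n1 n1 T(1,2)])
    have "norm (\<xi> l - \<xi> k) \<le> norm (\<eta> - \<xi> k) + norm (\<eta> - \<xi> l)"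
      using norm_triangle_ineq4[of "\<eta> - \<xi> k" "\<eta> - \<xi> l"] by simp
    then show "norm (\<xi> l - \<xi> k) \<le> T * (?s l + ?s k)" using that by (simp add: distrib_left)
  qed
  define r where "r = \<delta> * ?s m / \<kappa>"
  define R where "R = T * (\<kappa> * ?s m)"
  have r: "0 < r" using \<delta> s0[of m] \<kappa> by (simp add: r_def)
  have R: "0 \<le> R" using T s0[of m] \<kappa> by (simp add: R_def)
  have rle: "r \<le> \<delta> * ?s k" if "k \<in> ?K" for k
    using cmp[OF m that] \<delta> \<kappa> by (simp add: r_def divide_le_eq mult.commute mult.left_commute)
  have "finite ?K \<and> card ?K \<le> nat \<lfloor>((R + r) / r) ^ DIM('v)\<rfloor>"
  proof (rule packing_bound[where p=\<xi> and c=\<eta>, OF r R])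
    fix k assume k: "k \<in> ?K"
    have "T * ?s k \<le> R" unfolding R_def using cmp[OF k m] T by (intro mult_left_mono) auto
    then show "norm (\<xi> k - \<eta>) \<le> R" using k by (simp add: norm_minus_commute)
    fix l assume l: "l \<in> ?K" "k \<noteq> l"
    have "ball (\<xi> k) (\<delta> * ?s k) \<inter> ball (\<xi> l) (\<delta> * ?s l) = {}"
      using sep l by (auto simp: separated_frequencies_def)
    then show "ball (\<xi> k) r \<inter> ball (\<xi> l) r = {}"
      using subset_ball[OF rle[OF k], of "\<xi> k"] subset_ball[OF rle[OF l(1)], of "\<xi> l"] by blast
  qed
  moreover have "(R + r) / r = q * \<kappa>\<^sup>2 + 1"
  proof -
    have "R = q * \<kappa>\<^sup>2 * r" using \<kappa> by (simp add: R_def r_def T(3) power2_eq_square)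
    then show ?thesis using r by (simp add: add_divide_distrib)
  qed
  ultimately show ?thesis unfolding overlap_bound_def \<kappa>_def by simp
qed simp

lemma mem_half_open_cube_dist:
  fixes x y :: "real^'d::finite"
  assumes "x \<in> half_open_cube c h" "y \<in> half_open_cube c h"
  shows "norm (x - y) \<le> real CARD('d) * h"
proof -
  have "norm (x - y) \<le> (\<Sum>i\<in>UNIV. \<bar>(x - y) $ i\<bar>)" by (rule norm_le_l1_cart)
  also have "\<dots> \<le> (\<Sum>i\<in>(UNIV::'d set). h)"
  proof (rule sum_mono)
    fix i
    have "c $ i \<le> x $ i" "x $ i < c $ i + h" "c $ i \<le> y $ i" "y $ i < c $ i + h"
      using assms by (auto simp: half_open_cube_def)
    then show "\<bar>(x - y) $ i\<bar> \<le> h" by simp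
  qed
  finally show ?thesis by simp
qed

lemma candidate_set_subset: "candidate_set \<alpha> \<rho> n C \<Longrightarrow> C \<subseteq> dyadic_annulus n"
  unfolding candidate_set_def by blast

lemma candidate_set_near:
  fixes \<eta> :: "real^'d::finite"
  assumes "candidate_set \<alpha> \<rho> n C" "\<eta> \<in> dyadic_annulus n"
  shows "\<exists>\<zeta>\<in>C. norm (\<eta> - \<zeta>) \<le> real CARD('d) * (\<rho> * 2 powr (real n * (1 - \<alpha>)))"
proof -
  let ?h = "\<rho> * 2 powr (real n * (1 - \<alpha>))"
  obtain P p where P: "P \<subseteq> range (\<lambda>c. half_open_cube c ?h)" "\<Union>P = UNIV"
    and p: "\<forall>Q\<in>P. Q \<inter> dyadic_annulus n \<noteq> {} \<longrightarrow> p Q \<in> Q \<inter> dyadic_annulus n"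
    and C: "C = p ` {Q \<in> P. Q \<inter> dyadic_annulus n \<noteq> {}}"
    using assms(1) unfolding candidate_set_def by blast
  obtain Q where Q: "Q \<in> P" "\<eta> \<in> Q" using P(2) by blast
  then have ne: "Q \<inter> dyadic_annulus n \<noteq> {}" using assms(2) by blast
  obtain c where c: "Q = half_open_cube c ?h" using P(1) Q(1) by blast
  have "p Q \<in> C" using C Q(1) ne by blast
  moreover have "p Q \<in> Q" using p Q(1) ne by blast
  ultimately show ?thesis using mem_half_open_cube_dist[of \<eta> c ?h "p Q"] Q(2) c by blast
qed

lemma dyadic_annulus_exists:
  assumes "1 \<le> norm \<eta>" shows "\<exists>n. \<eta> \<in> dyadic_annulus n"
proof -
  obtain m where "norm \<eta> < 2 ^ m" using real_arch_pow[of 2 "norm \<eta>"] by auto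
  define n where "n = (LEAST m. norm \<eta> < 2 ^ m)"
  have 1: "norm \<eta> < 2 ^ n" unfolding n_def by (rule LeastI) fact
  then obtain k where k: "n = Suc k" using assms by (cases n) auto
  have "\<not> norm \<eta> < 2 ^ k" using not_less_Least[of k "\<lambda>m. norm \<eta> < 2 ^ m"] k by (simp add: n_def)
  then show ?thesis using 1 k by (auto simp: dyadic_annulus_def not_less)
qed

lemma dyadic_annulus_norm: "\<eta> \<in> dyadic_annulus n \<Longrightarrow> 1 \<le> norm \<eta>"
proof -
  assume "\<eta> \<in> dyadic_annulus n"
  moreover have "1 \<le> (2::real) ^ n" by simp
  ultimately show ?thesis unfolding dyadic_annulus_def mem_Collect_eq by linarith
qed

context
  fixes \<alpha> a \<rho> :: real and \<xi> :: "nat \<Rightarrow> real^'d::finite"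
  assumes \<alpha>: "0 < \<alpha>" and a: "0 < a" and \<rho>: "0 < \<rho>" and a\<rho>: "a * \<rho> \<le> 1" "a \<le> 1"
    and sub: "subdyadic_frequencies \<alpha> a \<rho> \<xi>"
begin

lemma subdyadic_separated: "separated_frequencies \<alpha> (a * \<rho>) \<xi>"
proof -
  obtain C c where C: "\<forall>n. candidate_set \<alpha> \<rho> n (C n)" and c: "candidate_ordering C c"
    and \<xi>: "bij_betw \<xi> UNIV (c ` {i. retained \<alpha> a \<rho> c i})"
    using sub unfolding subdyadic_frequencies_def by blast
  have inj: "inj \<xi>" using \<xi> by (simp add: bij_betw_def)
  have mem: "\<exists>i. retained \<alpha> a \<rho> c i \<and> \<xi> k = c i" for k using bij_betwE[OF \<xi>] by blast
  have n1: "1 \<le> norm (c i)" for i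
  proof -
    have "c i \<in> (\<Union>n. C n)" using c by (auto simp: candidate_ordering_def dest: bij_betwE)
    then show ?thesis using C candidate_set_subset dyadic_annulus_norm by blast
  qed
  have ret: "ball (c i) (a * \<rho> * fscale \<alpha> (c i)) \<inter> ball (c j) (a * \<rho> * fscale \<alpha> (c j)) = {}"
    if "retained \<alpha> a \<rho> c i" "retained \<alpha> a \<rho> c j" "j < i" for i j
    using that(1)[unfolded retained.simps[of \<alpha> a \<rho> c i], rule_format, of j] that(2,3) by (simp add: fscale_def)
  show ?thesis
    unfolding separated_frequencies_def
  proof (intro conjI inj allI impI)
    show "1 \<le> norm (\<xi> k)" for k using mem[of k] n1 by auto
    fix k l :: nat assume kl: "k \<noteq> l"
    obtain i j where ij: "retained \<alpha> a \<rho> c i" "\<xi> k = c i" "retained \<alpha> a \<rho> c j" "\<xi> l = c j" using mem by blast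
    have "i \<noteq> j" using inj_eq[OF inj, of k l] kl ij by auto
    then show "ball (\<xi> k) (a * \<rho> * fscale \<alpha> (\<xi> k)) \<inter> ball (\<xi> l) (a * \<rho> * fscale \<alpha> (\<xi> l)) = {}"
      using ret[of i j] ret[of j i] ij by (cases "j < i") (auto simp: Int_commute)
  qed
qed

text \<open>
  The first candidate is always retained, and it comes from the first annulus because the ordering
  respects annuli.
\<close>

lemma subdyadic_low_frequency: "\<exists>k. norm (\<xi> k) < 2"
proof -
  obtain C c where C: "\<forall>n. candidate_set \<alpha> \<rho> n (C n)" and c: "candidate_ordering C c"
    and \<xi>: "bij_betw \<xi> UNIV (c ` {i. retained \<alpha> a \<rho> c i})"
    using sub unfolding subdyadic_frequencies_def by blast
  have "retained \<alpha> a \<rho> c 0" by (subst retained.simps) simp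
  then obtain k where k: "\<xi> k = c 0" using \<xi> unfolding bij_betw_def by (metis (mono_tags, lifting) image_iff mem_Collect_eq)
  have b: "bij_betw c UNIV (\<Union>n. C n)" using c by (simp add: candidate_ordering_def)
  have "axis undefined (1::real) \<in> (dyadic_annulus 0 :: (real^'d) set)" by (simp add: dyadic_annulus_def norm_axis_1)
  then obtain \<zeta> where "\<zeta> \<in> C 0" using candidate_set_near[OF C[rule_format, of 0]] by blast
  then obtain i where i: "c i \<in> C 0" using b unfolding bij_betw_def by (metis UN_I UNIV_I image_iff)
  obtain m where m: "c 0 \<in> C m" using bij_betwE[OF b] by blast
  have "m = 0"
  proof (rule ccontr)
    assume "m \<noteq> 0"
    then have "i < 0" using c i m unfolding candidate_ordering_def by blast
    then show False by simp
  qed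
  then have "c 0 \<in> dyadic_annulus 0" using m C candidate_set_subset by blast
  then show ?thesis using k by (intro exI[of _ k]) (simp add: dyadic_annulus_def)
qed

text \<open>
  A point of an annulus is within one grid cube of a candidate.  The candidate is either retained or
  rejected because of a retained frequency nearby; in both cases the scales are comparable.
\<close>

lemma subdyadic_covering:
  assumes \<eta>: "1 \<le> norm \<eta>"
  shows "\<exists>k. norm (\<eta> - \<xi> k) \<le> (real CARD('d) * (scale_ratio \<alpha> 1)\<^sup>2 + scale_ratio \<alpha> 1 + 1) * \<rho> * fscale \<alpha> (\<xi> k)"
proof -
  obtain C c where C: "\<forall>n. candidate_set \<alpha> \<rho> n (C n)" and c: "candidate_ordering C c"
    and \<xi>: "bij_betw \<xi> UNIV (c ` {i. retained \<alpha> a \<rho> c i})"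
    using sub unfolding subdyadic_frequencies_def by blast
  have b: "bij_betw c UNIV (\<Union>n. C n)" using c by (simp add: candidate_ordering_def)
  obtain n where n: "\<eta> \<in> dyadic_annulus n" using dyadic_annulus_exists[OF \<eta>] by blast
  define h where "h = 2 powr (real n * (1 - \<alpha>))"
  obtain \<zeta> where \<zeta>: "\<zeta> \<in> C n" "norm (\<eta> - \<zeta>) \<le> real CARD('d) * (\<rho> * h)"
    using candidate_set_near[OF C[rule_format] n] unfolding h_def by blast
  obtain i where i: "c i = \<zeta>" using b \<zeta>(1) unfolding bij_betw_def by (metis UN_I UNIV_I image_iff)
  define \<kappa> where "\<kappa> = scale_ratio \<alpha> 1"
  have \<kappa>: "1 \<le> \<kappa>" unfolding \<kappa>_def by (intro scale_ratio_ge) auto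
  have n1: "1 \<le> norm (c j)" for j
  proof -
    have "c j \<in> (\<Union>n. C n)" using bij_betwE[OF b] by blast
    then show ?thesis using C candidate_set_subset dyadic_annulus_norm by blast
  qed
  have "\<exists>j. retained \<alpha> a \<rho> c j \<and> norm (c j - c i) \<le> (a * \<rho>) * (fscale \<alpha> (c j) + fscale \<alpha> (c i))"
  proof (cases "retained \<alpha> a \<rho> c i")
    case True
    then show ?thesis using a \<rho> by (intro exI[of _ i]) (simp add: fscale_def)
  next
    case False
    then obtain j x where j: "retained \<alpha> a \<rho> c j" and x: "dist (c i) x < a * \<rho> * fscale \<alpha> (c i)" "dist (c j) x < a * \<rho> * fscale \<alpha> (c j)"
      by (subst (asm) retained.simps) (auto simp: fscale_def)
    have "norm (c j - c i) \<le> dist (c j) x + dist (c i) x" by (metis dist_norm dist_triangle2)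
    then show ?thesis using x j by (intro exI[of _ j]) (simp add: distrib_left)
  qed
  then obtain j where j: "retained \<alpha> a \<rho> c j" and d: "norm (c j - c i) \<le> (a * \<rho>) * (fscale \<alpha> (c j) + fscale \<alpha> (c i))" by blast
  obtain k where k: "\<xi> k = c j" using \<xi> j unfolding bij_betw_def by (metis (mono_tags, lifting) image_iff mem_Collect_eq)
  have s1: "fscale \<alpha> (c i) \<le> \<kappa> * fscale \<alpha> (c j)"
    unfolding \<kappa>_def using a \<rho> a\<rho> by (intro fscale_comparable[OF \<alpha> n1 n1 _ _ d]) auto
  have ci: "2 ^ n \<le> norm (c i)" "norm (c i) < 2 * 2 ^ n"
    using \<zeta>(1) C candidate_set_subset i unfolding dyadic_annulus_def by fastforce+
  have h2: "h = (2 ^ n) powr (1 - \<alpha>)" by (simp add: h_def powr_powr flip: powr_realpow)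
  have s2: "h \<le> \<kappa> * fscale \<alpha> (c i)"
  proof -
    have f: "2 \<le> freq_ratio \<alpha> 1" by (rule freq_ratio_ge) simp
    have "norm (c i) * 1 \<le> norm (c i) * freq_ratio \<alpha> 1" using f by (intro mult_left_mono) auto
    then have u1: "(2::real) ^ n \<le> freq_ratio \<alpha> 1 * norm (c i)" using ci by (simp add: mult.commute)
    have "2 * 2 ^ n \<le> freq_ratio \<alpha> 1 * 2 ^ n" using f by (intro mult_right_mono) auto
    then have u2: "norm (c i) \<le> freq_ratio \<alpha> 1 * 2 ^ n" using ci by linarith
    show ?thesis
      unfolding h2 \<kappa>_def scale_ratio_def fscale_def
    proof (rule powr_comparable)
      show "0 < norm (c i)" using n1[of i] by linarith
      show "1 \<le> freq_ratio \<alpha> 1" using f by linarith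
    qed (use u1 u2 in auto)
  qed
  have "h \<le> \<kappa> * (\<kappa> * fscale \<alpha> (c j))" using s1 s2 \<kappa> by (meson mult_left_mono order_trans zero_le_one)
  then have A: "real CARD('d) * (\<rho> * h) \<le> real CARD('d) * (\<rho> * (\<kappa> * (\<kappa> * fscale \<alpha> (c j))))"
    using \<rho> by (intro mult_left_mono) auto
  have B: "(a * \<rho>) * (fscale \<alpha> (c j) + fscale \<alpha> (c i)) \<le> (1 * \<rho>) * (fscale \<alpha> (c j) + \<kappa> * fscale \<alpha> (c j))"
    using a \<rho> a\<rho> s1 by (intro mult_mono add_mono) (auto simp: fscale_def)
  have "norm (\<eta> - \<xi> k) \<le> norm (\<eta> - \<zeta>) + norm (c j - c i)"
    using norm_triangle_ineq4[of "\<eta> - \<zeta>" "c j - c i"] by (simp add: k i)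
  also have "\<dots> \<le> real CARD('d) * (\<rho> * (\<kappa> * (\<kappa> * fscale \<alpha> (c j)))) + (1 * \<rho>) * (fscale \<alpha> (c j) + \<kappa> * fscale \<alpha> (c j))"
    using \<zeta>(2) d A B by linarith
  also have "\<dots> = (real CARD('d) * \<kappa>\<^sup>2 + \<kappa> + 1) * \<rho> * fscale \<alpha> (\<xi> k)"
    by (simp add: k power2_eq_square algebra_simps)
  finally show ?thesis unfolding \<kappa>_def by blast
qed

end

section \<open>Bounded directional derivatives\<close>

text \<open>
  \<open>f\<close> and its first \<open>n\<close> derivatives along \<open>v\<close> are bounded by \<open>C\<close> on \<open>U\<close>.  Scaling \<open>v\<close> expresses bounds
  at different length scales without extra parameters, and one direction at a time is all that
  integration by parts uses.
\<close>

primrec dir_bounded :: "'v::real_normed_vector set \<Rightarrow> 'v \<Rightarrow> nat \<Rightarrow> real \<Rightarrow> ('v \<Rightarrow> complex) \<Rightarrow> bool" where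
  "dir_bounded U v 0 C f \<longleftrightarrow> (\<forall>\<eta>\<in>U. cmod (f \<eta>) \<le> C)"
| "dir_bounded U v (Suc n) C f \<longleftrightarrow> (\<forall>\<eta>\<in>U. cmod (f \<eta>) \<le> C) \<and>
     (\<exists>f'. (\<forall>\<eta>\<in>U. ((\<lambda>\<tau>. f (\<eta> + \<tau> *\<^sub>R v)) has_vector_derivative f' \<eta>) (at 0)) \<and> dir_bounded U v n C f')"

lemma dir_bounded_bound: "dir_bounded U v n C f \<Longrightarrow> \<eta> \<in> U \<Longrightarrow> cmod (f \<eta>) \<le> C"
  by (cases n) auto

lemma dir_bounded_SucI:
  assumes "\<And>\<eta>. \<eta> \<in> U \<Longrightarrow> cmod (f \<eta>) \<le> C"
    "\<And>\<eta>. \<eta> \<in> U \<Longrightarrow> ((\<lambda>\<tau>. f (\<eta> + \<tau> *\<^sub>R v)) has_vector_derivative f' \<eta>) (at 0)"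
    "dir_bounded U v n C f'"
  shows "dir_bounded U v (Suc n) C f"
proof -
  have "\<forall>\<eta>\<in>U. cmod (f \<eta>) \<le> C" using assms(1) by blast
  moreover have "\<forall>\<eta>\<in>U. ((\<lambda>\<tau>. f (\<eta> + \<tau> *\<^sub>R v)) has_vector_derivative f' \<eta>) (at 0)" using assms(2) by blast
  ultimately show ?thesis unfolding dir_bounded.simps using assms(3) by blast
qed

lemma dir_bounded_mono: "dir_bounded U v n C f \<Longrightarrow> C \<le> D \<Longrightarrow> dir_bounded U v n D f"
proof (induction n arbitrary: f)
  case 0
  then show ?case by (auto intro: order_trans)
next
  case (Suc n)
  then obtain f' where f': "\<forall>\<eta>\<in>U. ((\<lambda>\<tau>. f (\<eta> + \<tau> *\<^sub>R v)) has_vector_derivative f' \<eta>) (at 0)"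
    "dir_bounded U v n C f'" by auto
  show ?case
    by (rule dir_bounded_SucI[where f'=f'])
       (use f' Suc.IH Suc.prems(2) order_trans[OF dir_bounded_bound[OF Suc.prems(1)] Suc.prems(2)] in auto)
qed

lemma dir_bounded_Suc: "dir_bounded U v (Suc n) C f \<Longrightarrow> dir_bounded U v n C f"
proof (induction n arbitrary: f)
  case (Suc n)
  then obtain f' where f': "\<forall>\<eta>\<in>U. ((\<lambda>\<tau>. f (\<eta> + \<tau> *\<^sub>R v)) has_vector_derivative f' \<eta>) (at 0)"
    "dir_bounded U v (Suc n) C f'" by auto
  show ?case
    by (rule dir_bounded_SucI[where f'=f']) (use f' Suc dir_bounded_bound[OF Suc.prems] in auto)
qed simp

lemma dir_bounded_zero: "0 \<le> C \<Longrightarrow> dir_bounded U v n C (\<lambda>_. 0)"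
proof (induction n)
  case (Suc n)
  show ?case by (rule dir_bounded_SucI[where f'="\<lambda>_. 0"]) (use Suc in auto)
qed simp

lemma dir_bounded_add:
  "dir_bounded U v n C f \<Longrightarrow> dir_bounded U v n D g \<Longrightarrow> dir_bounded U v n (C + D) (\<lambda>\<eta>. f \<eta> + g \<eta>)"
proof (induction n arbitrary: f g)
  case 0
  then show ?case by (auto intro: order_trans[OF norm_triangle_ineq add_mono])
next
  case (Suc n)
  then obtain f' g' where f': "\<forall>\<eta>\<in>U. ((\<lambda>\<tau>. f (\<eta> + \<tau> *\<^sub>R v)) has_vector_derivative f' \<eta>) (at 0)" "dir_bounded U v n C f'"
    and g': "\<forall>\<eta>\<in>U. ((\<lambda>\<tau>. g (\<eta> + \<tau> *\<^sub>R v)) has_vector_derivative g' \<eta>) (at 0)" "dir_bounded U v n D g'" by auto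
  show ?case
  proof (rule dir_bounded_SucI[where f'="\<lambda>\<eta>. f' \<eta> + g' \<eta>"])
    show "cmod (f \<eta> + g \<eta>) \<le> C + D" if "\<eta> \<in> U" for \<eta>
      using dir_bounded_bound[OF Suc.prems(1) that] dir_bounded_bound[OF Suc.prems(2) that]
      by (intro order_trans[OF norm_triangle_ineq add_mono])
    show "((\<lambda>\<tau>. f (\<eta> + \<tau> *\<^sub>R v) + g (\<eta> + \<tau> *\<^sub>R v)) has_vector_derivative f' \<eta> + g' \<eta>) (at 0)" if "\<eta> \<in> U" for \<eta>
      using f' g' that by (intro has_vector_derivative_add) auto
  qed (use Suc f' g' in auto)
qed

lemma dir_bounded_sum:
  assumes "finite F" "\<And>l. l \<in> F \<Longrightarrow> dir_bounded U v n C (f l)" "0 \<le> C"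
  shows "dir_bounded U v n (real (card F) * C) (\<lambda>\<eta>. \<Sum>l\<in>F. f l \<eta>)"
  using assms
proof (induction F rule: finite_induct)
  case empty
  then show ?case by (simp add: dir_bounded_zero)
next
  case (insert l F)
  then have "dir_bounded U v n (C + real (card F) * C) (\<lambda>\<eta>. f l \<eta> + (\<Sum>l\<in>F. f l \<eta>))"
    by (intro dir_bounded_add) auto
  then show ?case using insert by (simp add: distrib_right)
qed

lemma dir_bounded_mult:
  "dir_bounded U v n C f \<Longrightarrow> dir_bounded U v n D g \<Longrightarrow> 0 \<le> C \<Longrightarrow> 0 \<le> D \<Longrightarrow> dir_bounded U v n (2 ^ n * C * D) (\<lambda>\<eta>. f \<eta> * g \<eta>)"
proof (induction n arbitrary: f g)
  case 0
  then show ?case by (auto simp: norm_mult intro!: mult_mono)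
next
  case (Suc n)
  then obtain f' g' where f': "\<forall>\<eta>\<in>U. ((\<lambda>\<tau>. f (\<eta> + \<tau> *\<^sub>R v)) has_vector_derivative f' \<eta>) (at 0)" "dir_bounded U v n C f'"
    and g': "\<forall>\<eta>\<in>U. ((\<lambda>\<tau>. g (\<eta> + \<tau> *\<^sub>R v)) has_vector_derivative g' \<eta>) (at 0)" "dir_bounded U v n D g'" by auto
  note f0 = dir_bounded_Suc[OF Suc.prems(1)] and g0 = dir_bounded_Suc[OF Suc.prems(2)]
  show ?case
  proof (rule dir_bounded_SucI[where f'="\<lambda>\<eta>. f \<eta> * g' \<eta> + f' \<eta> * g \<eta>"])
    show "cmod (f \<eta> * g \<eta>) \<le> 2 ^ Suc n * C * D" if "\<eta> \<in> U" for \<eta>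
    proof -
      have "cmod (f \<eta> * g \<eta>) \<le> C * D"
        unfolding norm_mult using dir_bounded_bound[OF f0 that] dir_bounded_bound[OF g0 that] Suc.prems by (intro mult_mono) auto
      also have "1 * (C * D) \<le> 2 ^ Suc n * (C * D)" using Suc.prems by (intro mult_right_mono) (auto simp del: power_Suc)
      finally show ?thesis by (simp add: mult.assoc)
    qed
    show "((\<lambda>\<tau>. f (\<eta> + \<tau> *\<^sub>R v) * g (\<eta> + \<tau> *\<^sub>R v)) has_vector_derivative f \<eta> * g' \<eta> + f' \<eta> * g \<eta>) (at 0)" if "\<eta> \<in> U" for \<eta>
      using has_vector_derivative_mult[OF f'(1)[rule_format, OF that] g'(1)[rule_format, OF that]] by simp
    have "dir_bounded U v n (2 ^ n * C * D + 2 ^ n * C * D) (\<lambda>\<eta>. f \<eta> * g' \<eta> + f' \<eta> * g \<eta>)"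
      using f0 g0 f' g' Suc by (intro dir_bounded_add Suc.IH) auto
    moreover have "2 ^ n * C * D + 2 ^ n * C * D = 2 ^ Suc n * C * D" by simp
    ultimately show "dir_bounded U v n (2 ^ Suc n * C * D) (\<lambda>\<eta>. f \<eta> * g' \<eta> + f' \<eta> * g \<eta>)" by (simp only:)
  qed
qed

lemma dir_bounded_cnj: "dir_bounded U v n C f \<Longrightarrow> dir_bounded U v n C (\<lambda>\<eta>. cnj (f \<eta>))"
proof (induction n arbitrary: f)
  case (Suc n)
  then obtain f' where f': "\<forall>\<eta>\<in>U. ((\<lambda>\<tau>. f (\<eta> + \<tau> *\<^sub>R v)) has_vector_derivative f' \<eta>) (at 0)" "dir_bounded U v n C f'" by auto
  show ?case
  proof (rule dir_bounded_SucI[where f'="\<lambda>\<eta>. cnj (f' \<eta>)"])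
    show "((\<lambda>\<tau>. cnj (f (\<eta> + \<tau> *\<^sub>R v))) has_vector_derivative cnj (f' \<eta>)) (at 0)" if "\<eta> \<in> U" for \<eta>
      using f' that by (intro has_vector_derivative_cnj) auto
  qed (use f' Suc dir_bounded_bound[OF Suc.prems] in auto)
qed simp

lemma dir_bounded_uminus: "dir_bounded U v n C f \<Longrightarrow> dir_bounded U v n C (\<lambda>\<eta>. - f \<eta>)"
proof (induction n arbitrary: f)
  case (Suc n)
  then obtain f' where f': "\<forall>\<eta>\<in>U. ((\<lambda>\<tau>. f (\<eta> + \<tau> *\<^sub>R v)) has_vector_derivative f' \<eta>) (at 0)" "dir_bounded U v n C f'" by auto
  show ?case
  proof (rule dir_bounded_SucI[where f'="\<lambda>\<eta>. - f' \<eta>"])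
    show "((\<lambda>\<tau>. - f (\<eta> + \<tau> *\<^sub>R v)) has_vector_derivative - f' \<eta>) (at 0)" if "\<eta> \<in> U" for \<eta>
      using f' that by (intro has_vector_derivative_minus) auto
  qed (use f' Suc dir_bounded_bound[OF Suc.prems] in auto)
qed simp

lemma dir_bounded_cmult: "dir_bounded U v n C f \<Longrightarrow> 0 \<le> C \<Longrightarrow> dir_bounded U v n (cmod c * C) (\<lambda>\<eta>. c * f \<eta>)"
proof (induction n arbitrary: f)
  case 0
  then show ?case by (auto simp: norm_mult intro!: mult_left_mono)
next
  case (Suc n)
  then obtain f' where f': "\<forall>\<eta>\<in>U. ((\<lambda>\<tau>. f (\<eta> + \<tau> *\<^sub>R v)) has_vector_derivative f' \<eta>) (at 0)" "dir_bounded U v n C f'" by auto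
  show ?case
  proof (rule dir_bounded_SucI[where f'="\<lambda>\<eta>. c * f' \<eta>"])
    show "((\<lambda>\<tau>. c * f (\<eta> + \<tau> *\<^sub>R v)) has_vector_derivative c * f' \<eta>) (at 0)" if "\<eta> \<in> U" for \<eta>
      using f' that by (intro has_vector_derivative_mult_right) auto
  qed (use f' Suc dir_bounded_bound[OF Suc.prems(1)] in \<open>auto simp: norm_mult intro!: mult_left_mono\<close>)
qed

text \<open>
  By induction, as the derivative of \<open>1 / m\<close> is \<open>- m' * (1 / m)\<^sup>2\<close>.  The constant depends on the bounds
  for \<open>m\<close> alone, which makes estimates uniform over infinitely many functions \<open>m\<close>.
\<close>

lemma dir_bounded_inverse:
  assumes "0 < A" "0 \<le> C"
  shows "\<exists>K\<ge>0. \<forall>U (v::'v::real_normed_vector) m. dir_bounded U v n C m \<longrightarrow> (\<forall>\<eta>\<in>U. A \<le> cmod (m \<eta>)) \<longrightarrow>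
    dir_bounded U v n K (\<lambda>\<eta>. inverse (m \<eta>))"
proof (induction n)
  case 0
  show ?case using assms by (intro exI[of _ "inverse A"]) (auto simp: norm_inverse intro!: le_imp_inverse_le)
next
  case (Suc n)
  then obtain K where K: "0 \<le> K" and IH: "\<And>U (v::'v) m. dir_bounded U v n C m \<Longrightarrow> (\<forall>\<eta>\<in>U. A \<le> cmod (m \<eta>)) \<Longrightarrow>
    dir_bounded U v n K (\<lambda>\<eta>. inverse (m \<eta>))" by blast
  define L where "L = 2 ^ n * C * (2 ^ n * K * K)"
  have L: "0 \<le> L" using assms K by (simp add: L_def)
  show ?case
  proof (intro exI[of _ "max (inverse A) L"] conjI allI impI)
    show "0 \<le> max (inverse A) L" using L by simp
    fix U and v :: 'v and m assume m: "dir_bounded U v (Suc n) C m" and mA: "\<forall>\<eta>\<in>U. A \<le> cmod (m \<eta>)"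
    then obtain m' where m': "\<forall>\<eta>\<in>U. ((\<lambda>\<tau>. m (\<eta> + \<tau> *\<^sub>R v)) has_vector_derivative m' \<eta>) (at 0)" "dir_bounded U v n C m'" by auto
    have I: "dir_bounded U v n K (\<lambda>\<eta>. inverse (m \<eta>))" by (rule IH[OF dir_bounded_Suc[OF m] mA])
    show "dir_bounded U v (Suc n) (max (inverse A) L) (\<lambda>\<eta>. inverse (m \<eta>))"
    proof (rule dir_bounded_SucI[where f'="\<lambda>\<eta>. - (m' \<eta> * (inverse (m \<eta>) * inverse (m \<eta>)))"])
      show "cmod (inverse (m \<eta>)) \<le> max (inverse A) L" if "\<eta> \<in> U" for \<eta>
        using le_imp_inverse_le[OF mA[rule_format, OF that] assms(1)] by (simp add: norm_inverse le_max_iff_disj)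
      show "((\<lambda>\<tau>. inverse (m (\<eta> + \<tau> *\<^sub>R v))) has_vector_derivative - (m' \<eta> * (inverse (m \<eta>) * inverse (m \<eta>)))) (at 0)" if "\<eta> \<in> U" for \<eta>
      proof -
        have nz: "m \<eta> \<noteq> 0" using mA that assms(1) by fastforce
        have "(inverse has_field_derivative - (inverse (m \<eta>) * 1 * inverse (m \<eta>))) (at (m (\<eta> + 0 *\<^sub>R v)))"
          using nz by (auto intro!: derivative_eq_intros)
        from field_vector_diff_chain_at[OF m'(1)[rule_format, OF that] this]
        show ?thesis by (simp add: o_def ac_simps)
      qed
      have "dir_bounded U v n L (\<lambda>\<eta>. m' \<eta> * (inverse (m \<eta>) * inverse (m \<eta>)))"
        unfolding L_def using assms K by (intro dir_bounded_mult m'(2) I) auto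
      from dir_bounded_mono[OF dir_bounded_uminus[OF this]]
      show "dir_bounded U v n (max (inverse A) L) (\<lambda>\<eta>. - (m' \<eta> * (inverse (m \<eta>) * inverse (m \<eta>))))" by simp
    qed
  qed
qed

lemma eventually_line_open:
  fixes U :: "'v::real_normed_vector set"
  assumes "open U" "\<eta> \<in> U"
  shows "\<forall>\<^sub>F \<tau> in nhds (0::real). \<eta> + \<tau> *\<^sub>R v \<in> U"
proof -
  have "((\<lambda>\<tau>. \<eta> + \<tau> *\<^sub>R v) \<longlongrightarrow> \<eta> + 0 *\<^sub>R v) (nhds (0::real))"
    by (intro tendsto_intros filterlim_ident)
  then show ?thesis using assms by (intro topological_tendstoD) auto
qed

lemma has_vector_derivative_line_cong:
  fixes U :: "'v::real_normed_vector set" and f g :: "'v \<Rightarrow> complex"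
  assumes U: "open U" "\<eta> \<in> U" and eq: "\<And>\<eta>. \<eta> \<in> U \<Longrightarrow> f \<eta> = g \<eta>"
    and d: "((\<lambda>\<tau>. f (\<eta> + \<tau> *\<^sub>R v)) has_vector_derivative D) (at 0)"
  shows "((\<lambda>\<tau>. g (\<eta> + \<tau> *\<^sub>R v)) has_vector_derivative D) (at 0)"
proof -
  have "\<forall>\<^sub>F \<tau> in nhds (0::real). f (\<eta> + \<tau> *\<^sub>R v) = g (\<eta> + \<tau> *\<^sub>R v)"
    using eventually_line_open[OF U] by eventually_elim (rule eq)
  then have ev: "\<forall>\<^sub>F \<tau> in at (0::real). f (\<eta> + \<tau> *\<^sub>R v) = g (\<eta> + \<tau> *\<^sub>R v)"
    unfolding eventually_at_filter by eventually_elim simp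
  show ?thesis
    using d unfolding has_vector_derivative_def
    by (rule has_derivative_transform_eventually[OF _ ev]) (use U eq in auto)
qed

lemma dir_bounded_cong:
  assumes U: "open U" and eq: "\<And>\<eta>. \<eta> \<in> U \<Longrightarrow> f \<eta> = g \<eta>" and f: "dir_bounded U v n C f"
  shows "dir_bounded U v n C g"
proof (cases n)
  case 0
  then show ?thesis using f eq by auto
next
  case (Suc k)
  then obtain f' where f': "\<forall>\<eta>\<in>U. ((\<lambda>\<tau>. f (\<eta> + \<tau> *\<^sub>R v)) has_vector_derivative f' \<eta>) (at 0)" "dir_bounded U v k C f'"
    using f by auto
  show ?thesis unfolding Suc
  proof (rule dir_bounded_SucI[where f'=f'])
    show "cmod (g \<eta>) \<le> C" if "\<eta> \<in> U" for \<eta> using dir_bounded_bound[OF f that] eq[OF that] by simp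
    show "((\<lambda>\<tau>. g (\<eta> + \<tau> *\<^sub>R v)) has_vector_derivative f' \<eta>) (at 0)" if "\<eta> \<in> U" for \<eta>
      by (rule has_vector_derivative_line_cong[where U=U and f=f]) (use U eq f' that in auto)
  qed (rule f')
qed

lemma zero_derivative_off_support:
  fixes K :: "'v::real_normed_vector set" and G :: "'v \<Rightarrow> complex"
  assumes "closed K" "\<And>\<eta>. \<eta> \<notin> K \<Longrightarrow> G \<eta> = 0" "\<eta> \<notin> K"
  shows "((\<lambda>\<tau>. G (\<eta> + \<tau> *\<^sub>R v)) has_vector_derivative 0) (at 0)"
proof (rule has_vector_derivative_line_cong[where U="- K" and f="\<lambda>_. 0"])
  show "open (- K)" using assms(1) by (rule open_Compl)
  show "\<eta> \<in> - K" using assms(3) by simp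
  show "0 = G \<zeta>" if "\<zeta> \<in> - K" for \<zeta> using assms(2)[of \<zeta>] that by simp
  show "((\<lambda>\<tau>. 0) has_vector_derivative 0) (at 0)" by (rule has_vector_derivative_const)
qed

text \<open>
  The symbol is only controlled near the support of a bump; multiplied by the bump, the local
  bounds become global ones.
\<close>

lemma dir_bounded_extend:
  assumes U: "open U" and K: "closed K" "K \<subseteq> U" and C: "0 \<le> C"
    and G: "dir_bounded U v n C G" and supp: "\<And>\<eta>. \<eta> \<notin> K \<Longrightarrow> G \<eta> = 0"
  shows "dir_bounded UNIV v n C G"
  using G supp
proof (induction n arbitrary: G)
  case 0
  then show ?case using C K by (auto simp: subset_iff) (metis norm_zero)
next
  case (Suc n)
  then obtain G' where G': "\<forall>\<eta>\<in>U. ((\<lambda>\<tau>. G (\<eta> + \<tau> *\<^sub>R v)) has_vector_derivative G' \<eta>) (at 0)" "dir_bounded U v n C G'" by auto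
  let ?H = "\<lambda>\<eta>. if \<eta> \<in> K then G' \<eta> else 0"
  have off: "G' \<eta> = 0" if "\<eta> \<in> U" "\<eta> \<notin> K" for \<eta>
    using vector_derivative_unique_at[OF G'(1)[rule_format, OF that(1)] zero_derivative_off_support[where G=G, OF K(1) Suc.prems(2) that(2)]] by simp
  show ?case
  proof (rule dir_bounded_SucI[where f'="?H"])
    show "cmod (G \<eta>) \<le> C" for \<eta>
    proof (cases "\<eta> \<in> U")
      case True
      then show ?thesis by (rule dir_bounded_bound[OF Suc.prems(1)])
    next
      case False
      then have "G \<eta> = 0" using K(2) by (intro Suc.prems(2)) auto
      then show ?thesis using C by simp
    qed
    show "((\<lambda>\<tau>. G (\<eta> + \<tau> *\<^sub>R v)) has_vector_derivative ?H \<eta>) (at 0)" for \<eta>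
    proof (cases "\<eta> \<in> K")
      case False
      then show ?thesis using zero_derivative_off_support[where K=K and G=G and v=v] K(1) Suc.prems(2) by simp
    qed (use G'(1) K(2) in auto)
    show "dir_bounded UNIV v n C ?H"
    proof (rule Suc.IH)
      show "dir_bounded U v n C ?H" by (rule dir_bounded_cong[OF U _ G'(2)]) (use off in auto)
    qed simp
  qed
qed

lemma dir_bounded_affine:
  fixes F :: "'v::real_normed_vector \<Rightarrow> complex"
  assumes "dir_bounded UNIV e n C F" "0 \<le> C"
  shows "dir_bounded UNIV (\<sigma> *\<^sub>R e) n (C * max 1 \<bar>\<sigma> * c\<bar> ^ n) (\<lambda>\<eta>. F (c *\<^sub>R (\<eta> - \<xi>)))"
  using assms
proof (induction n arbitrary: F C)
  case 0
  then show ?case by simp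
next
  case (Suc n)
  then obtain F' where F': "\<And>\<eta>. ((\<lambda>\<tau>. F (\<eta> + \<tau> *\<^sub>R e)) has_vector_derivative F' \<eta>) (at 0)" "dir_bounded UNIV e n C F'" by auto
  let ?m = "max 1 \<bar>\<sigma> * c\<bar>"
  have m: "1 \<le> ?m ^ Suc n" "?m ^ n \<ge> 1" by (intro one_le_power; simp)+
  show ?case
  proof (rule dir_bounded_SucI[where f'="\<lambda>\<eta>. of_real (\<sigma> * c) * F' (c *\<^sub>R (\<eta> - \<xi>))"])
    show "cmod (F (c *\<^sub>R (\<eta> - \<xi>))) \<le> C * ?m ^ Suc n" for \<eta>
      using dir_bounded_bound[OF Suc.prems(1), of "c *\<^sub>R (\<eta> - \<xi>)"] mult_left_mono[OF m(1) Suc.prems(2)] by simp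
    show "((\<lambda>\<tau>. F (c *\<^sub>R (\<eta> + \<tau> *\<^sub>R \<sigma> *\<^sub>R e - \<xi>))) has_vector_derivative of_real (\<sigma> * c) * F' (c *\<^sub>R (\<eta> - \<xi>))) (at 0)" for \<eta>
    proof -
      have "((\<lambda>\<tau>::real. \<sigma> * c * \<tau>) has_vector_derivative \<sigma> * c) (at 0)"
        by (auto intro!: derivative_eq_intros simp: has_real_derivative_iff_has_vector_derivative[symmetric])
      moreover have "((\<lambda>\<tau>. F (c *\<^sub>R (\<eta> - \<xi>) + \<tau> *\<^sub>R e)) has_vector_derivative F' (c *\<^sub>R (\<eta> - \<xi>))) (at (\<sigma> * c * 0))"
        using F'(1) by simp
      ultimately have "((\<lambda>\<tau>. F (c *\<^sub>R (\<eta> - \<xi>) + \<tau> *\<^sub>R e)) \<circ> (\<lambda>\<tau>. \<sigma> * c * \<tau>) has_vector_derivative (\<sigma> * c) *\<^sub>R F' (c *\<^sub>R (\<eta> - \<xi>))) (at 0)"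
        by (rule vector_diff_chain_at)
      moreover have "(\<lambda>\<tau>. F (c *\<^sub>R (\<eta> - \<xi>) + \<tau> *\<^sub>R e)) \<circ> (\<lambda>\<tau>. \<sigma> * c * \<tau>) = (\<lambda>\<tau>. F (c *\<^sub>R (\<eta> + \<tau> *\<^sub>R \<sigma> *\<^sub>R e - \<xi>)))"
        by (rule ext) (simp add: algebra_simps)
      ultimately show ?thesis by (simp add: scaleR_conv_of_real)
    qed
    have "dir_bounded UNIV (\<sigma> *\<^sub>R e) n (C * ?m ^ n) (\<lambda>\<eta>. F' (c *\<^sub>R (\<eta> - \<xi>)))" by (rule Suc.IH[OF F'(2) Suc.prems(2)])
    moreover have "0 \<le> C * ?m ^ n" using Suc.prems m by auto
    ultimately have "dir_bounded UNIV (\<sigma> *\<^sub>R e) n (\<bar>\<sigma> * c\<bar> * (C * ?m ^ n)) (\<lambda>\<eta>. of_real (\<sigma> * c) * F' (c *\<^sub>R (\<eta> - \<xi>)))"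
      using dir_bounded_cmult[where c="of_real (\<sigma> * c)"] by (metis norm_of_real)
    moreover have "\<bar>\<sigma> * c\<bar> * (C * ?m ^ n) \<le> C * ?m ^ Suc n"
    proof -
      have "\<bar>\<sigma> * c\<bar> * (C * ?m ^ n) \<le> ?m * (C * ?m ^ n)" using \<open>0 \<le> C * ?m ^ n\<close> by (intro mult_right_mono) auto
      then show ?thesis by (simp add: ac_simps)
    qed
    ultimately show "dir_bounded UNIV (\<sigma> *\<^sub>R e) n (C * ?m ^ Suc n) (\<lambda>\<eta>. of_real (\<sigma> * c) * F' (c *\<^sub>R (\<eta> - \<xi>)))"
      by (rule dir_bounded_mono)
  qed
qed

lemma iter_partial_off_support:
  fixes f :: "real^'d::finite \<Rightarrow> complex"
  assumes "\<eta> \<notin> supp f"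
  shows "iter_partial ds f \<eta> = 0"
  using assms
proof (induction ds arbitrary: \<eta>)
  case Nil
  then have "\<eta> \<notin> {x. f x \<noteq> 0}" using closure_subset[of "{x. f x \<noteq> 0}"] unfolding supp_def by blast
  then show ?case by simp
next
  case (Cons i ds)
  have o: "open (- supp f)" by (simp add: supp_def open_Compl)
  have "(iter_partial ds f has_derivative (\<lambda>_. 0)) (at \<eta>)"
  proof (rule has_derivative_transform_within_open[OF _ o])
    show "((\<lambda>_. 0) has_derivative (\<lambda>_. 0)) (at \<eta>)" by simp
  qed (use Cons in auto)
  then have "frechet_derivative (iter_partial ds f) (at \<eta>) = (\<lambda>_. 0)"
    by (rule frechet_derivative_at[symmetric])
  then show ?case by simp
qed

lemma smooth_compact_support_dir_bounded:
  fixes f :: "real^'d::finite \<Rightarrow> complex"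
  assumes f: "smooth_compact_support f"
  shows "\<exists>C\<ge>0. dir_bounded UNIV (axis i 1) n C f"
proof -
  have diff: "iter_partial ds f differentiable (at x)" for ds x
    using f by (auto simp: smooth_compact_support_def smooth_def)
  have bd: "\<exists>C\<ge>0. \<forall>x. cmod (iter_partial ds f x) \<le> C" for ds
  proof -
    have "continuous_on (supp f) (iter_partial ds f)"
      by (intro continuous_at_imp_continuous_on ballI differentiable_imp_continuous_within diff)
    then have "compact (iter_partial ds f ` supp f)"
      using f by (intro compact_continuous_image) (auto simp: smooth_compact_support_def)
    from compact_imp_bounded[OF this] obtain B where B: "\<forall>x\<in>supp f. cmod (iter_partial ds f x) \<le> B"
      by (auto simp: bounded_iff)
    show ?thesis
    proof (intro exI[of _ "max 0 B"] conjI allI)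
      show "cmod (iter_partial ds f x) \<le> max 0 B" for x
        using B iter_partial_off_support[of x f ds] by (cases "x \<in> supp f") (auto simp: le_max_iff_disj)
    qed simp
  qed
  have "\<exists>C\<ge>0. dir_bounded UNIV (axis i 1) n C (iter_partial (replicate k i) f)" for k
  proof (induction n arbitrary: k)
    case 0
    show ?case using bd[of "replicate k i"] by auto
  next
    case (Suc n)
    obtain C1 where C1: "0 \<le> C1" "\<And>x. cmod (iter_partial (replicate k i) f x) \<le> C1" using bd by blast
    obtain C2 where C2: "0 \<le> C2" "dir_bounded UNIV (axis i 1) n C2 (iter_partial (replicate (Suc k) i) f)" using Suc by blast
    let ?g = "iter_partial (replicate k i) f"
    have "dir_bounded UNIV (axis i 1) (Suc n) (max C1 C2) ?g"
    proof (rule dir_bounded_SucI[where f'="iter_partial (replicate (Suc k) i) f"])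
      show "((\<lambda>\<tau>. ?g (\<eta> + \<tau> *\<^sub>R axis i 1)) has_vector_derivative iter_partial (replicate (Suc k) i) f \<eta>) (at 0)" for \<eta>
      proof -
        let ?D = "frechet_derivative ?g (at \<eta>)"
        have d: "(?g has_derivative ?D) (at (\<eta> + 0 *\<^sub>R axis i 1))" using diff[of "replicate k i" \<eta>] by (simp add: frechet_derivative_works)
        have l: "((\<lambda>\<tau>::real. \<eta> + \<tau> *\<^sub>R axis i 1) has_derivative (\<lambda>\<tau>. \<tau> *\<^sub>R axis i 1)) (at 0)"
          by (auto intro!: derivative_eq_intros)
        have "((\<lambda>\<tau>. ?g (\<eta> + \<tau> *\<^sub>R axis i 1)) has_derivative (\<lambda>\<tau>. ?D (\<tau> *\<^sub>R axis i 1))) (at 0)"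
          by (rule has_derivative_compose[OF l d])
        moreover have "linear ?D" using d has_derivative_linear by blast
        ultimately show ?thesis by (simp add: has_vector_derivative_def linear_scale)
      qed
      show "dir_bounded UNIV (axis i 1) n (max C1 C2) (iter_partial (replicate (Suc k) i) f)"
        by (rule dir_bounded_mono[OF C2(2)]) simp
    qed (use C1 in \<open>auto simp: le_max_iff_disj\<close>)
    then show ?case using C1 by (intro exI[of _ "max C1 C2"]) auto
  qed
  from this[of 0] show ?thesis by simp
qed

lemma dir_bounded_subset: "dir_bounded V v n C f \<Longrightarrow> U \<subseteq> V \<Longrightarrow> dir_bounded U v n C f"
proof (induction n arbitrary: f)
  case 0
  then show ?case by auto
next
  case (Suc n)
  then obtain f' where f': "\<forall>\<eta>\<in>V. ((\<lambda>\<tau>. f (\<eta> + \<tau> *\<^sub>R v)) has_vector_derivative f' \<eta>) (at 0)" "dir_bounded V v n C f'" by auto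
  show ?case
    by (rule dir_bounded_SucI[where f'=f'])
       (use f' Suc.IH[OF f'(2) Suc.prems(2)] dir_bounded_bound[OF Suc.prems(1)] Suc.prems(2) in auto)
qed

lemma smooth_compact_support_uniform:
  fixes f :: "real^'d::finite \<Rightarrow> complex"
  assumes "smooth_compact_support f"
  shows "\<exists>C\<ge>0. \<forall>i. dir_bounded UNIV (axis i 1) n C f"
proof -
  have "\<forall>i. \<exists>C\<ge>0. dir_bounded UNIV (axis i 1) n C f" using smooth_compact_support_dir_bounded[OF assms] by blast
  then obtain C where C: "\<And>i. 0 \<le> C i" "\<And>i. dir_bounded UNIV (axis i 1) n (C i) f" by metis
  have "C i \<le> (\<Sum>i\<in>UNIV. C i)" for i using C(1) by (intro member_le_sum) auto
  then show ?thesis using C by (intro exI[of _ "\<Sum>i\<in>UNIV. C i"] conjI allI sum_nonneg dir_bounded_mono[OF C(2)]) auto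
qed

section \<open>Decay of oscillatory integrals\<close>

lemma lborel_integral_shift:
  fixes f :: "'a::euclidean_space \<Rightarrow> 'b::{banach, second_countable_topology}"
  assumes [measurable]: "f \<in> borel_measurable borel"
  shows "(LINT x|lborel. f (x + c)) = (LINT x|lborel. f x)"
    and "integrable lborel (\<lambda>x. f (x + c)) \<longleftrightarrow> integrable lborel f"
proof -
  have e: "lborel = distr lborel borel ((+) c)" by (simp add: lborel_distr_plus)
  have "(LINT x|lborel. f x) = (LINT x|distr lborel borel ((+) c). f x)" using e by simp
  also have "\<dots> = (LINT x|lborel. f (x + c))" by (subst integral_distr) (auto simp: add.commute)
  finally show "(LINT x|lborel. f (x + c)) = (LINT x|lborel. f x)" by simp
  have "integrable lborel f \<longleftrightarrow> integrable (distr lborel borel ((+) c)) f" using e by simp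
  also have "\<dots> \<longleftrightarrow> integrable lborel (\<lambda>x. f (x + c))" by (subst integrable_distr_eq) (auto simp: add.commute)
  finally show "integrable lborel (\<lambda>x. f (x + c)) \<longleftrightarrow> integrable lborel f" by simp
qed

lemma line_derivative_shift:
  fixes P P' :: "'v::real_normed_vector \<Rightarrow> complex"
  assumes "\<And>\<eta>. ((\<lambda>\<tau>. P (\<eta> + \<tau> *\<^sub>R v)) has_vector_derivative P' \<eta>) (at 0)"
  shows "((\<lambda>\<tau>. P (\<eta> + \<tau> *\<^sub>R v)) has_vector_derivative P' (\<eta> + \<tau>0 *\<^sub>R v)) (at \<tau>0)"
proof -
  have "((\<lambda>\<tau>::real. \<tau> - \<tau>0) has_vector_derivative 1) (at \<tau>0)"
    by (auto intro!: derivative_eq_intros simp: has_real_derivative_iff_has_vector_derivative[symmetric])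
  moreover have "((\<lambda>\<tau>. P (\<eta> + \<tau>0 *\<^sub>R v + \<tau> *\<^sub>R v)) has_vector_derivative P' (\<eta> + \<tau>0 *\<^sub>R v)) (at (\<tau>0 - \<tau>0))"
    using assms by simp
  ultimately have "((\<lambda>\<tau>. P (\<eta> + \<tau>0 *\<^sub>R v + \<tau> *\<^sub>R v)) \<circ> (\<lambda>\<tau>. \<tau> - \<tau>0) has_vector_derivative 1 *\<^sub>R P' (\<eta> + \<tau>0 *\<^sub>R v)) (at \<tau>0)"
    by (rule vector_diff_chain_at)
  moreover have "\<eta> + \<tau>0 *\<^sub>R v + (\<tau> - \<tau>0) *\<^sub>R v = \<eta> + \<tau> *\<^sub>R v" for \<tau>
    by (simp add: scaleR_left_diff_distrib)
  ultimately show ?thesis by (simp add: o_def)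
qed

lemma difference_quotient_tendsto:
  fixes P :: "'v::real_normed_vector \<Rightarrow> complex"
  assumes "((\<lambda>\<tau>. P (\<eta> + \<tau> *\<^sub>R v)) has_vector_derivative (D::complex)) (at 0)"
  shows "(\<lambda>k. of_nat (Suc k) * (P (\<eta> + (1 / real (Suc k)) *\<^sub>R v) - P \<eta>)) \<longlonglongrightarrow> D"
proof -
  have *: "((\<lambda>h. norm (P (\<eta> + h *\<^sub>R v) - P \<eta> - h *\<^sub>R D) / norm h) \<longlongrightarrow> 0) (at 0)"
    using assms by (simp add: has_vector_derivative_def has_derivative_at)
  have "((\<lambda>h. norm ((P (\<eta> + h *\<^sub>R v) - P \<eta>) /\<^sub>R h - D)) \<longlongrightarrow> 0) (at 0)"
  proof (rule Lim_transform_eventually[OF *])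
    have "norm (P (\<eta> + h *\<^sub>R v) - P \<eta> - h *\<^sub>R D) / norm h = norm ((P (\<eta> + h *\<^sub>R v) - P \<eta>) /\<^sub>R h - D)" if "h \<noteq> 0" for h
    proof -
      have "(P (\<eta> + h *\<^sub>R v) - P \<eta>) /\<^sub>R h - D = (P (\<eta> + h *\<^sub>R v) - P \<eta> - h *\<^sub>R D) /\<^sub>R h"
        using that by (simp add: scaleR_right_diff_distrib)
      then show ?thesis by (simp add: divide_inverse mult.commute)
    qed
    then show "\<forall>\<^sub>F h in at 0. norm (P (\<eta> + h *\<^sub>R v) - P \<eta> - h *\<^sub>R D) / norm h = norm ((P (\<eta> + h *\<^sub>R v) - P \<eta>) /\<^sub>R h - D)"
      by (simp add: eventually_at_filter)
  qed
  then have "((\<lambda>h. (P (\<eta> + h *\<^sub>R v) - P \<eta>) /\<^sub>R h) \<longlongrightarrow> D) (at 0)"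
    by (rule LIM_zero_cancel[OF tendsto_norm_zero_cancel])
  moreover have "filterlim (\<lambda>k. 1 / real (Suc k)) (at 0) sequentially"
    unfolding filterlim_at using LIMSEQ_inverse_real_of_nat by (auto simp: inverse_eq_divide)
  ultimately have "(\<lambda>k. (P (\<eta> + (1 / real (Suc k)) *\<^sub>R v) - P \<eta>) /\<^sub>R (1 / real (Suc k))) \<longlonglongrightarrow> D"
    by (rule filterlim_compose)
  then show ?thesis by (simp add: scaleR_conv_of_real)
qed

text \<open>
  Difference quotients have integral 0 by translation invariance, and converge boundedly to the
  derivative; this replaces an iterated integral with the fundamental theorem of calculus.
\<close>

lemma integral_line_derivative_zero:
  fixes P P' :: "'v::euclidean_space \<Rightarrow> complex"
  assumes d: "\<And>\<eta>. ((\<lambda>\<tau>. P (\<eta> + \<tau> *\<^sub>R v)) has_vector_derivative P' \<eta>) (at 0)"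
    and b: "\<And>\<eta>. cmod (P' \<eta>) \<le> C" "\<And>\<eta>. cmod (P \<eta>) \<le> C" and C: "0 \<le> C"
    and m [measurable]: "P \<in> borel_measurable borel"
    and supp: "\<And>\<eta>. \<eta> \<notin> cball 0 r \<Longrightarrow> P \<eta> = 0"
  shows "P' \<in> borel_measurable borel" "(LINT \<eta>|lborel. P' \<eta>) = 0"
proof -
  define q where "q k \<eta> = of_nat (Suc k) * (P (\<eta> + (1 / real (Suc k)) *\<^sub>R v) - P \<eta>)" for k \<eta>
  have [measurable]: "(\<lambda>\<eta>. P (\<eta> + c)) \<in> borel_measurable borel" for c
    by (rule measurable_compose[OF _ m]) measurable
  have qm [measurable]: "q k \<in> borel_measurable borel" for k
    unfolding q_def[abs_def] by measurable
  have lim: "(\<lambda>k. q k \<eta>) \<longlonglongrightarrow> P' \<eta>" for \<eta>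
    unfolding q_def by (rule difference_quotient_tendsto[OF d])
  show P'm [measurable]: "P' \<in> borel_measurable borel"
    by (rule borel_measurable_LIMSEQ_metric[OF qm lim])
  have Pint: "integrable lborel P"
  proof (rule Bochner_Integration.integrable_bound)
    show "integrable lborel (\<lambda>\<eta>::'v. C * indicator (cball 0 r) \<eta> :: real)"
      using emeasure_bounded_finite[of "cball 0 r :: 'v set"] by (intro integrable_mult_right integrable_real_indicator) auto
    show "AE \<eta> in lborel. norm (P \<eta>) \<le> norm (C * indicator (cball 0 r) \<eta>)"
      using supp b C by (intro AE_I2) (auto simp: indicator_def)
  qed measurable
  have q0: "(LINT \<eta>|lborel. q k \<eta>) = 0" for k
  proof -
    have "integrable lborel (\<lambda>\<eta>. P (\<eta> + (1 / real (Suc k)) *\<^sub>R v))"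
      using Pint by (simp only: lborel_integral_shift(2)[OF m])
    then have "(LINT \<eta>|lborel. P (\<eta> + (1 / real (Suc k)) *\<^sub>R v) - P \<eta>) = 0"
      using Pint by (simp only: Bochner_Integration.integral_diff lborel_integral_shift(1)[OF m] diff_self)
    then show ?thesis unfolding q_def by simp
  qed
  have qb: "cmod (q k \<eta>) \<le> (C * norm (1::real)) * indicator (cball 0 (r + norm v)) \<eta>" for k \<eta>
  proof (cases "\<eta> \<in> cball 0 (r + norm v)")
    case True
    have "norm (P (\<eta> + (1 / real (Suc k)) *\<^sub>R v) - P (\<eta> + 0 *\<^sub>R v)) \<le> C * norm (1 / real (Suc k) - 0)"
    proof (rule differentiable_bound[where f="\<lambda>\<tau>. P (\<eta> + \<tau> *\<^sub>R v)" and f'="\<lambda>\<tau> h. h *\<^sub>R P' (\<eta> + \<tau> *\<^sub>R v)" and S=UNIV])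
      show "((\<lambda>\<tau>. P (\<eta> + \<tau> *\<^sub>R v)) has_derivative (\<lambda>h. h *\<^sub>R P' (\<eta> + x *\<^sub>R v))) (at x within UNIV)" for x
        using line_derivative_shift[OF d] by (simp add: has_vector_derivative_def)
      show "onorm (\<lambda>h. h *\<^sub>R P' (\<eta> + x *\<^sub>R v)) \<le> C" for x
      proof (rule onorm_bound[OF C])
        show "norm (h *\<^sub>R P' (\<eta> + x *\<^sub>R v)) \<le> C * norm h" for h
          using mult_right_mono[OF b(1)[of "\<eta> + x *\<^sub>R v"], of "\<bar>h\<bar>"] by (simp add: mult.commute)
      qed
    qed auto
    then have "real (Suc k) * norm (P (\<eta> + (1 / real (Suc k)) *\<^sub>R v) - P \<eta>) \<le> real (Suc k) * (C * norm (1 / real (Suc k) - 0))"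
      by (intro mult_left_mono) auto
    then show ?thesis using True by (simp add: q_def norm_mult del: of_nat_Suc)
  next
    case False
    have "1 / real (Suc k) * norm v \<le> 1 * norm v" by (intro mult_right_mono) auto
    then have "norm ((1 / real (Suc k)) *\<^sub>R v) \<le> norm v" by simp
    moreover have "r + norm v < norm \<eta>" using False by simp
    moreover have "norm \<eta> \<le> norm (\<eta> + (1 / real (Suc k)) *\<^sub>R v) + norm ((1 / real (Suc k)) *\<^sub>R v)"
      using norm_triangle_ineq4[of "\<eta> + (1 / real (Suc k)) *\<^sub>R v" "(1 / real (Suc k)) *\<^sub>R v"] by simp
    ultimately have "r < norm (\<eta> + (1 / real (Suc k)) *\<^sub>R v)" "r < norm \<eta>"
      using norm_ge_zero[of v] by linarith+
    then have "\<eta> + (1 / real (Suc k)) *\<^sub>R v \<notin> cball 0 r" "\<eta> \<notin> cball 0 r" by auto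
    then have "q k \<eta> = 0" using supp by (simp add: q_def)
    then show ?thesis by (simp only: norm_zero) (use C in \<open>simp add: indicator_def\<close>)
  qed
  have "(\<lambda>k. LINT \<eta>|lborel. q k \<eta>) \<longlonglongrightarrow> (LINT \<eta>|lborel. P' \<eta>)"
  proof (rule integral_dominated_convergence[where w="\<lambda>\<eta>. (C * norm (1::real)) * indicator (cball 0 (r + norm v)) \<eta>"])
    show "integrable lborel (\<lambda>\<eta>::'v. (C * norm (1::real)) * indicator (cball 0 (r + norm v)) \<eta> :: real)"
      using emeasure_bounded_finite[of "cball 0 (r + norm v) :: 'v set"] by (intro integrable_mult_right integrable_real_indicator) auto
    show "AE \<eta> in lborel. norm (q k \<eta>) \<le> (C * norm (1::real)) * indicator (cball 0 (r + norm v)) \<eta>" for k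
      using qb by (intro AE_I2)
  qed (use lim in auto)
  then show "(LINT \<eta>|lborel. P' \<eta>) = 0" unfolding q0 by (simp add: LIMSEQ_const_iff)
qed

lemma cis_line_derivative:
  "((\<lambda>\<tau>. cis (\<theta> \<bullet> (\<eta> + \<tau> *\<^sub>R v))) has_vector_derivative (\<i> * of_real (\<theta> \<bullet> v) * cis (\<theta> \<bullet> \<eta>))) (at 0)"
proof -
  have "((\<lambda>\<tau>. \<theta> \<bullet> (\<eta> + \<tau> *\<^sub>R v)) has_derivative (\<lambda>\<tau>. \<tau> * (\<theta> \<bullet> v))) (at 0)"
    by (auto intro!: derivative_eq_intros simp: inner_add_right)
  from has_derivative_cis[OF this] show ?thesis
    unfolding has_vector_derivative_def by (rule has_derivative_eq_rhs) (auto simp: fun_eq_iff scaleR_conv_of_real)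
qed

text \<open>
  Every integration by parts along \<open>v\<close> gains a factor \<open>\<theta> \<bullet> v\<close>, and there are no boundary terms because
  the integrand has bounded support.
\<close>

lemma integration_by_parts_bound:
  fixes G :: "'v::euclidean_space \<Rightarrow> complex"
  assumes G: "dir_bounded UNIV v n C G" and C: "0 \<le> C" and m: "G \<in> borel_measurable borel"
    and K: "closed K" "K \<subseteq> cball 0 r" and supp: "\<And>\<eta>. \<eta> \<notin> K \<Longrightarrow> G \<eta> = 0"
  shows "\<bar>\<theta> \<bullet> v\<bar> ^ n * cmod (LINT \<eta>|lborel. G \<eta> * cis (\<theta> \<bullet> \<eta>)) \<le> C * measure lborel K"
  using G m supp
proof (induction n arbitrary: G)
  case 0
  have fin: "emeasure lborel K < \<infinity>" using emeasure_bounded_finite[of K] bounded_subset[OF bounded_cball K(2)] by blast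
  have [measurable]: "K \<in> sets borel" using K by simp
  have "cmod (LINT \<eta>|lborel. G \<eta> * cis (\<theta> \<bullet> \<eta>)) \<le> (LINT \<eta>|lborel. C * indicator K \<eta>)"
  proof (rule Bochner_Integration.integral_norm_bound_integral)
    show I: "integrable lborel (\<lambda>\<eta>. C * indicator K \<eta> :: real)" using fin by (intro integrable_mult_right integrable_real_indicator) auto
    show le: "norm (G \<eta> * cis (\<theta> \<bullet> \<eta>)) \<le> C * indicator K \<eta>" for \<eta>
      using 0 by (cases "\<eta> \<in> K") (auto simp: norm_mult)
    have [measurable]: "(\<lambda>\<eta>. cis (\<theta> \<bullet> \<eta>)) \<in> borel_measurable borel"
      by (intro borel_measurable_continuous_onI continuous_intros)
    show "integrable lborel (\<lambda>\<eta>. G \<eta> * cis (\<theta> \<bullet> \<eta>))"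
      by (rule Bochner_Integration.integrable_bound[OF I]) (use 0(2) le in \<open>auto intro: order_trans[OF le abs_ge_self]\<close>)
  qed
  then show ?case using fin by simp
next
  case (Suc n)
  then obtain G' where G': "\<And>\<eta>. ((\<lambda>\<tau>. G (\<eta> + \<tau> *\<^sub>R v)) has_vector_derivative G' \<eta>) (at 0)" "dir_bounded UNIV v n C G'" by auto
  have off: "G' \<eta> = 0" if "\<eta> \<notin> K" for \<eta>
    using vector_derivative_unique_at[OF G'(1)[of \<eta>] zero_derivative_off_support[where G=G, OF K(1) Suc.prems(3) that]] by simp
  have b: "cmod (G \<eta>) \<le> C" "cmod (G' \<eta>) \<le> C" for \<eta>
    using dir_bounded_bound[OF Suc.prems(1)] dir_bounded_bound[OF G'(2)] by auto
  have offr: "G \<eta> = 0" if "\<eta> \<notin> cball 0 r" for \<eta> using Suc.prems(3)[of \<eta>] K(2) that by blast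
  have G'm: "G' \<in> borel_measurable borel"
    by (rule integral_line_derivative_zero(1)[OF G'(1) b(2,1) C Suc.prems(2) offr])
  have [measurable]: "(\<lambda>\<eta>. cis (\<theta> \<bullet> \<eta>)) \<in> borel_measurable borel"
    by (intro borel_measurable_continuous_onI continuous_intros)
  note [measurable] = Suc.prems(2) G'm
  let ?P = "\<lambda>\<eta>. G \<eta> * cis (\<theta> \<bullet> \<eta>)"
  let ?P' = "\<lambda>\<eta>. G \<eta> * (\<i> * of_real (\<theta> \<bullet> v) * cis (\<theta> \<bullet> \<eta>)) + G' \<eta> * cis (\<theta> \<bullet> \<eta>)"
  have z: "(LINT \<eta>|lborel. ?P' \<eta>) = 0"
  proof (rule integral_line_derivative_zero(2))
    show "((\<lambda>\<tau>. ?P (\<eta> + \<tau> *\<^sub>R v)) has_vector_derivative ?P' \<eta>) (at 0)" for \<eta>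
      using has_vector_derivative_mult[OF G'(1)[of \<eta>] cis_line_derivative[of \<theta> \<eta> v]] by simp
    show "cmod (?P' \<eta>) \<le> C * \<bar>\<theta> \<bullet> v\<bar> + C" for \<eta>
      using b[of \<eta>] by (intro order_trans[OF norm_triangle_ineq add_mono]) (auto simp: norm_mult mult_right_mono)
    show "cmod (?P \<eta>) \<le> C * \<bar>\<theta> \<bullet> v\<bar> + C" for \<eta>
      using b[of \<eta>] C by (auto simp: norm_mult intro: order_trans[OF _ le_add_same_cancel2[THEN iffD2]])
    show "0 \<le> C * \<bar>\<theta> \<bullet> v\<bar> + C" using C by simp
    show "?P \<in> borel_measurable borel" by measurable
    show "?P \<eta> = 0" if "\<eta> \<notin> cball 0 r" for \<eta> using offr[OF that] by simp
  qed
  have bdint: "integrable lborel (\<lambda>\<eta>. g \<eta> * cis (\<theta> \<bullet> \<eta>))"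
    if g: "g \<in> borel_measurable borel" "\<And>\<eta>. cmod (g \<eta>) \<le> C" "\<And>\<eta>. \<eta> \<notin> K \<Longrightarrow> g \<eta> = 0" for g
  proof (rule Bochner_Integration.integrable_bound)
    show "integrable lborel (\<lambda>\<eta>::'v. C * indicator (cball 0 r) \<eta> :: real)"
      using emeasure_bounded_finite[of "cball 0 r :: 'v set"] by (intro integrable_mult_right integrable_real_indicator) auto
    show "AE \<eta> in lborel. norm (g \<eta> * cis (\<theta> \<bullet> \<eta>)) \<le> norm (C * indicator (cball 0 r) \<eta> :: real)"
    proof (rule AE_I2)
      fix \<eta>
      show "norm (g \<eta> * cis (\<theta> \<bullet> \<eta>)) \<le> norm (C * indicator (cball 0 r) \<eta> :: real)"
      proof (cases "\<eta> \<in> cball 0 r")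
        case True
        then show ?thesis using g(2)[of \<eta>] C by (simp add: norm_mult)
      next
        case False
        then have "g \<eta> = 0" using K(2) g(3) by blast
        then show ?thesis by simp
      qed
    qed
    show "(\<lambda>\<eta>. g \<eta> * cis (\<theta> \<bullet> \<eta>)) \<in> borel_measurable lborel" using g(1) by measurable
  qed
  have iG: "integrable lborel ?P" by (rule bdint[OF Suc.prems(2) b(1) Suc.prems(3)])
  have iG': "integrable lborel (\<lambda>\<eta>. G' \<eta> * cis (\<theta> \<bullet> \<eta>))" by (rule bdint[OF G'm b(2) off])
  have "?P' = (\<lambda>\<eta>. \<i> * of_real (\<theta> \<bullet> v) * ?P \<eta> + G' \<eta> * cis (\<theta> \<bullet> \<eta>))" by (auto simp: fun_eq_iff)
  then have "\<i> * of_real (\<theta> \<bullet> v) * (LINT \<eta>|lborel. ?P \<eta>) + (LINT \<eta>|lborel. G' \<eta> * cis (\<theta> \<bullet> \<eta>)) = 0"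
    using z iG iG' by (simp only: Bochner_Integration.integral_add integrable_mult_right integral_mult_right_zero)
  then have "(LINT \<eta>|lborel. G' \<eta> * cis (\<theta> \<bullet> \<eta>)) = - (\<i> * of_real (\<theta> \<bullet> v) * (LINT \<eta>|lborel. ?P \<eta>))"
    by (simp add: add_eq_0_iff)
  then have "cmod (LINT \<eta>|lborel. G' \<eta> * cis (\<theta> \<bullet> \<eta>)) = \<bar>\<theta> \<bullet> v\<bar> * cmod (LINT \<eta>|lborel. ?P \<eta>)"
    by (simp add: norm_mult)
  then show ?case using Suc.IH[OF G'(2) G'm off] by (simp add: ac_simps)
qed

text \<open>
  Replace every summand by the largest of the numbers 1 and \<open>t i\<close>.
\<close>

lemma power_sum_le:
  fixes t :: "'d::finite \<Rightarrow> real"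
  assumes "\<And>i. 0 \<le> t i"
  shows "(1 + (\<Sum>i\<in>UNIV. t i)) ^ N \<le> (real CARD('d) + 1) ^ N * (1 + (\<Sum>i\<in>UNIV. t i ^ N))"
proof -
  define M where "M = Max (insert 1 (range t))"
  have M: "1 \<le> M" "t i \<le> M" for i
    unfolding M_def by (rule Max_ge; simp)+
  have "M \<in> insert 1 (range t)" unfolding M_def by (rule Max_in) auto
  then have MN: "M ^ N \<le> 1 + (\<Sum>i\<in>UNIV. t i ^ N)"
  proof
    assume "M = 1"
    then show ?thesis using assms by (simp add: sum_nonneg)
  next
    assume "M \<in> range t"
    then obtain i where "M = t i" by auto
    then have "M ^ N \<le> (\<Sum>i\<in>UNIV. t i ^ N)" using assms by (auto intro: member_le_sum)
    then show ?thesis by simp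
  qed
  have "1 + (\<Sum>i\<in>UNIV. t i) \<le> M + (\<Sum>i\<in>(UNIV::'d set). M)" by (intro add_mono sum_mono M)
  then have "(1 + (\<Sum>i\<in>UNIV. t i)) ^ N \<le> ((real CARD('d) + 1) * M) ^ N"
    using assms by (intro power_mono) (auto simp: distrib_right sum_nonneg)
  also have "\<dots> \<le> (real CARD('d) + 1) ^ N * (1 + (\<Sum>i\<in>UNIV. t i ^ N))"
    unfolding power_mult_distrib using MN by (intro mult_left_mono) auto
  finally show ?thesis .
qed

text \<open>
  Integration by parts in all coordinate directions at scale \<open>s\<close>; the largest coordinate of \<open>\<theta>\<close> decides.
\<close>

theorem oscillatory_integral_decay:
  fixes G :: "real^'d::finite \<Rightarrow> complex"
  assumes s: "0 < s" and G: "\<And>i. dir_bounded UNIV (s *\<^sub>R axis i 1) N C G" and C: "0 \<le> C"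
    and m: "G \<in> borel_measurable borel"
    and K: "closed K" "K \<subseteq> cball 0 r" and supp: "\<And>\<eta>. \<eta> \<notin> K \<Longrightarrow> G \<eta> = 0"
  shows "(1 + s * norm \<theta>) ^ N * cmod (LINT \<eta>|lborel. G \<eta> * cis (\<theta> \<bullet> \<eta>)) \<le>
    (real CARD('d) + 1) ^ (N + 1) * (C * measure lborel K)"
proof -
  let ?I = "cmod (LINT \<eta>|lborel. G \<eta> * cis (\<theta> \<bullet> \<eta>))"
  let ?t = "\<lambda>i. \<bar>\<theta> \<bullet> (s *\<^sub>R axis i 1)\<bar>"
  have t: "?t i = s * \<bar>\<theta> $ i\<bar>" for i using s by (simp add: inner_axis abs_mult)
  have "norm \<theta> \<le> (\<Sum>i\<in>UNIV. \<bar>\<theta> $ i\<bar>)" by (rule norm_le_l1_cart)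
  then have "s * norm \<theta> \<le> s * (\<Sum>i\<in>UNIV. \<bar>\<theta> $ i\<bar>)" using s by (intro mult_left_mono) auto
  then have "1 + s * norm \<theta> \<le> 1 + (\<Sum>i\<in>UNIV. ?t i)" unfolding t by (simp add: sum_distrib_left)
  then have "(1 + s * norm \<theta>) ^ N \<le> (1 + (\<Sum>i\<in>UNIV. ?t i)) ^ N" using s by (intro power_mono) auto
  also have "\<dots> \<le> (real CARD('d) + 1) ^ N * (1 + (\<Sum>i\<in>UNIV. ?t i ^ N))" by (rule power_sum_le) simp
  finally have "(1 + s * norm \<theta>) ^ N * ?I \<le> (real CARD('d) + 1) ^ N * (1 + (\<Sum>i\<in>UNIV. ?t i ^ N)) * ?I"
    by (intro mult_right_mono) auto
  also have "\<dots> = (real CARD('d) + 1) ^ N * (?I + (\<Sum>i\<in>UNIV. ?t i ^ N * ?I))"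
    by (simp add: distrib_right sum_distrib_right mult.assoc)
  also have "\<dots> \<le> (real CARD('d) + 1) ^ N * (C * measure lborel K + (\<Sum>i\<in>(UNIV::'d set). C * measure lborel K))"
  proof (intro mult_left_mono add_mono sum_mono)
    have "dir_bounded UNIV (0::real^'d) 0 C G" using dir_bounded_bound[OF G] by simp
    from integration_by_parts_bound[OF this C m K supp, of \<theta>] show "?I \<le> C * measure lborel K" by simp
    show "?t i ^ N * ?I \<le> C * measure lborel K" for i
      by (rule integration_by_parts_bound[OF G C m K supp])
  qed simp
  also have "\<dots> = (real CARD('d) + 1) ^ (N + 1) * (C * measure lborel K)"
    by (simp add: algebra_simps)
  finally show ?thesis .
qed

section \<open>Wave packets on the Fourier side\<close>

lemma lborel_integral_affine:
  fixes f :: "'a::euclidean_space \<Rightarrow> 'b::{banach, second_countable_topology}"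
  assumes [measurable]: "f \<in> borel_measurable borel" and c: "0 < c"
  shows "(LINT x|lborel. f x) = c ^ DIM('a) *\<^sub>R (LINT x|lborel. f (t + c *\<^sub>R x))"
    and "integrable lborel f \<Longrightarrow> integrable lborel (\<lambda>x. f (t + c *\<^sub>R x))"
proof -
  let ?D = "density (distr lborel borel (\<lambda>x. t + c *\<^sub>R x)) (\<lambda>_. ennreal (c ^ DIM('a)))"
  have e: "lborel = ?D"
    using lborel_affine[of c t] c by simp
  have [measurable]: "(\<lambda>x. t + c *\<^sub>R x) \<in> borel_measurable borel"
    by (intro borel_measurable_continuous_onI continuous_intros)
  have "(LINT x|lborel. f x) = (LINT x|?D. f x)" using e by simp
  also have "\<dots> = (LINT x|distr lborel borel (\<lambda>x. t + c *\<^sub>R x). c ^ DIM('a) *\<^sub>R f x)"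
    using c by (subst integral_density) auto
  also have "\<dots> = c ^ DIM('a) *\<^sub>R (LINT x|lborel. f (t + c *\<^sub>R x))"
    by (subst integral_distr) auto
  finally show "(LINT x|lborel. f x) = c ^ DIM('a) *\<^sub>R (LINT x|lborel. f (t + c *\<^sub>R x))" .
  assume "integrable lborel f"
  then have "integrable ?D f" using e by simp
  then have "integrable (distr lborel borel (\<lambda>x. t + c *\<^sub>R x)) (\<lambda>x. c ^ DIM('a) *\<^sub>R f x)"
    using c by (subst (asm) integrable_density) auto
  then show "integrable lborel (\<lambda>x. f (t + c *\<^sub>R x))"
    using c integrable_scaleR_right[of "inverse (c ^ DIM('a))" lborel "\<lambda>x. c ^ DIM('a) *\<^sub>R f (t + c *\<^sub>R x)"]
    by (subst (asm) integrable_distr_eq) auto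
qed

text \<open>
  The Fourier transform of a wave packet, written with the transform \<open>\<phi>h\<close> of the window.
\<close>

definition packet_ft :: "real \<Rightarrow> (real^'d::finite \<Rightarrow> complex) \<Rightarrow> (real^'d) \<times> (real^'d) \<Rightarrow> real^'d \<Rightarrow> complex" where
  "packet_ft \<alpha> \<phi>h = (\<lambda>(x, \<zeta>) \<eta>. of_real (fscale \<alpha> \<zeta> powr (- (real CARD('d) / 2))) *
     (cis (- (x \<bullet> (\<eta> - \<zeta>))) * \<phi>h ((1 / fscale \<alpha> \<zeta>) *\<^sub>R (\<eta> - \<zeta>))))"

lemma wave_packet_eq:
  "wave_packet \<alpha> \<phi> (x, \<zeta>) t = of_real (fscale \<alpha> \<zeta> powr (real CARD('d) / 2)) *
     (of_real (\<phi> (fscale \<alpha> \<zeta> *\<^sub>R (t - x))) * cis (t \<bullet> \<zeta>))" for x \<zeta> t :: "real^'d::finite"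
  by (simp add: wave_packet_def fscale_def powr_powr mult.commute)

lemma wave_packet_L1L2:
  fixes x \<zeta> :: "real^'d::finite"
  assumes \<phi>: "(\<lambda>t. complex_of_real (\<phi> t)) \<in> L1L2" and \<zeta>: "1 \<le> norm \<zeta>"
  shows "wave_packet \<alpha> \<phi> (x, \<zeta>) \<in> L1L2"
    and "fourier (wave_packet \<alpha> \<phi> (x, \<zeta>)) = packet_ft \<alpha> (fourier (\<lambda>t. complex_of_real (\<phi> t))) (x, \<zeta>)"
proof -
  let ?s = "fscale \<alpha> \<zeta>" and ?f = "\<lambda>t. complex_of_real (\<phi> t)"
  have s: "0 < ?s" by (rule fscale_pos[OF \<zeta>])
  have fm [measurable]: "?f \<in> borel_measurable borel" using L1L2_D(1)[OF \<phi>] by auto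
  have [measurable]: "(\<lambda>t::real^'d. cis (t \<bullet> \<eta>)) \<in> borel_measurable borel" "(\<lambda>t::real^'d. cis (- (t \<bullet> \<eta>))) \<in> borel_measurable borel" for \<eta>
    by (intro borel_measurable_continuous_onI continuous_intros)+
  have am [measurable]: "(\<lambda>t. ?s *\<^sub>R (t - x)) \<in> borel_measurable borel"
    by (intro borel_measurable_continuous_onI continuous_intros)
  have gm [measurable]: "(\<lambda>t. ?f (?s *\<^sub>R (t - x))) \<in> borel_measurable borel"
    by (rule measurable_compose[OF am fm])
  have sx: "?s *\<^sub>R (t - x) = - (?s *\<^sub>R x) + ?s *\<^sub>R t" for t by (simp add: scaleR_right_diff_distrib)
  have i1: "integrable lborel (\<lambda>t. ?f (?s *\<^sub>R (t - x)))"
    unfolding sx by (rule lborel_integral_affine(2)[OF fm s L1L2_D(2)[OF \<phi>]])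
  have i2: "integrable lborel (\<lambda>t. (cmod (?f (?s *\<^sub>R (t - x))))\<^sup>2)"
    unfolding sx by (rule lborel_integral_affine(2)[OF _ s L2_integrable_sq[OF L1L2_D(1)[OF \<phi>]]]) measurable
  have wm: "wave_packet \<alpha> \<phi> (x, \<zeta>) \<in> borel_measurable borel"
    unfolding wave_packet_eq[abs_def] by measurable
  have "(\<lambda>t. ?f (?s *\<^sub>R (t - x))) \<in> L2" by (rule L2_I[OF gm i2])
  then have "wave_packet \<alpha> \<phi> (x, \<zeta>) \<in> L2"
    by (rule L2_bound[OF wm, where C="?s powr (real CARD('d) / 2)"]) (simp add: wave_packet_eq norm_mult)
  moreover have "integrable lborel (wave_packet \<alpha> \<phi> (x, \<zeta>))"
    by (rule Bochner_Integration.integrable_bound[OF integrable_mult_right[OF i1, of "of_real (?s powr (real CARD('d) / 2))"]])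
       (use wm in \<open>auto simp: wave_packet_eq norm_mult\<close>)
  ultimately show "wave_packet \<alpha> \<phi> (x, \<zeta>) \<in> L1L2" by (simp add: L1L2_def)
  show "fourier (wave_packet \<alpha> \<phi> (x, \<zeta>)) = packet_ft \<alpha> (fourier ?f) (x, \<zeta>)"
  proof
    fix \<eta>
    let ?F = "\<lambda>t. wave_packet \<alpha> \<phi> (x, \<zeta>) t * cis (- (t \<bullet> \<eta>))"
    have Fm: "?F \<in> borel_measurable borel" using wm by measurable
    have key: "?F (x + (1 / ?s) *\<^sub>R u) = of_real (?s powr (real CARD('d) / 2)) * cis (- (x \<bullet> (\<eta> - \<zeta>))) *
        (?f u * cis (- (u \<bullet> ((1 / ?s) *\<^sub>R (\<eta> - \<zeta>)))))" for u
    proof -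
      let ?t = "x + (1 / ?s) *\<^sub>R u"
      have a: "cis (?t \<bullet> \<zeta>) * cis (- (?t \<bullet> \<eta>)) = cis (- (x \<bullet> (\<eta> - \<zeta>))) * cis (- (u \<bullet> ((1 / ?s) *\<^sub>R (\<eta> - \<zeta>))))"
        unfolding cis_mult by (rule arg_cong[where f=cis]) (simp add: inner_add_left inner_diff_right diff_divide_distrib)
      have b: "?s *\<^sub>R (?t - x) = u" using s by simp
      have "?F ?t = of_real (?s powr (real CARD('d) / 2)) * (?f (?s *\<^sub>R (?t - x)) * (cis (?t \<bullet> \<zeta>) * cis (- (?t \<bullet> \<eta>))))"
        unfolding wave_packet_eq by (simp only: mult.assoc)
      also have "\<dots> = of_real (?s powr (real CARD('d) / 2)) * cis (- (x \<bullet> (\<eta> - \<zeta>))) *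
        (?f u * cis (- (u \<bullet> ((1 / ?s) *\<^sub>R (\<eta> - \<zeta>)))))"
        unfolding a b by (simp only: mult_ac)
      finally show ?thesis .
    qed
    have "fourier (wave_packet \<alpha> \<phi> (x, \<zeta>)) \<eta> = (1 / ?s) ^ CARD('d) *\<^sub>R (LINT u|lborel. ?F (x + (1 / ?s) *\<^sub>R u))"
      unfolding fourier_def using lborel_integral_affine(1)[OF Fm, of "1 / ?s" x] s by simp
    also have "\<dots> = (1 / ?s) ^ CARD('d) *\<^sub>R (of_real (?s powr (real CARD('d) / 2)) * cis (- (x \<bullet> (\<eta> - \<zeta>))) *
        fourier ?f ((1 / ?s) *\<^sub>R (\<eta> - \<zeta>)))"
      unfolding key fourier_def by simp
    also have "\<dots> = packet_ft \<alpha> (fourier ?f) (x, \<zeta>) \<eta>"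
    proof -
    have e: "(1 / ?s) ^ CARD('d) * ?s powr (real CARD('d) / 2) = ?s powr (- (real CARD('d) / 2))"
    proof -
      have "(1 / ?s) ^ CARD('d) = ?s powr (- real CARD('d))"
        using s by (simp add: powr_minus powr_realpow power_one_over inverse_eq_divide)
      then show ?thesis by (simp flip: powr_add)
    qed
      have g: "r *\<^sub>R (of_real b * c * F) = of_real (r * b) * (c * F)" for r b and c F :: complex
        by (simp add: scaleR_conv_of_real)
      show ?thesis unfolding g e packet_ft_def by simp
    qed
    finally show "fourier (wave_packet \<alpha> \<phi> (x, \<zeta>)) \<eta> = packet_ft \<alpha> (fourier ?f) (x, \<zeta>) \<eta>" .
  qed
qed

text \<open>
  The frequency side of the construction.  Here \<open>\<beta>\<close> is the spatial step in units of the reciprocal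
  scale, and \<open>R1 * \<beta> < pi\<close> is the painless condition: the support of a bump fits into a period cube.
  The parameter \<open>q\<close> is the ratio of the support radius to the separation radius, on which the overlap
  depends.
\<close>

locale painless_system =
  fixes \<alpha> \<beta> R1 m0 R0 q :: real and \<xi> :: "nat \<Rightarrow> real^'d::finite" and \<phi>h :: "real^'d \<Rightarrow> complex" and \<delta> Cb :: real
  assumes \<alpha>: "0 < \<alpha>" and \<beta>: "0 < \<beta>" and R1: "0 < R1" and m0: "0 < m0" and R1\<beta>: "R1 * \<beta> < pi"
    and \<delta>: "0 < \<delta>" and sep: "separated_frequencies \<alpha> \<delta> \<xi>"
    and q: "R1 = q * \<delta>"
    and cover: "\<And>\<eta>. \<exists>k. norm (\<eta> - \<xi> k) \<le> R0 * fscale \<alpha> (\<xi> k)"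
    and smooth: "smooth_compact_support \<phi>h"
    and suppR: "supp \<phi>h \<subseteq> ball 0 R1"
    and lower: "\<And>\<zeta>. norm \<zeta> \<le> R0 \<Longrightarrow> m0 \<le> cmod (\<phi>h \<zeta>)"
    and upper: "\<And>\<zeta>. cmod (\<phi>h \<zeta>) \<le> Cb"
    and \<phi>h_meas: "\<phi>h \<in> borel_measurable borel"
begin

abbreviation s :: "nat \<Rightarrow> real" where "s k \<equiv> fscale \<alpha> (\<xi> k)"

definition bump :: "nat \<Rightarrow> real^'d \<Rightarrow> complex" where
  "bump k \<eta> = \<phi>h ((1 / s k) *\<^sub>R (\<eta> - \<xi> k))"

text \<open>
  The frame operator acts on Fourier transforms as multiplication by this function.
\<close>

definition symbol :: "real^'d \<Rightarrow> real" where
  "symbol \<eta> = (1 / \<beta>) ^ CARD('d) * (\<Sum>k. (cmod (bump k \<eta>))\<^sup>2)"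

abbreviation node :: "nat \<Rightarrow> int^'d \<Rightarrow> real^'d" where
  "node k j \<equiv> (\<beta> / s k) *\<^sub>R ivec j"

definition lattice :: "((real^'d) \<times> (real^'d)) set" where
  "lattice = (\<lambda>(k, j). (node k j, \<xi> k)) ` UNIV"

definition overlap :: nat where
  "overlap = overlap_bound TYPE(real^'d) \<alpha> q R1"

definition m_min :: real where "m_min = (1 / \<beta>) ^ CARD('d) * m0\<^sup>2"
definition m_max :: real where "m_max = (1 / \<beta>) ^ CARD('d) * (real overlap * Cb\<^sup>2)"

abbreviation pf :: "(real^'d) \<times> (real^'d) \<Rightarrow> real^'d \<Rightarrow> complex" where
  "pf \<equiv> packet_ft \<alpha> \<phi>h"

lemma norm_\<xi>: "1 \<le> norm (\<xi> k)" and inj_\<xi>: "inj \<xi>"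
  using sep by (auto simp: separated_frequencies_def)

lemma s_pos: "0 < s k"
  by (rule fscale_pos[OF norm_\<xi>])

lemma norm_rescaled: "norm ((1 / s k) *\<^sub>R v) = norm v / s k"
  using s_pos[of k] by simp

lemma Cb: "0 \<le> Cb"
  using upper[of 0] norm_ge_zero order_trans by blast

lemma bump_support: "bump k \<eta> \<noteq> 0 \<Longrightarrow> norm (\<eta> - \<xi> k) < R1 * s k"
proof -
  assume "bump k \<eta> \<noteq> 0"
  then have "(1 / s k) *\<^sub>R (\<eta> - \<xi> k) \<in> supp \<phi>h"
    unfolding bump_def supp_def using closure_subset[of "{x. \<phi>h x \<noteq> 0}"] by blast
  then have "norm ((1 / s k) *\<^sub>R (\<eta> - \<xi> k)) < R1" using suppR by auto
  then show ?thesis unfolding norm_rescaled using s_pos[of k] by (simp add: pos_divide_less_eq)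
qed

lemma bump_measurable [measurable]: "bump k \<in> borel_measurable borel"
proof -
  have "(\<lambda>\<eta>. (1 / s k) *\<^sub>R (\<eta> - \<xi> k)) \<in> borel_measurable borel"
    by (intro borel_measurable_continuous_onI continuous_intros)
  from measurable_compose[OF this \<phi>h_meas] show ?thesis unfolding bump_def[abs_def] .
qed

lemma bump_bound: "cmod (bump k \<eta>) \<le> Cb"
  unfolding bump_def by (rule upper)

lemma finite_overlap: "finite {k. bump k \<eta> \<noteq> 0}" "card {k. bump k \<eta> \<noteq> 0} \<le> overlap"
proof -
  have sub: "{k. bump k \<eta> \<noteq> 0} \<subseteq> {k. norm (\<eta> - \<xi> k) \<le> R1 * s k}" using bump_support less_imp_le by blast
  have "finite {k. norm (\<eta> - \<xi> k) \<le> R1 * s k} \<and> card {k. norm (\<eta> - \<xi> k) \<le> R1 * s k} \<le> overlap"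
    unfolding overlap_def using R1 by (intro bounded_overlap[OF \<alpha> \<delta> sep _ _ q]) auto
  with sub show "finite {k. bump k \<eta> \<noteq> 0}" "card {k. bump k \<eta> \<noteq> 0} \<le> overlap"
    by (auto intro: finite_subset order_trans[OF card_mono])
qed

lemma bump_sum_finite: "(\<lambda>k. (cmod (bump k \<eta>))\<^sup>2) sums (\<Sum>k | bump k \<eta> \<noteq> 0. (cmod (bump k \<eta>))\<^sup>2)"
  by (rule sums_finite) (use finite_overlap in auto)

lemma symbol_eq: "symbol \<eta> = (1 / \<beta>) ^ CARD('d) * (\<Sum>k | bump k \<eta> \<noteq> 0. (cmod (bump k \<eta>))\<^sup>2)"
  unfolding symbol_def using sums_unique[OF bump_sum_finite] by simp

lemma symbol_le: "symbol \<eta> \<le> m_max"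
proof -
  have "(\<Sum>k | bump k \<eta> \<noteq> 0. (cmod (bump k \<eta>))\<^sup>2) \<le> real (card {k. bump k \<eta> \<noteq> 0}) * Cb\<^sup>2"
    by (rule sum_bounded_above) (intro power_mono bump_bound norm_ge_zero)
  also have "\<dots> \<le> real overlap * Cb\<^sup>2" using finite_overlap(2)[of \<eta>] by (intro mult_right_mono) auto
  finally show ?thesis unfolding symbol_eq m_max_def using \<beta> by (intro mult_left_mono) auto
qed

lemma symbol_ge: "m_min \<le> symbol \<eta>"
proof -
  obtain k where k: "norm (\<eta> - \<xi> k) \<le> R0 * s k" using cover by blast
  then have "norm ((1 / s k) *\<^sub>R (\<eta> - \<xi> k)) \<le> R0" unfolding norm_rescaled using s_pos[of k] by (simp add: pos_divide_le_eq)
  then have b: "m0 \<le> cmod (bump k \<eta>)" unfolding bump_def by (rule lower)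
  then have "bump k \<eta> \<noteq> 0" using m0 by auto
  have "m0\<^sup>2 \<le> (cmod (bump k \<eta>))\<^sup>2" using b m0 by (intro power_mono) auto
  also have "\<dots> \<le> (\<Sum>k | bump k \<eta> \<noteq> 0. (cmod (bump k \<eta>))\<^sup>2)"
    using finite_overlap(1)[of \<eta>] \<open>bump k \<eta> \<noteq> 0\<close> by (intro member_le_sum) auto
  finally show ?thesis unfolding symbol_eq m_min_def using \<beta> by (intro mult_left_mono) auto
qed

lemma m_min_pos: "0 < m_min"
  unfolding m_min_def using \<beta> m0 by simp

lemma symbol_pos: "0 < symbol \<eta>"
  using symbol_ge[of \<eta>] m_min_pos by linarith

lemma symbol_measurable [measurable]: "symbol \<in> borel_measurable borel"
  unfolding symbol_def[abs_def] by measurable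

lemma pf_eq: "pf (x, \<xi> k) \<eta> = of_real (s k powr (- (real CARD('d) / 2))) * (cis (- (x \<bullet> (\<eta> - \<xi> k))) * bump k \<eta>)"
  by (simp add: packet_ft_def bump_def)

lemma pf_measurable [measurable]: "pf (x, \<xi> k) \<in> borel_measurable borel"
proof -
  have [measurable]: "(\<lambda>\<eta>. cis (- (x \<bullet> (\<eta> - \<xi> k)))) \<in> borel_measurable borel"
    by (intro borel_measurable_continuous_onI continuous_intros)
  show ?thesis unfolding pf_eq[abs_def] by measurable
qed

lemma bounded_compact_L1L2:
  fixes g :: "real^'d \<Rightarrow> complex"
  assumes [measurable]: "g \<in> borel_measurable borel" and b: "\<And>\<eta>. cmod (g \<eta>) \<le> C" and supp: "\<And>\<eta>. \<eta> \<notin> cball 0 r \<Longrightarrow> g \<eta> = 0"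
  shows "g \<in> L1L2"
proof -
  have "g \<in> L2"
  proof (rule L2_bound[where g="indicator (cube (r + 1))" and C=C])
    show "cmod (g \<eta>) \<le> C * cmod (indicator (cube (r + 1)) \<eta>)" for \<eta>
      using b[of \<eta>] supp[of \<eta>] cball_subset_cube[of r] by (cases "\<eta> \<in> cball 0 r") (auto simp: indicator_def)
  qed (auto intro: indicator_cube_L2)
  then show ?thesis unfolding L1L2_def using bounded_support_L2_integrable[where f=g and R=r] supp by blast
qed

lemma pf_div_L1L2: "(\<lambda>\<eta>. pf (x, \<xi> k) \<eta> / of_real (symbol \<eta>)) \<in> L1L2"
  and pf_L1L2: "pf (x, \<xi> k) \<in> L1L2"
proof -
  let ?c = "s k powr (- (real CARD('d) / 2))"
  have off: "pf (x, \<xi> k) \<eta> = 0" if "\<eta> \<notin> cball 0 (norm (\<xi> k) + R1 * s k)" for \<eta>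
  proof -
    have "norm \<eta> \<le> norm (\<xi> k) + norm (\<eta> - \<xi> k)" using norm_triangle_ineq[of "\<xi> k" "\<eta> - \<xi> k"] by simp
    then have "\<not> norm (\<eta> - \<xi> k) < R1 * s k" using that by auto
    then have "bump k \<eta> = 0" using bump_support by blast
    then show ?thesis by (simp add: pf_eq)
  qed
  have b: "cmod (pf (x, \<xi> k) \<eta>) \<le> ?c * Cb" for \<eta>
    unfolding pf_eq using bump_bound by (auto simp: norm_mult intro!: mult_left_mono)
  show "pf (x, \<xi> k) \<in> L1L2" by (rule bounded_compact_L1L2[OF _ b off]) measurable
  show "(\<lambda>\<eta>. pf (x, \<xi> k) \<eta> / of_real (symbol \<eta>)) \<in> L1L2"
  proof (rule bounded_compact_L1L2)
    show "cmod (pf (x, \<xi> k) \<eta> / of_real (symbol \<eta>)) \<le> ?c * Cb / m_min" for \<eta>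
      unfolding norm_divide norm_of_real using b[of \<eta>] symbol_ge[of \<eta>] m_min_pos symbol_pos[of \<eta>] Cb by (intro frac_le) auto
    show "pf (x, \<xi> k) \<eta> / of_real (symbol \<eta>) = 0" if "\<eta> \<notin> cball 0 (norm (\<xi> k) + R1 * s k)" for \<eta>
      using off[OF that] by simp
  qed measurable
qed

text \<open>
  After recentring at \<open>\<xi> k\<close>, the coefficients are Fourier coefficients of \<open>u * cnj (bump k)\<close> on a cube of
  half side \<open>L = pi * s k / \<beta>\<close>, which contains the support because \<open>R1 * \<beta> < pi\<close>.  The powers of \<open>s k\<close> from the
  normalization and from the volume of the cube cancel.
\<close>

lemma parseval_single:
  fixes u :: "real^'d \<Rightarrow> complex"
  assumes u: "u \<in> L2"
  shows "((\<lambda>j::int^'d. (cmod (l2_inner u (pf (node k j, \<xi> k))))\<^sup>2) has_sum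
     ((2 * pi / \<beta>) ^ CARD('d) * (LINT \<eta>|lborel. (cmod (u \<eta>))\<^sup>2 * (cmod (bump k \<eta>))\<^sup>2))) UNIV"
proof -
  define L where "L = pi * s k / \<beta>"
  have L: "0 < L" using s_pos[of k] \<beta> by (simp add: L_def)
  have um [measurable]: "u \<in> borel_measurable borel" using u by auto
  define g where "g \<zeta> = u (\<zeta> + \<xi> k) * cnj (bump k (\<zeta> + \<xi> k))" for \<zeta>
  have um2 [measurable]: "(\<lambda>\<eta>. u \<eta> * cnj (bump k \<eta>)) \<in> borel_measurable borel" by measurable
  have ub: "(\<lambda>\<eta>. u \<eta> * cnj (bump k \<eta>)) \<in> L2"
  proof (rule L2_bound[OF um2 u, where C=Cb])
    show "cmod (u \<eta> * cnj (bump k \<eta>)) \<le> Cb * cmod (u \<eta>)" for \<eta>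
      using mult_right_mono[OF bump_bound[of k \<eta>] norm_ge_zero[of "u \<eta>"]] by (simp add: norm_mult mult.commute)
  qed
  have [measurable]: "(\<lambda>\<zeta>. \<zeta> + \<xi> k) \<in> borel_measurable borel" by measurable
  have gm [measurable]: "g \<in> borel_measurable borel"
    unfolding g_def[abs_def] using measurable_compose[OF \<open>(\<lambda>\<zeta>. \<zeta> + \<xi> k) \<in> borel_measurable borel\<close> um2] .
  have g2: "(\<lambda>\<zeta>. (cmod (g \<zeta>))\<^sup>2) = (\<lambda>\<zeta>. (\<lambda>\<eta>. (cmod (u \<eta> * cnj (bump k \<eta>)))\<^sup>2) (\<zeta> + \<xi> k))" by (simp add: g_def)
  have gL: "g \<in> L2"
    by (rule L2_I[OF gm], unfold g2, subst lborel_integral_shift(2)) (use L2_integrable_sq[OF ub] in auto)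
  have gn: "(l2_norm g)\<^sup>2 = (LINT \<eta>|lborel. (cmod (u \<eta>))\<^sup>2 * (cmod (bump k \<eta>))\<^sup>2)"
    unfolding l2_norm_sq g2 by (subst lborel_integral_shift(1)) (auto simp: norm_mult power_mult_distrib)
  have supp: "g \<zeta> = 0" if "\<zeta> \<notin> cube L" for \<zeta>
  proof (rule ccontr)
    assume "g \<zeta> \<noteq> 0"
    then have "norm \<zeta> < R1 * s k" using bump_support[of k "\<zeta> + \<xi> k"] by (auto simp: g_def)
    also have "R1 * s k < L"
    proof -
      have "R1 * \<beta> * s k < pi * s k" using R1\<beta> s_pos[of k] by (intro mult_strict_right_mono)
      then show ?thesis using \<beta> by (simp add: L_def field_simps)
    qed
    finally have "\<zeta> \<in> cube L" unfolding mem_cube by (meson component_le_norm_cart le_less_trans)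
    then show False using that by simp
  qed
  let ?c = "s k powr (- (real CARD('d) / 2))"
  have coef: "l2_inner u (pf (node k j, \<xi> k)) = of_real ?c * l2_inner g (cube_char L (- j))" for j
  proof -
    have "l2_inner u (pf (node k j, \<xi> k)) = (LINT \<eta>|lborel. (\<lambda>\<eta>. u \<eta> * cnj (pf (node k j, \<xi> k) \<eta>)) \<eta>)"
      by (simp add: l2_inner_def)
    also have "\<dots> = (LINT \<zeta>|lborel. u (\<zeta> + \<xi> k) * cnj (pf (node k j, \<xi> k) (\<zeta> + \<xi> k)))"
      by (rule lborel_integral_shift(1)[symmetric]) measurable
    also have "\<dots> = (LINT \<zeta>|lborel. of_real ?c * (g \<zeta> * cnj (cube_char L (- j) \<zeta>)))"
    proof (intro Bochner_Integration.integral_cong refl)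
      fix \<zeta>
      have e: "pi / L = \<beta> / s k" using \<beta> s_pos[of k] by (simp add: L_def)
      show "u (\<zeta> + \<xi> k) * cnj (pf (node k j, \<xi> k) (\<zeta> + \<xi> k)) = of_real ?c * (g \<zeta> * cnj (cube_char L (- j) \<zeta>))"
      proof (cases "\<zeta> \<in> cube L")
        case True
        then show ?thesis unfolding pf_eq g_def cube_char_def torus_char_def e
          by (simp add: ivec_minus cis_cnj inner_commute)
      next
        case False
        from supp[OF this] have "u (\<zeta> + \<xi> k) * cnj (bump k (\<zeta> + \<xi> k)) = 0" by (simp add: g_def)
        then show ?thesis using supp[OF False] unfolding pf_eq by auto
      qed
    qed
    also have "\<dots> = of_real ?c * l2_inner g (cube_char L (- j))" by (simp add: l2_inner_def)
    finally show ?thesis .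
  qed
  have "((\<lambda>j::int^'d. (cmod (l2_inner g (cube_char L j)))\<^sup>2) has_sum ((2 * L) ^ CARD('d) * (l2_norm g)\<^sup>2)) UNIV"
    by (rule fourier_series_parseval[OF L gL supp])
  then have "((\<lambda>j::int^'d. (cmod (l2_inner g (cube_char L (- j))))\<^sup>2) has_sum ((2 * L) ^ CARD('d) * (l2_norm g)\<^sup>2)) UNIV"
    by (subst has_sum_reindex_bij_witness[where T=UNIV and i=uminus and j=uminus]) auto
  from has_sum_cmult_right[OF this, of "?c\<^sup>2"]
  have "((\<lambda>j::int^'d. (cmod (l2_inner u (pf (node k j, \<xi> k))))\<^sup>2) has_sum (?c\<^sup>2 * ((2 * L) ^ CARD('d) * (l2_norm g)\<^sup>2))) UNIV"
    unfolding coef by (simp add: norm_mult power_mult_distrib)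
  moreover have "?c\<^sup>2 * (2 * L) ^ CARD('d) = (2 * pi / \<beta>) ^ CARD('d)"
  proof -
    have "?c\<^sup>2 = s k powr (- real CARD('d))" by (simp add: power2_eq_square flip: powr_add)
    also have "\<dots> = (1 / s k) ^ CARD('d)" using s_pos[of k] by (simp add: powr_minus powr_realpow power_one_over inverse_eq_divide)
    finally show ?thesis using s_pos[of k] by (simp add: L_def flip: power_mult_distrib)
  qed
  ultimately show ?thesis unfolding gn by (simp only: mult.assoc[symmetric])
qed

end

section \<open>The frame and its dual\<close>

context painless_system
begin

lemma lattice_inj: "inj (\<lambda>(k, j). (node k j, \<xi> k))"
proof (rule injI, clarify)
  fix k l :: nat and i j :: "int^'d"
  assume n: "node k i = node l j" and x: "\<xi> k = \<xi> l"
  have kl: "k = l" using x inj_eq[OF inj_\<xi>] by simp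
  have "\<beta> / s k \<noteq> 0" using \<beta> s_pos[of k] by simp
  then have "ivec i = ivec j" using n kl by simp
  then show "k = l \<and> i = j" using kl by (simp add: ivec_def vec_eq_iff)
qed

lemma lattice_memE:
  assumes "w \<in> lattice"
  obtains x k where "w = (x, \<xi> k)"
proof -
  obtain p where "w = (\<lambda>(k, j). (node k j, \<xi> k)) p" using assms unfolding lattice_def by blast
  then have "w = (node (fst p) (snd p), \<xi> (fst p))" by (simp add: case_prod_beta')
  then show thesis by (rule that)
qed

lemma pf_L2: "w \<in> lattice \<Longrightarrow> pf w \<in> L2"
  using lattice_memE pf_L1L2 L1L2_D(1) by metis

lemma energy_identity:
  assumes u: "u \<in> L2"
  shows "((\<lambda>w. (cmod (l2_inner u (pf w)))\<^sup>2) has_sum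
     ((2 * pi) ^ CARD('d) * (LINT \<eta>|lborel. (cmod (u \<eta>))\<^sup>2 * symbol \<eta>))) lattice"
proof -
  define \<kappa> where "\<kappa> = (2 * pi / \<beta>) ^ CARD('d)"
  have \<kappa>: "0 < \<kappa>" using \<beta> by (simp add: \<kappa>_def)
  have [measurable]: "u \<in> borel_measurable borel" using u by auto
  let ?F = "\<lambda>k \<eta>. (cmod (u \<eta>))\<^sup>2 * (cmod (bump k \<eta>))\<^sup>2"
  define I where "I k = \<kappa> * (LINT \<eta>|lborel. ?F k \<eta>)" for k
  let ?G = "\<lambda>\<eta>. (cmod (u \<eta>))\<^sup>2 * symbol \<eta>"
  have iF: "integrable lborel (?F k)" for k
  proof (rule Bochner_Integration.integrable_bound)
    show "integrable lborel (\<lambda>\<eta>. (cmod (u \<eta>))\<^sup>2 * Cb\<^sup>2)" using L2_integrable_sq[OF u] by simp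
    show "AE \<eta> in lborel. norm (?F k \<eta>) \<le> norm ((cmod (u \<eta>))\<^sup>2 * Cb\<^sup>2)"
    proof (rule AE_I2)
      fix \<eta>
      have "(cmod (bump k \<eta>))\<^sup>2 \<le> Cb\<^sup>2" by (intro power_mono bump_bound) simp
      then show "norm (?F k \<eta>) \<le> norm ((cmod (u \<eta>))\<^sup>2 * Cb\<^sup>2)" by (simp add: mult_left_mono)
    qed
  qed measurable
  have iG: "integrable lborel ?G"
  proof (rule Bochner_Integration.integrable_bound)
    show "integrable lborel (\<lambda>\<eta>. (cmod (u \<eta>))\<^sup>2 * m_max)" using L2_integrable_sq[OF u] by simp
    show "AE \<eta> in lborel. norm (?G \<eta>) \<le> norm ((cmod (u \<eta>))\<^sup>2 * m_max)"
    proof (rule AE_I2)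
      fix \<eta>
      have "symbol \<eta> \<le> m_max" "0 < symbol \<eta>" by (rule symbol_le, rule symbol_pos)
      then show "norm (?G \<eta>) \<le> norm ((cmod (u \<eta>))\<^sup>2 * m_max)" by (simp add: mult_left_mono abs_mult)
    qed
  qed measurable
  have I0: "0 \<le> I k" for k unfolding I_def using \<kappa> by (intro mult_nonneg_nonneg Bochner_Integration.integral_nonneg) auto
  have pw: "(\<lambda>k. \<kappa> * ?F k \<eta>) sums ((2 * pi) ^ CARD('d) * ?G \<eta>)" for \<eta>
  proof -
    have "(\<lambda>k. \<kappa> * ?F k \<eta>) sums (\<kappa> * ((cmod (u \<eta>))\<^sup>2 * (\<Sum>k | bump k \<eta> \<noteq> 0. (cmod (bump k \<eta>))\<^sup>2)))"
      by (intro sums_mult bump_sum_finite)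
    also have "\<kappa> * ((cmod (u \<eta>))\<^sup>2 * (\<Sum>k | bump k \<eta> \<noteq> 0. (cmod (bump k \<eta>))\<^sup>2)) = (2 * pi) ^ CARD('d) * ?G \<eta>"
      unfolding symbol_eq \<kappa>_def by (simp add: power_divide)
    finally show ?thesis .
  qed
  have Isum: "I sums ((2 * pi) ^ CARD('d) * (LINT \<eta>|lborel. ?G \<eta>))"
  proof -
    have nn: "0 \<le> \<kappa> * ?F k \<eta>" for k \<eta> using \<kappa> by simp
    have "ennreal ((2 * pi) ^ CARD('d) * (LINT \<eta>|lborel. ?G \<eta>)) = (\<integral>\<^sup>+\<eta>. ennreal ((2 * pi) ^ CARD('d) * ?G \<eta>) \<partial>lborel)"
      using iG symbol_pos by (subst nn_integral_eq_integral) (auto simp: less_imp_le)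
    also have "\<dots> = (\<integral>\<^sup>+\<eta>. (\<Sum>k. ennreal (\<kappa> * ?F k \<eta>)) \<partial>lborel)"
      by (intro nn_integral_cong suminf_ennreal_eq[symmetric] nn pw)
    also have "\<dots> = (\<Sum>k. \<integral>\<^sup>+\<eta>. ennreal (\<kappa> * ?F k \<eta>) \<partial>lborel)"
      by (rule nn_integral_suminf) measurable
    also have "\<dots> = (\<Sum>k. ennreal (I k))"
      unfolding I_def using iF nn by (intro suminf_cong) (subst nn_integral_eq_integral; auto)
    finally have "(\<Sum>k. ennreal (I k)) = ennreal ((2 * pi) ^ CARD('d) * (LINT \<eta>|lborel. ?G \<eta>))" ..
    then have "(\<lambda>k. ennreal (I k)) sums ennreal ((2 * pi) ^ CARD('d) * (LINT \<eta>|lborel. ?G \<eta>))"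
      using summable_sums[OF summableI, of "\<lambda>k. ennreal (I k)"] by simp
    moreover have "0 \<le> (2 * pi) ^ CARD('d) * (LINT \<eta>|lborel. ?G \<eta>)"
      using symbol_pos by (intro mult_nonneg_nonneg Bochner_Integration.integral_nonneg) (auto simp: less_imp_le)
    ultimately show ?thesis by (simp only: sums_ennreal[OF I0])
  qed
  let ?h = "\<lambda>(k, j). (cmod (l2_inner u (pf (node k j, \<xi> k))))\<^sup>2"
  have inner: "((\<lambda>j. ?h (k, j)) has_sum I k) UNIV" for k
    using parseval_single[OF u, of k] by (simp add: I_def \<kappa>_def)
  have outer: "(I has_sum ((2 * pi) ^ CARD('d) * (LINT \<eta>|lborel. ?G \<eta>))) UNIV"
    by (rule sums_nonneg_imp_has_sum[OF Isum I0])
  have "(?h has_sum ((2 * pi) ^ CARD('d) * (LINT \<eta>|lborel. ?G \<eta>))) (UNIV \<times> UNIV)"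
    by (intro has_sum_SigmaI[OF inner outer] summable_on_SigmaI[OF inner])
       (use outer in \<open>auto simp: summable_on_def\<close>)
  then have "(((\<lambda>w. (cmod (l2_inner u (pf w)))\<^sup>2) \<circ> (\<lambda>(k, j). (node k j, \<xi> k))) has_sum ((2 * pi) ^ CARD('d) * (LINT \<eta>|lborel. ?G \<eta>))) UNIV"
    by (simp add: o_def case_prod_beta')
  then show ?thesis
    unfolding lattice_def by (subst has_sum_reindex[OF lattice_inj])
qed

lemma symbol_weighted:
  assumes u: "u \<in> L2"
  shows "(\<lambda>\<eta>. of_real (sqrt (symbol \<eta>)) * u \<eta>) \<in> L2"
proof (rule L2_bound[OF _ u, where C="sqrt m_max"])
  show "(\<lambda>\<eta>. of_real (sqrt (symbol \<eta>)) * u \<eta>) \<in> borel_measurable borel" using u by measurable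
  show "cmod (of_real (sqrt (symbol \<eta>)) * u \<eta>) \<le> sqrt m_max * cmod (u \<eta>)" for \<eta>
    using symbol_le[of \<eta>] symbol_pos[of \<eta>] by (simp add: norm_mult mult_right_mono)
qed

text \<open>
  Polarization of \<open>energy_identity\<close>, whose right-hand side is a multiple of the squared norm of \<open>u\<close>
  weighted by the square root of the symbol.
\<close>

lemma energy_polarized:
  assumes u: "u \<in> L2" and v: "v \<in> L2"
  shows "((\<lambda>w. l2_inner u (pf w) * cnj (l2_inner v (pf w))) has_sum
     (of_real ((2 * pi) ^ CARD('d)) * (LINT \<eta>|lborel. u \<eta> * cnj (v \<eta>) * of_real (symbol \<eta>)))) lattice"
proof -
  define K where "K = (2 * pi) ^ CARD('d)"
  let ?\<sigma> = "\<lambda>u \<eta>. of_real (sqrt (symbol \<eta>)) * u \<eta>"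
  let ?T = "\<lambda>u w. l2_inner u (pf w)"
  have E: "((\<lambda>w. (cmod (?T u w))\<^sup>2) has_sum (K * (l2_norm (?\<sigma> u))\<^sup>2)) lattice" if "u \<in> L2" for u
  proof -
    have "(cmod (?\<sigma> u \<eta>))\<^sup>2 = (cmod (u \<eta>))\<^sup>2 * symbol \<eta>" for \<eta>
      using symbol_pos[of \<eta>] by (simp add: norm_mult power_mult_distrib)
    then show ?thesis using energy_identity[OF that] by (simp add: l2_norm_sq K_def)
  qed
  have iv: "(\<lambda>\<eta>. \<i> * v \<eta>) \<in> L2" by (rule L2_cmult[OF v])
  have T1: "?T (\<lambda>\<eta>. u \<eta> + v \<eta>) w = ?T u w + ?T v w" if "w \<in> lattice" for w
    by (rule l2_inner_add_left[OF u v pf_L2[OF that]])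
  have T2: "?T (\<lambda>\<eta>. u \<eta> + \<i> * v \<eta>) w = ?T u w + \<i> * ?T v w" if "w \<in> lattice" for w
    using l2_inner_add_left[OF u iv pf_L2[OF that]] by (simp add: l2_inner_cmult_left)
  have s1: "?\<sigma> (\<lambda>\<eta>. u \<eta> + v \<eta>) = (\<lambda>\<eta>. ?\<sigma> u \<eta> + ?\<sigma> v \<eta>)" and s2: "?\<sigma> (\<lambda>\<eta>. u \<eta> + \<i> * v \<eta>) = (\<lambda>\<eta>. ?\<sigma> u \<eta> + \<i> * ?\<sigma> v \<eta>)"
    by (auto simp: distrib_left)
  have P: "a * cnj b = complex_of_real (((cmod (a + b))\<^sup>2 - (cmod a)\<^sup>2 - (cmod b)\<^sup>2) / 2)
     + \<i> * complex_of_real (((cmod (a + \<i> * b))\<^sup>2 - (cmod a)\<^sup>2 - (cmod b)\<^sup>2) / 2)" for a b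
    unfolding cmod_power2 by (simp add: complex_eq_iff power2_eq_square algebra_simps)
  let ?R = "\<lambda>w. ((cmod (?T (\<lambda>\<eta>. u \<eta> + v \<eta>) w))\<^sup>2 - (cmod (?T u w))\<^sup>2 - (cmod (?T v w))\<^sup>2) / 2"
  let ?J = "\<lambda>w. ((cmod (?T (\<lambda>\<eta>. u \<eta> + \<i> * v \<eta>) w))\<^sup>2 - (cmod (?T u w))\<^sup>2 - (cmod (?T v w))\<^sup>2) / 2"
  have R: "(?R has_sum ((K * (l2_norm (\<lambda>\<eta>. ?\<sigma> u \<eta> + ?\<sigma> v \<eta>))\<^sup>2 - K * (l2_norm (?\<sigma> u))\<^sup>2 - K * (l2_norm (?\<sigma> v))\<^sup>2) / 2)) lattice"
    unfolding s1[symmetric] by (intro has_sum_divide_const has_sum_diff_real E L2_add u v)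
  have J: "(?J has_sum ((K * (l2_norm (\<lambda>\<eta>. ?\<sigma> u \<eta> + \<i> * ?\<sigma> v \<eta>))\<^sup>2 - K * (l2_norm (?\<sigma> u))\<^sup>2 - K * (l2_norm (?\<sigma> v))\<^sup>2) / 2)) lattice"
    unfolding s2[symmetric] by (intro has_sum_divide_const has_sum_diff_real E L2_add u iv v)
  have "((\<lambda>w. of_real (?R w) + \<i> * of_real (?J w)) has_sum
     (of_real ((K * (l2_norm (\<lambda>\<eta>. ?\<sigma> u \<eta> + ?\<sigma> v \<eta>))\<^sup>2 - K * (l2_norm (?\<sigma> u))\<^sup>2 - K * (l2_norm (?\<sigma> v))\<^sup>2) / 2)
     + \<i> * of_real ((K * (l2_norm (\<lambda>\<eta>. ?\<sigma> u \<eta> + \<i> * ?\<sigma> v \<eta>))\<^sup>2 - K * (l2_norm (?\<sigma> u))\<^sup>2 - K * (l2_norm (?\<sigma> v))\<^sup>2) / 2))) lattice"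
    by (intro has_sum_add has_sum_cmult_right has_sum_of_real R J)
  also have "(of_real ((K * (l2_norm (\<lambda>\<eta>. ?\<sigma> u \<eta> + ?\<sigma> v \<eta>))\<^sup>2 - K * (l2_norm (?\<sigma> u))\<^sup>2 - K * (l2_norm (?\<sigma> v))\<^sup>2) / 2)
     + \<i> * of_real ((K * (l2_norm (\<lambda>\<eta>. ?\<sigma> u \<eta> + \<i> * ?\<sigma> v \<eta>))\<^sup>2 - K * (l2_norm (?\<sigma> u))\<^sup>2 - K * (l2_norm (?\<sigma> v))\<^sup>2) / 2)) = of_real K * l2_inner (?\<sigma> u) (?\<sigma> v)"
    unfolding l2_inner_polarization[OF symbol_weighted[OF u] symbol_weighted[OF v]]
    by (simp add: complex_eq_iff right_diff_distrib diff_divide_distrib)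
  also have "l2_inner (?\<sigma> u) (?\<sigma> v) = (LINT \<eta>|lborel. u \<eta> * cnj (v \<eta>) * of_real (symbol \<eta>))"
    unfolding l2_inner_def
  proof (intro Bochner_Integration.integral_cong refl)
    fix \<eta>
    have "?\<sigma> u \<eta> * cnj (?\<sigma> v \<eta>) = u \<eta> * cnj (v \<eta>) * (of_real (sqrt (symbol \<eta>)) * of_real (sqrt (symbol \<eta>)))"
      by (simp add: mult_ac)
    also have "of_real (sqrt (symbol \<eta>)) * of_real (sqrt (symbol \<eta>)) = (of_real (symbol \<eta>) :: complex)"
      unfolding of_real_mult[symmetric] using symbol_pos[of \<eta>] by simp
    finally show "?\<sigma> u \<eta> * cnj (?\<sigma> v \<eta>) = u \<eta> * cnj (v \<eta>) * of_real (symbol \<eta>)" .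
  qed
  finally have "((\<lambda>w. of_real (?R w) + \<i> * of_real (?J w)) has_sum
     of_real K * (LINT \<eta>|lborel. u \<eta> * cnj (v \<eta>) * of_real (symbol \<eta>))) lattice" .
  then show ?thesis
    unfolding K_def by (rule has_sum_cong[THEN iffD1, rotated]) (simp only: T1 T2 P[symmetric])
qed

end

text \<open>
  The time side: \<open>\<phi>h\<close> is the Fourier transform of the window \<open>\<phi>\<close>.
\<close>

locale painless_frame =
  painless_system \<alpha> \<beta> R1 m0 R0 q \<xi> \<phi>h \<delta> Cb
  for \<alpha> \<beta> R1 m0 R0 q and \<xi> :: "nat \<Rightarrow> real^'b::finite" and \<phi>h \<delta> Cb +
  fixes \<phi> :: "real^'b \<Rightarrow> real"
  assumes \<phi>: "(\<lambda>t. complex_of_real (\<phi> t)) \<in> L1L2" and \<phi>h: "\<phi>h = fourier (\<lambda>t. complex_of_real (\<phi> t))"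
begin

abbreviation "\<psi> \<equiv> wave_packet \<alpha> \<phi>"

text \<open>
  Keeping the constant of Plancherel's theorem opaque prevents the power from being expanded.
\<close>

definition ft_const :: real where "ft_const = (2 * pi) ^ CARD('b)"

lemmas plancherel_ft = plancherel[where 'd='b, folded ft_const_def]
  and plancherel_norm_ft = plancherel_norm[where 'd='b, folded ft_const_def]
  and energy_identity_ft = energy_identity[folded ft_const_def]
  and energy_polarized_ft = energy_polarized[folded ft_const_def]
  and l2_inner_inv_fourier_ft = l2_inner_inv_fourier[where 'd='b, folded ft_const_def]
  and l2_inner_inv_fourier_inv_fourier_ft = l2_inner_inv_fourier_inv_fourier[where 'd='b, folded ft_const_def]

definition dual_ft :: "(real^'b) \<times> (real^'b) \<Rightarrow> real^'b \<Rightarrow> complex" where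
  "dual_ft w \<eta> = pf w \<eta> / of_real (symbol \<eta>)"

definition dual :: "(real^'b) \<times> (real^'b) \<Rightarrow> real^'b \<Rightarrow> complex" where
  "dual w = inv_fourier (dual_ft w)"

lemma ft_const_pos [simp]: "0 < ft_const" by (simp add: ft_const_def)

lemma ft_const_simps [simp]: "ft_const \<noteq> 0" "\<bar>ft_const\<bar> = ft_const" "0 \<le> ft_const"
  using ft_const_pos by linarith+

lemma packet_in_lattice: "w \<in> lattice \<Longrightarrow> \<psi> w \<in> L1L2" "w \<in> lattice \<Longrightarrow> fourier (\<psi> w) = pf w"
  using wave_packet_L1L2[OF \<phi> norm_\<xi>] unfolding \<phi>h by (auto elim!: lattice_memE)

lemma dual_ft_L1L2: "w \<in> lattice \<Longrightarrow> dual_ft w \<in> L1L2"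
  unfolding dual_ft_def[abs_def] using pf_div_L1L2 by (auto elim!: lattice_memE)

lemma dual_L2: "w \<in> lattice \<Longrightarrow> dual w \<in> L2"
  unfolding dual_def by (intro inv_fourier_L2 dual_ft_L1L2)

lemma div_symbol_L2:
  assumes "u \<in> L2" shows "(\<lambda>\<eta>. u \<eta> / of_real (symbol \<eta>)) \<in> L2"
proof (rule L2_bound[OF _ assms, where C="1 / m_min"])
  show "(\<lambda>\<eta>. u \<eta> / of_real (symbol \<eta>)) \<in> borel_measurable borel" using assms by measurable
  show "cmod (u \<eta> / of_real (symbol \<eta>)) \<le> 1 / m_min * cmod (u \<eta>)" for \<eta>
    using frac_le[of "cmod (u \<eta>)" "cmod (u \<eta>)" m_min "symbol \<eta>"] symbol_ge[of \<eta>] m_min_pos symbol_pos[of \<eta>]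
    by (simp add: norm_divide)
qed

lemma coefficient: "f \<in> L1L2 \<Longrightarrow> w \<in> lattice \<Longrightarrow> l2_inner (fourier f) (pf w) = of_real ft_const * l2_inner f (\<psi> w)"
  using plancherel_ft[OF _ packet_in_lattice(1), of f w] packet_in_lattice(2) by simp

text \<open>
  Division by the real symbol moves to the other argument of the inner product, so dual
  coefficients of \<open>h\<close> are packet coefficients of another function and \<open>energy_identity\<close> applies.
\<close>

lemma dual_coefficient:
  assumes "h \<in> L1L2" "w \<in> lattice"
  shows "of_real ft_const * l2_inner (dual w) h = cnj (l2_inner (\<lambda>\<eta>. fourier h \<eta> / of_real (symbol \<eta>)) (pf w))"
proof -
  have "of_real ft_const * l2_inner (dual w) h = l2_inner (dual_ft w) (fourier h)"
    unfolding dual_def using l2_inner_inv_fourier_ft[OF L1L2_D(2)[OF dual_ft_L1L2[OF assms(2)]] L1L2_D(2)[OF assms(1)]] by simp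
  also have "\<dots> = l2_inner (pf w) (\<lambda>\<eta>. fourier h \<eta> / of_real (symbol \<eta>))"
    unfolding l2_inner_def by (intro Bochner_Integration.integral_cong) (auto simp: dual_ft_def)
  also have "\<dots> = cnj (l2_inner (\<lambda>\<eta>. fourier h \<eta> / of_real (symbol \<eta>)) (pf w))" by (rule l2_inner_commute)
  finally show ?thesis .
qed

lemma dual_packet_inner:
  assumes "w \<in> lattice" "z \<in> lattice"
  shows "of_real ft_const * l2_inner (dual w) (\<psi> z) = l2_inner (dual_ft w) (pf z)"
  unfolding dual_def
  using l2_inner_inv_fourier_ft[OF L1L2_D(2)[OF dual_ft_L1L2[OF assms(1)]] L1L2_D(2)[OF packet_in_lattice(1)[OF assms(2)]]] packet_in_lattice(2)[OF assms(2)] by simp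

lemma dual_dual_inner:
  assumes "w \<in> lattice" "z \<in> lattice"
  shows "of_real ft_const * l2_inner (dual w) (dual z) = l2_inner (dual_ft w) (dual_ft z)"
  unfolding dual_def using l2_inner_inv_fourier_inv_fourier_ft[OF dual_ft_L1L2[OF assms(1)] dual_ft_L1L2[OF assms(2)]] by simp

lemma energy_packets:
  assumes f: "f \<in> L1L2"
  shows "((\<lambda>w. (cmod (l2_inner f (\<psi> w)))\<^sup>2) has_sum (1 / ft_const * (LINT \<eta>|lborel. (cmod (fourier f \<eta>))\<^sup>2 * symbol \<eta>))) lattice"
proof -
  have e: "(cmod (l2_inner f (\<psi> w)))\<^sup>2 = (1 / ft_const)\<^sup>2 * (cmod (l2_inner (fourier f) (pf w)))\<^sup>2" if "w \<in> lattice" for w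
    unfolding coefficient[OF f that] by (simp add: norm_mult power_mult_distrib power_divide norm_power)
  have "((\<lambda>w. (1 / ft_const)\<^sup>2 * (cmod (l2_inner (fourier f) (pf w)))\<^sup>2) has_sum
      ((1 / ft_const)\<^sup>2 * (ft_const * (LINT \<eta>|lborel. (cmod (fourier f \<eta>))\<^sup>2 * symbol \<eta>)))) lattice"
    by (intro has_sum_cmult_right energy_identity_ft fourier_L2_bound f)
  also have "(1 / ft_const)\<^sup>2 * (ft_const * (LINT \<eta>|lborel. (cmod (fourier f \<eta>))\<^sup>2 * symbol \<eta>)) = 1 / ft_const * (LINT \<eta>|lborel. (cmod (fourier f \<eta>))\<^sup>2 * symbol \<eta>)"
    using ft_const_pos by (simp add: power2_eq_square)
  finally show ?thesis by (rule has_sum_cong[THEN iffD1, rotated]) (simp add: e)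
qed

lemma fourier_energy:
  fixes f :: "real^'b \<Rightarrow> complex"
  shows "f \<in> L1L2 \<Longrightarrow> (LINT \<eta>|lborel. (cmod (fourier f \<eta>))\<^sup>2) = ft_const * (l2_norm f)\<^sup>2"
  using plancherel_norm_ft[of f] by (simp add: power_mult_distrib flip: l2_norm_sq)

lemma weighted_energy_bounds:
  assumes f: "f \<in> L1L2"
  shows "m_min * (ft_const * (l2_norm f)\<^sup>2) \<le> (LINT \<eta>|lborel. (cmod (fourier f \<eta>))\<^sup>2 * symbol \<eta>)"
    "(LINT \<eta>|lborel. (cmod (fourier f \<eta>))\<^sup>2 * symbol \<eta>) \<le> m_max * (ft_const * (l2_norm f)\<^sup>2)"
proof -
  note F = fourier_L2_bound(1)[OF f]
  have [measurable]: "fourier f \<in> borel_measurable borel" using F by auto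
  have i: "integrable lborel (\<lambda>\<eta>. (cmod (fourier f \<eta>))\<^sup>2)" by (rule L2_integrable_sq[OF F])
  have i2: "integrable lborel (\<lambda>\<eta>. (cmod (fourier f \<eta>))\<^sup>2 * symbol \<eta>)"
  proof (rule Bochner_Integration.integrable_bound)
    show "integrable lborel (\<lambda>\<eta>. (cmod (fourier f \<eta>))\<^sup>2 * m_max)" using i by simp
    show "AE \<eta> in lborel. norm ((cmod (fourier f \<eta>))\<^sup>2 * symbol \<eta>) \<le> norm ((cmod (fourier f \<eta>))\<^sup>2 * m_max)"
    proof (rule AE_I2)
      fix \<eta>
      have "symbol \<eta> \<le> m_max" "0 < symbol \<eta>" by (rule symbol_le, rule symbol_pos)
      then show "norm ((cmod (fourier f \<eta>))\<^sup>2 * symbol \<eta>) \<le> norm ((cmod (fourier f \<eta>))\<^sup>2 * m_max)" by (simp add: mult_left_mono abs_mult)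
    qed
  qed measurable
  have "m_min * (ft_const * (l2_norm f)\<^sup>2) = (LINT \<eta>|lborel. (cmod (fourier f \<eta>))\<^sup>2 * m_min)"
    using fourier_energy[OF f] by simp
  also have "\<dots> \<le> (LINT \<eta>|lborel. (cmod (fourier f \<eta>))\<^sup>2 * symbol \<eta>)"
    using i i2 by (intro integral_mono mult_left_mono symbol_ge) auto
  finally show "m_min * (ft_const * (l2_norm f)\<^sup>2) \<le> (LINT \<eta>|lborel. (cmod (fourier f \<eta>))\<^sup>2 * symbol \<eta>)" .
  have "(LINT \<eta>|lborel. (cmod (fourier f \<eta>))\<^sup>2 * symbol \<eta>) \<le> (LINT \<eta>|lborel. (cmod (fourier f \<eta>))\<^sup>2 * m_max)"
    using i i2 by (intro integral_mono mult_left_mono symbol_le) auto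
  also have "\<dots> = m_max * (ft_const * (l2_norm f)\<^sup>2)" using fourier_energy[OF f] by simp
  finally show "(LINT \<eta>|lborel. (cmod (fourier f \<eta>))\<^sup>2 * symbol \<eta>) \<le> m_max * (ft_const * (l2_norm f)\<^sup>2)" .
qed

lemma m_max_pos: "0 < m_max"
  using symbol_le[of 0] symbol_pos[of 0] by linarith

lemma bessel_packets: "bessel_on L1L2 m_max lattice \<psi>"
  unfolding bessel_on_def
proof (intro conjI ballI allI impI)
  show "0 \<le> m_max" using m_max_pos by simp
  show "\<psi> w \<in> L2" if "w \<in> lattice" for w using packet_in_lattice(1)[OF that] L1L2_D by blast
  fix f :: "real^'b \<Rightarrow> complex" and F assume f: "f \<in> L1L2" and F: "finite F" "F \<subseteq> lattice"
  have "(\<Sum>w\<in>F. (cmod (l2_inner f (\<psi> w)))\<^sup>2) \<le> 1 / ft_const * (LINT \<eta>|lborel. (cmod (fourier f \<eta>))\<^sup>2 * symbol \<eta>)"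
    by (rule has_sum_mono2[OF has_sum_finite[OF F(1)] energy_packets[OF f] F(2)]) simp
  also have "\<dots> \<le> 1 / ft_const * (m_max * (ft_const * (l2_norm f)\<^sup>2))"
    using weighted_energy_bounds(2)[OF f] ft_const_pos by (intro mult_left_mono) auto
  also have "\<dots> = m_max * (l2_norm f)\<^sup>2" using ft_const_pos by simp
  finally show "(\<Sum>w\<in>F. (cmod (l2_inner f (\<psi> w)))\<^sup>2) \<le> m_max * (l2_norm f)\<^sup>2" .
qed

theorem packets_frame: "frame_with_bounds m_min m_max lattice \<psi>"
proof (rule frame_from_dense[OF _ bessel_packets])
  show "0 \<le> m_min" using m_min_pos by simp
  fix f :: "real^'b \<Rightarrow> complex" assume f: "f \<in> L1L2"
  have "m_min * (l2_norm f)\<^sup>2 = 1 / ft_const * (m_min * (ft_const * (l2_norm f)\<^sup>2))" using ft_const_pos by simp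
  also have "\<dots> \<le> 1 / ft_const * (LINT \<eta>|lborel. (cmod (fourier f \<eta>))\<^sup>2 * symbol \<eta>)"
    using weighted_energy_bounds(1)[OF f] ft_const_pos by (intro mult_left_mono) auto
  also have "\<dots> = (\<Sum>\<^sub>\<infinity>w\<in>lattice. (cmod (l2_inner f (\<psi> w)))\<^sup>2)"
    by (rule infsumI[OF energy_packets[OF f], symmetric])
  finally show "m_min * (l2_norm f)\<^sup>2 \<le> (\<Sum>\<^sub>\<infinity>w\<in>lattice. (cmod (l2_inner f (\<psi> w)))\<^sup>2)" .
qed

text \<open>
  Dividing by the symbol in the definition of the dual cancels the symbol produced by
  \<open>energy_polarized\<close>.
\<close>

lemma dual_frame_operator:
  assumes w: "w \<in> lattice"
  shows "frame_operator lattice \<psi> (dual w) (\<psi> w)"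
  unfolding frame_operator_def
proof (intro conjI dual_L2 w)
  note v = L1L2_D(1)[OF dual_ft_L1L2[OF w]]
  have c: "l2_inner (dual w) (\<psi> z) = of_real (1 / ft_const) * l2_inner (dual_ft w) (pf z)" if "z \<in> lattice" for z
    using dual_packet_inner[OF w that, symmetric] by simp
  show "l2_has_sum (\<lambda>z t. l2_inner (dual w) (\<psi> z) * \<psi> z t) lattice (\<psi> w)"
  proof (rule l2_has_sum_from_weak[OF bessel_packets])
    show "\<psi> w \<in> L2" using packet_in_lattice(1)[OF w] L1L2_D by blast
    have "(\<lambda>z. (1 / ft_const)\<^sup>2 * (cmod (l2_inner (dual_ft w) (pf z)))\<^sup>2) summable_on lattice"
      using has_sum_cmult_right[OF energy_identity_ft[OF v]] by (auto simp: summable_on_def)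
    then show "(\<lambda>z. (cmod (l2_inner (dual w) (\<psi> z)))\<^sup>2) summable_on lattice"
      by (rule summable_on_cong[THEN iffD1, rotated]) (simp add: c norm_mult power_mult_distrib norm_divide norm_power power_divide)
    fix h :: "real^'b \<Rightarrow> complex" assume h: "h \<in> L1L2"
    have e: "of_real (1 / ft_const\<^sup>2) * (l2_inner (dual_ft w) (pf z) * cnj (l2_inner (fourier h) (pf z))) = l2_inner (dual w) (\<psi> z) * l2_inner (\<psi> z) h"
      if "z \<in> lattice" for z
      unfolding c[OF that] coefficient[OF h that] l2_inner_commute[of "\<psi> z" h] by (simp add: power2_eq_square)
    have "((\<lambda>z. of_real (1 / ft_const\<^sup>2) * (l2_inner (dual_ft w) (pf z) * cnj (l2_inner (fourier h) (pf z)))) has_sum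
      (of_real (1 / ft_const\<^sup>2) * (of_real ft_const * (LINT \<eta>|lborel. dual_ft w \<eta> * cnj (fourier h \<eta>) * of_real (symbol \<eta>))))) lattice"
      by (intro has_sum_cmult_right energy_polarized_ft v fourier_L2_bound h)
    also have "(LINT \<eta>|lborel. dual_ft w \<eta> * cnj (fourier h \<eta>) * of_real (symbol \<eta>)) = l2_inner (fourier (\<psi> w)) (fourier h)"
      unfolding l2_inner_def packet_in_lattice(2)[OF w]
    proof (intro Bochner_Integration.integral_cong refl)
      fix \<eta>
      have "symbol \<eta> \<noteq> 0" using symbol_pos[of \<eta>] by simp
      then show "dual_ft w \<eta> * cnj (fourier h \<eta>) * of_real (symbol \<eta>) = pf w \<eta> * cnj (fourier h \<eta>)"
        by (simp add: dual_ft_def)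
    qed
    also have "\<dots> = of_real ft_const * l2_inner (\<psi> w) h" by (rule plancherel_ft[OF packet_in_lattice(1)[OF w] h])
    also have "of_real (1 / ft_const\<^sup>2) * (of_real ft_const * (of_real ft_const * l2_inner (\<psi> w) h)) = l2_inner (\<psi> w) h"
      using ft_const_pos by (simp add: power2_eq_square)
    finally show "((\<lambda>z. l2_inner (dual w) (\<psi> z) * l2_inner (\<psi> z) h) has_sum l2_inner (\<psi> w) h) lattice"
      by (rule has_sum_cong[THEN iffD1, rotated]) (simp only: e)
  qed
qed

theorem dual_canonical: "canonical_dual lattice \<psi> dual"
  by (rule canonical_dualI[OF packets_frame m_min_pos dual_frame_operator])

lemma bessel_dual: "bessel_on L1L2 (1 / m_min) lattice dual"
  unfolding bessel_on_def
proof (intro conjI ballI allI impI)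
  show "0 \<le> 1 / m_min" using m_min_pos by simp
  show "dual w \<in> L2" if "w \<in> lattice" for w by (rule dual_L2[OF that])
  fix h :: "real^'b \<Rightarrow> complex" and F assume h: "h \<in> L1L2" and F: "finite F" "F \<subseteq> lattice"
  let ?u = "\<lambda>\<eta>. fourier h \<eta> / of_real (symbol \<eta>)"
  note H = fourier_L2_bound(1)[OF h]
  have [measurable]: "fourier h \<in> borel_measurable borel" using H by auto
  have u: "?u \<in> L2" by (rule div_symbol_L2[OF H])
  have e: "(cmod (l2_inner h (dual w)))\<^sup>2 = (1 / ft_const)\<^sup>2 * (cmod (l2_inner ?u (pf w)))\<^sup>2" if "w \<in> lattice" for w
  proof -
    have "cmod (l2_inner ?u (pf w)) = cmod (cnj (l2_inner ?u (pf w)))" by simp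
    also have "\<dots> = ft_const * cmod (l2_inner (dual w) h)" unfolding dual_coefficient[OF h that, symmetric] by (simp add: norm_mult norm_power)
    also have "cmod (l2_inner (dual w) h) = cmod (l2_inner h (dual w))" by (subst l2_inner_commute) simp
    finally show ?thesis using ft_const_pos by (simp add: power_mult_distrib power_divide)
  qed
  have "(\<Sum>w\<in>F. (cmod (l2_inner h (dual w)))\<^sup>2) = (1 / ft_const)\<^sup>2 * (\<Sum>w\<in>F. (cmod (l2_inner ?u (pf w)))\<^sup>2)"
    unfolding sum_distrib_left using F e by (intro sum.cong) auto
  also have "\<dots> \<le> (1 / ft_const)\<^sup>2 * (ft_const * (LINT \<eta>|lborel. (cmod (?u \<eta>))\<^sup>2 * symbol \<eta>))"
    by (intro mult_left_mono has_sum_mono2[OF has_sum_finite[OF F(1)] energy_identity_ft[OF u] F(2)]) auto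
  also have "\<dots> = 1 / ft_const * (LINT \<eta>|lborel. (cmod (?u \<eta>))\<^sup>2 * symbol \<eta>)" using ft_const_pos by (simp add: power2_eq_square)
  also have "\<dots> \<le> 1 / ft_const * (LINT \<eta>|lborel. (cmod (fourier h \<eta>))\<^sup>2 * (1 / m_min))"
  proof (intro mult_left_mono integral_mono_AE')
    show "integrable lborel (\<lambda>\<eta>. (cmod (fourier h \<eta>))\<^sup>2 * (1 / m_min))" using L2_integrable_sq[OF H] by simp
    show "AE \<eta> in lborel. (cmod (?u \<eta>))\<^sup>2 * symbol \<eta> \<le> (cmod (fourier h \<eta>))\<^sup>2 * (1 / m_min)"
    proof (rule AE_I2)
      fix \<eta>
      have "(cmod (?u \<eta>))\<^sup>2 * symbol \<eta> = (cmod (fourier h \<eta>))\<^sup>2 * (1 / symbol \<eta>)"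
        using symbol_pos[of \<eta>] by (simp add: norm_divide power_divide power2_eq_square)
      also have "\<dots> \<le> (cmod (fourier h \<eta>))\<^sup>2 * (1 / m_min)"
        using symbol_ge[of \<eta>] m_min_pos by (intro mult_left_mono frac_le) auto
      finally show "(cmod (?u \<eta>))\<^sup>2 * symbol \<eta> \<le> (cmod (fourier h \<eta>))\<^sup>2 * (1 / m_min)" .
    qed
    show "AE \<eta> in lborel. 0 \<le> (cmod (fourier h \<eta>))\<^sup>2 * (1 / m_min)"
      using m_min_pos by (intro AE_I2) simp
  qed (use ft_const_pos in simp)
  also have "\<dots> = 1 / m_min * (l2_norm h)\<^sup>2" using fourier_energy[OF h] ft_const_pos by simp
  finally show "(\<Sum>w\<in>F. (cmod (l2_inner h (dual w)))\<^sup>2) \<le> 1 / m_min * (l2_norm h)\<^sup>2" .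
qed

theorem reconstruction:
  assumes "f \<in> L2"
  shows "l2_has_sum (\<lambda>w t. l2_inner f (\<psi> w) * dual w t) lattice f"
proof (rule reconstruction_extend[OF bessel_packets bessel_dual _ assms])
  fix f :: "real^'b \<Rightarrow> complex" assume f: "f \<in> L1L2"
  note F = fourier_L2_bound(1)[OF f]
  show "l2_has_sum (\<lambda>w t. l2_inner f (\<psi> w) * dual w t) lattice f"
  proof (rule l2_has_sum_from_weak[OF bessel_dual L1L2_D(1)[OF f]])
    show "(\<lambda>w. (cmod (l2_inner f (\<psi> w)))\<^sup>2) summable_on lattice"
      using energy_packets[OF f] by (auto simp: summable_on_def)
    fix h :: "real^'b \<Rightarrow> complex" assume h: "h \<in> L1L2"
    let ?u = "\<lambda>\<eta>. fourier h \<eta> / of_real (symbol \<eta>)"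
    have e: "of_real (1 / ft_const\<^sup>2) * (l2_inner (fourier f) (pf w) * cnj (l2_inner ?u (pf w))) = l2_inner f (\<psi> w) * l2_inner (dual w) h"
      if "w \<in> lattice" for w
      unfolding dual_coefficient[OF h that, symmetric] coefficient[OF f that] by (simp add: power2_eq_square)
    have "((\<lambda>w. of_real (1 / ft_const\<^sup>2) * (l2_inner (fourier f) (pf w) * cnj (l2_inner ?u (pf w)))) has_sum
      (of_real (1 / ft_const\<^sup>2) * (of_real ft_const * (LINT \<eta>|lborel. fourier f \<eta> * cnj (?u \<eta>) * of_real (symbol \<eta>))))) lattice"
      by (intro has_sum_cmult_right energy_polarized_ft F div_symbol_L2 fourier_L2_bound h)
    also have "(LINT \<eta>|lborel. fourier f \<eta> * cnj (?u \<eta>) * of_real (symbol \<eta>)) = l2_inner (fourier f) (fourier h)"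
      unfolding l2_inner_def
    proof (intro Bochner_Integration.integral_cong refl)
      fix \<eta>
      have "symbol \<eta> \<noteq> 0" using symbol_pos[of \<eta>] by simp
      then show "fourier f \<eta> * cnj (?u \<eta>) * of_real (symbol \<eta>) = fourier f \<eta> * cnj (fourier h \<eta>)"
        by simp
    qed
    also have "\<dots> = of_real ft_const * l2_inner f h" by (rule plancherel_ft[OF f h])
    also have "of_real (1 / ft_const\<^sup>2) * (of_real ft_const * (of_real ft_const * l2_inner f h)) = l2_inner f h"
      using ft_const_pos by (simp add: power2_eq_square)
    finally show "((\<lambda>w. l2_inner f (\<psi> w) * l2_inner (dual w) h) has_sum l2_inner f h) lattice"
      by (rule has_sum_cong[THEN iffD1, rotated]) (simp only: e)
  qed
qed

end

section \<open>Localization of the dual frame\<close>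

context painless_system
begin

definition \<kappa> :: real where "\<kappa> = scale_ratio \<alpha> R1"

lemma \<kappa>_ge: "1 \<le> \<kappa>"
  unfolding \<kappa>_def using R1 by (intro scale_ratio_ge) auto

text \<open>
  A condition on centres and scales rather than on the supports themselves: it is symmetric and
  implied by the existence of a common point.
\<close>

definition neighbours :: "nat \<Rightarrow> nat set" where
  "neighbours k = {l. norm (\<xi> k - \<xi> l) \<le> R1 * (s k + s l)}"

lemma neighbours_comparable:
  assumes "l \<in> neighbours k"
  shows "s l \<le> \<kappa> * s k" "s k \<le> \<kappa> * s l" "norm (\<xi> k) \<le> freq_ratio \<alpha> R1 * norm (\<xi> l)"
proof -
  have d: "norm (\<xi> k - \<xi> l) \<le> R1 * (s k + s l)" "norm (\<xi> l - \<xi> k) \<le> R1 * (s l + s k)"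
    using assms by (auto simp: neighbours_def norm_minus_commute add.commute)
  have R: "0 \<le> R1" "R1 \<le> R1" using R1 by auto
  show "s l \<le> \<kappa> * s k" unfolding \<kappa>_def by (rule fscale_comparable(2)[OF \<alpha> norm_\<xi> norm_\<xi> R d(1)])
  show "s k \<le> \<kappa> * s l" unfolding \<kappa>_def by (rule fscale_comparable(2)[OF \<alpha> norm_\<xi> norm_\<xi> R d(2)])
  show "norm (\<xi> k) \<le> freq_ratio \<alpha> R1 * norm (\<xi> l)" by (rule fscale_comparable(1)[OF \<alpha> norm_\<xi> norm_\<xi> R d(2)])
qed

definition nb :: nat where "nb = overlap_bound TYPE(real^'d) \<alpha> (q * (1 + \<kappa>)) (R1 * (1 + \<kappa>))"

lemma neighbours_finite: "finite (neighbours k)" "card (neighbours k) \<le> nb"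
proof -
  have sub: "neighbours k \<subseteq> {l. norm (\<xi> k - \<xi> l) \<le> (R1 * (1 + \<kappa>)) * s l}"
  proof
    fix l assume l: "l \<in> neighbours k"
    have "norm (\<xi> k - \<xi> l) \<le> R1 * (s k + s l)" using l by (simp add: neighbours_def)
    also have "\<dots> \<le> R1 * (\<kappa> * s l + s l)" using neighbours_comparable(2)[OF l] R1 by (intro mult_left_mono) auto
    finally show "l \<in> {l. norm (\<xi> k - \<xi> l) \<le> (R1 * (1 + \<kappa>)) * s l}" by (simp add: algebra_simps)
  qed
  have "finite {l. norm (\<xi> k - \<xi> l) \<le> (R1 * (1 + \<kappa>)) * s l} \<and> card {l. norm (\<xi> k - \<xi> l) \<le> (R1 * (1 + \<kappa>)) * s l} \<le> nb"
    unfolding nb_def using R1 \<kappa>_ge q by (intro bounded_overlap[OF \<alpha> \<delta> sep]) auto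
  with sub show "finite (neighbours k)" "card (neighbours k) \<le> nb"
    by (auto intro: finite_subset order_trans[OF card_mono])
qed

lemma bump_overlap_neighbours:
  assumes "norm (\<eta> - \<xi> k) < R1 * s k" "bump l \<eta> \<noteq> 0"
  shows "l \<in> neighbours k"
proof -
  have "norm (\<xi> k - \<xi> l) \<le> norm (\<eta> - \<xi> l) + norm (\<eta> - \<xi> k)"
    using norm_triangle_ineq4[of "\<eta> - \<xi> l" "\<eta> - \<xi> k"] by simp
  then show ?thesis using assms(1) bump_support[OF assms(2)] by (simp add: neighbours_def distrib_left)
qed

abbreviation region :: "nat \<Rightarrow> (real^'d) set" where "region k \<equiv> ball (\<xi> k) (R1 * s k)"

text \<open>
  On the support of one bump the symbol is a sum of a fixed finite family of bumps, which can be
  differentiated term by term.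
\<close>

lemma symbol_local:
  assumes "\<eta> \<in> region k"
  shows "complex_of_real (symbol \<eta>) = (\<Sum>l\<in>neighbours k. of_real ((1 / \<beta>) ^ CARD('d)) * (bump l \<eta> * cnj (bump l \<eta>)))"
proof -
  have \<eta>: "norm (\<eta> - \<xi> k) < R1 * s k" using assms by (simp add: dist_norm norm_minus_commute)
  have "(\<Sum>l | bump l \<eta> \<noteq> 0. (cmod (bump l \<eta>))\<^sup>2) = (\<Sum>l\<in>neighbours k. (cmod (bump l \<eta>))\<^sup>2)"
    using bump_overlap_neighbours[OF \<eta>] neighbours_finite by (intro sum.mono_neutral_left) auto
  then have "symbol \<eta> = (\<Sum>l\<in>neighbours k. (1 / \<beta>) ^ CARD('d) * (cmod (bump l \<eta>))\<^sup>2)"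
    unfolding symbol_eq by (simp only: sum_distrib_left)
  then show ?thesis by (simp only: of_real_sum of_real_mult complex_norm_square)
qed

lemma region_open: "open (region k)" by simp

lemma bump_dir_bounded:
  assumes C: "0 \<le> C" "dir_bounded UNIV (axis i 1) n C \<phi>h" and l: "l \<in> neighbours k"
  shows "dir_bounded (region k) (s k *\<^sub>R axis i 1) n (C * \<kappa> ^ n) (bump l)"
proof -
  have "dir_bounded UNIV (s k *\<^sub>R axis i 1) n (C * max 1 \<bar>s k * (1 / s l)\<bar> ^ n) (\<lambda>\<eta>. \<phi>h ((1 / s l) *\<^sub>R (\<eta> - \<xi> l)))"
    by (rule dir_bounded_affine[OF C(2,1)])
  moreover have "C * max 1 \<bar>s k * (1 / s l)\<bar> ^ n \<le> C * \<kappa> ^ n"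
  proof (intro mult_left_mono power_mono C(1))
    show "max 1 \<bar>s k * (1 / s l)\<bar> \<le> \<kappa>"
      using \<kappa>_ge neighbours_comparable(2)[OF l] s_pos[of k] s_pos[of l] by (simp add: divide_le_eq)
  qed simp
  ultimately have "dir_bounded UNIV (s k *\<^sub>R axis i 1) n (C * \<kappa> ^ n) (bump l)"
    unfolding bump_def[abs_def] by (rule dir_bounded_mono)
  then show ?thesis by (rule dir_bounded_subset) (rule subset_UNIV)
qed

text \<open>
  A closed set inside the open region, as \<open>dir_bounded_extend\<close> requires, outside which the bump vanishes.
\<close>

definition bump_carrier :: "nat \<Rightarrow> (real^'d) set" where
  "bump_carrier k = (\<lambda>\<eta>. (1 / s k) *\<^sub>R (\<eta> - \<xi> k)) -` supp \<phi>h"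

lemma bump_carrier_closed: "closed (bump_carrier k)"
  unfolding bump_carrier_def by (rule closed_vimage) (auto simp: supp_def intro!: continuous_intros)

lemma bump_carrier_off: "\<eta> \<notin> bump_carrier k \<Longrightarrow> bump k \<eta> = 0"
  unfolding bump_carrier_def bump_def supp_def using closure_subset[of "{x. \<phi>h x \<noteq> 0}"] by blast

lemma bump_carrier_region: "bump_carrier k \<subseteq> region k"
proof
  fix \<eta> assume "\<eta> \<in> bump_carrier k"
  then have "norm ((1 / s k) *\<^sub>R (\<eta> - \<xi> k)) < R1" using suppR by (auto simp: bump_carrier_def)
  then have "norm (\<eta> - \<xi> k) < R1 * s k" unfolding norm_rescaled using s_pos[of k] by (simp add: pos_divide_less_eq)
  then show "\<eta> \<in> region k" by (simp add: dist_norm norm_minus_commute)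
qed

text \<open>
  Derivatives are taken at scale \<open>s k\<close>; neighbouring scales differ by a factor of at most \<open>\<kappa>\<close>, and the
  number of neighbours is bounded, so none of the constants depends on \<open>k\<close> or \<open>l\<close>.  The two powers of
  the symbol belong to inner products of a dual element with a packet and with a dual element.
\<close>

lemma cross_term_dir_bounded:
  "\<exists>C\<ge>0. \<forall>k l i. l \<in> neighbours k \<longrightarrow>
     dir_bounded UNIV (s k *\<^sub>R axis i 1) n C (\<lambda>\<eta>. bump k \<eta> * (cnj (bump l \<eta>) * inverse (of_real (symbol \<eta>)))) \<and>
     dir_bounded UNIV (s k *\<^sub>R axis i 1) n C (\<lambda>\<eta>. bump k \<eta> * (cnj (bump l \<eta>) * (inverse (of_real (symbol \<eta>)) * inverse (of_real (symbol \<eta>)))))"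
proof -
  obtain C where C: "0 \<le> C" "\<And>i. dir_bounded UNIV (axis i 1) n C \<phi>h"
    using smooth_compact_support_uniform[OF smooth] by blast
  define D where "D = C * \<kappa> ^ n"
  have D: "0 \<le> D" using C(1) \<kappa>_ge by (simp add: D_def)
  define E where "E = cmod (of_real ((1 / \<beta>) ^ CARD('d))) * (2 ^ n * D * D)"
  have E: "0 \<le> E" using D by (simp add: E_def)
  have nbE: "0 \<le> real nb * E" using E by simp
  obtain I where I: "0 \<le> I" and Iv: "\<And>U (v::real^'d) m. dir_bounded U v n (real nb * E) m \<Longrightarrow> (\<forall>\<eta>\<in>U. m_min \<le> cmod (m \<eta>)) \<Longrightarrow>
    dir_bounded U v n I (\<lambda>\<eta>. inverse (m \<eta>))"
    using dir_bounded_inverse[OF m_min_pos nbE, of n] by blast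
  define F1 where "F1 = 2 ^ n * D * (2 ^ n * D * I)"
  define F2 where "F2 = 2 ^ n * D * (2 ^ n * D * (2 ^ n * I * I))"
  have F: "0 \<le> F1" "0 \<le> F2" using D I by (auto simp: F1_def F2_def)
  show ?thesis
  proof (intro exI[of _ "max F1 F2"] conjI allI impI)
    show "0 \<le> max F1 F2" using F by simp
    fix k l :: nat and i :: 'd assume l: "l \<in> neighbours k"
    let ?v = "s k *\<^sub>R axis i 1 :: real^'d" and ?U = "region k"
    have b: "dir_bounded ?U ?v n D (bump l)" if "l \<in> neighbours k" for l
      unfolding D_def by (rule bump_dir_bounded[OF C that])
    have kk: "k \<in> neighbours k" using R1 s_pos[of k] by (simp add: neighbours_def less_imp_le)
    have "dir_bounded ?U ?v n (real (card (neighbours k)) * E) (\<lambda>\<eta>. \<Sum>l\<in>neighbours k. of_real ((1 / \<beta>) ^ CARD('d)) * (bump l \<eta> * cnj (bump l \<eta>)))"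
      unfolding E_def using D by (intro dir_bounded_sum neighbours_finite dir_bounded_cmult dir_bounded_mult b dir_bounded_cnj) auto
    moreover have "real (card (neighbours k)) * E \<le> real nb * E" using neighbours_finite(2)[of k] E by (intro mult_right_mono) auto
    ultimately have "dir_bounded ?U ?v n (real nb * E) (\<lambda>\<eta>. \<Sum>l\<in>neighbours k. of_real ((1 / \<beta>) ^ CARD('d)) * (bump l \<eta> * cnj (bump l \<eta>)))"
      by (rule dir_bounded_mono)
    then have sy: "dir_bounded ?U ?v n (real nb * E) (\<lambda>\<eta>. of_real (symbol \<eta>))"
      by (rule dir_bounded_cong[OF region_open, rotated]) (rule symbol_local[symmetric])
    have "m_min \<le> cmod (of_real (symbol \<eta>))" for \<eta> using symbol_ge[of \<eta>] by simp
    then have inv: "dir_bounded ?U ?v n I (\<lambda>\<eta>. inverse (of_real (symbol \<eta>)))" by (intro Iv[OF sy]) blast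
    let ?G1 = "\<lambda>\<eta>. bump k \<eta> * (cnj (bump l \<eta>) * inverse (of_real (symbol \<eta>)))"
    let ?G2 = "\<lambda>\<eta>. bump k \<eta> * (cnj (bump l \<eta>) * (inverse (of_real (symbol \<eta>)) * inverse (of_real (symbol \<eta>))))"
    have G1: "dir_bounded ?U ?v n F1 ?G1"
      unfolding F1_def using D I by (intro dir_bounded_mult b kk dir_bounded_cnj l inv) auto
    have G2: "dir_bounded ?U ?v n F2 ?G2"
      unfolding F2_def using D I by (intro dir_bounded_mult b kk dir_bounded_cnj l inv) auto
    have cl: "closed (bump_carrier k)" and sub: "bump_carrier k \<subseteq> ?U" and off: "\<And>\<eta>. \<eta> \<notin> bump_carrier k \<Longrightarrow> bump k \<eta> = 0"
      by (rule bump_carrier_closed, rule bump_carrier_region, rule bump_carrier_off)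
    show "dir_bounded UNIV ?v n (max F1 F2) ?G1"
      by (rule dir_bounded_extend[OF region_open cl sub _ dir_bounded_mono[OF G1]]) (use F off in auto)
    show "dir_bounded UNIV ?v n (max F1 F2) ?G2"
      by (rule dir_bounded_extend[OF region_open cl sub _ dir_bounded_mono[OF G2]]) (use F off in auto)
  qed
qed

text \<open>
  For neighbours the scale in the separation function is comparable to \<open>norm (\<xi> k)\<close>, and the
  distance of the frequencies is at most a constant times \<open>s k\<close>.
\<close>

lemma separation_bound:
  assumes l: "l \<in> neighbours k"
  shows "1 + separation \<alpha> (x, \<xi> k) (y, \<xi> l) \<le> (1 + \<kappa> + \<kappa> * (R1 * (1 + \<kappa>))) * (1 + s k * norm (y - x))"
proof -
  define r where "r = 1 + min (norm (\<xi> k)) (norm (\<xi> l))"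
  define L where "L = freq_ratio \<alpha> R1"
  have L: "2 \<le> L" unfolding L_def using R1 by (intro freq_ratio_ge) simp
  have n: "1 \<le> norm (\<xi> k)" "1 \<le> norm (\<xi> l)" by (rule norm_\<xi>)+
  have r1: "r \<le> L * norm (\<xi> k)"
  proof -
    have "r \<le> 2 * norm (\<xi> k)" using n by (simp add: r_def min_def)
    also have "\<dots> \<le> L * norm (\<xi> k)" using L by (intro mult_right_mono) auto
    finally show ?thesis .
  qed
  have r2: "norm (\<xi> k) \<le> L * r"
  proof -
    have "norm (\<xi> k) \<le> L * norm (\<xi> l)" unfolding L_def by (rule neighbours_comparable(3)[OF l])
    moreover have "1 * norm (\<xi> k) \<le> L * norm (\<xi> k)" using L by (intro mult_right_mono) auto
    ultimately have "norm (\<xi> k) \<le> L * min (norm (\<xi> k)) (norm (\<xi> l))" by (simp add: min_def)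
    also have "\<dots> \<le> L * r" unfolding r_def using L by (intro mult_left_mono) auto
    finally show ?thesis .
  qed
  have rpos: "0 < r" using n by (simp add: r_def min_def)
  have \<kappa>L: "\<kappa> = L powr \<bar>1 - \<alpha>\<bar>" "\<kappa> = L powr \<bar>\<alpha> - 1\<bar>" by (auto simp: \<kappa>_def L_def scale_ratio_def abs_minus_commute)
  have p1: "r powr (1 - \<alpha>) \<le> \<kappa> * s k"
    unfolding \<kappa>L(1) fscale_def by (rule powr_comparable) (use n rpos L r1 r2 in auto)
  have p2: "r powr (\<alpha> - 1) \<le> \<kappa> * (1 / s k)"
  proof -
    have "r powr (\<alpha> - 1) \<le> \<kappa> * norm (\<xi> k) powr (\<alpha> - 1)"
      unfolding \<kappa>L(2) by (rule powr_comparable) (use n rpos L r1 r2 in auto)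
    moreover have "norm (\<xi> k) powr (\<alpha> - 1) = 1 / s k"
      using powr_minus_divide[of "norm (\<xi> k)" "1 - \<alpha>"] by (simp add: fscale_def)
    ultimately show ?thesis by simp
  qed
  have d: "norm (\<xi> k - \<xi> l) \<le> R1 * (1 + \<kappa>) * s k"
  proof -
    have "norm (\<xi> k - \<xi> l) \<le> R1 * (s k + s l)" using l by (simp add: neighbours_def)
    also have "\<dots> \<le> R1 * (s k + \<kappa> * s k)" using neighbours_comparable(1)[OF l] R1 by (intro mult_left_mono) auto
    finally show ?thesis by (simp add: algebra_simps)
  qed
  have "r powr (1 - \<alpha>) * norm (x - y) \<le> \<kappa> * s k * norm (y - x)"
    using p1 by (simp add: norm_minus_commute mult_right_mono)
  moreover have "r powr (\<alpha> - 1) * norm (\<xi> k - \<xi> l) \<le> \<kappa> * (1 / s k) * (R1 * (1 + \<kappa>) * s k)"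
    using p2 d \<kappa>_ge s_pos[of k] by (intro mult_mono) auto
  ultimately have "separation \<alpha> (x, \<xi> k) (y, \<xi> l) \<le> \<kappa> * s k * norm (y - x) + \<kappa> * (1 / s k) * (R1 * (1 + \<kappa>) * s k)"
    by (simp add: separation_def sep_scale_def r_def)
  also have "\<kappa> * (1 / s k) * (R1 * (1 + \<kappa>) * s k) = \<kappa> * (R1 * (1 + \<kappa>))" using s_pos[of k] by simp
  finally have A: "separation \<alpha> (x, \<xi> k) (y, \<xi> l) \<le> \<kappa> * (s k * norm (y - x)) + \<kappa> * (R1 * (1 + \<kappa>))" by (simp add: mult.assoc)
  define t where "t = s k * norm (y - x)"
  have t: "0 \<le> t" using s_pos[of k] by (simp add: t_def)
  have c: "0 \<le> \<kappa> * (R1 * (1 + \<kappa>))" using \<kappa>_ge R1 by simp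
  have "0 \<le> \<kappa> * (R1 * (1 + \<kappa>)) * t" using c t by (rule mult_nonneg_nonneg)
  then show ?thesis using A t \<kappa>_ge unfolding t_def[symmetric] by (simp add: distrib_right distrib_left)
qed

text \<open>
  The normalizing factors of two packets against the volume of a frequency ball.
\<close>

lemma amplitude_bound:
  assumes l: "l \<in> neighbours k"
  shows "s k powr (- (real CARD('d) / 2)) * s l powr (- (real CARD('d) / 2)) * s k ^ CARD('d) \<le> \<kappa> powr (real CARD('d) / 2)"
proof -
  let ?h = "real CARD('d) / 2"
  have "s k ^ CARD('d) = s k powr (?h + ?h)" using s_pos[of k] by (simp add: powr_realpow)
  also have "\<dots> = s k powr ?h * s k powr ?h" by (rule powr_add)
  finally have "s k powr (- ?h) * s l powr (- ?h) * s k ^ CARD('d) = (s k powr (- ?h) * s k powr ?h) * (s k powr ?h * s l powr (- ?h))"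
    by (simp only: mult_ac)
  also have "s k powr (- ?h) * s k powr ?h = 1" using s_pos[of k] by (simp flip: powr_add)
  also have "s k powr ?h \<le> (\<kappa> * s l) powr ?h" using neighbours_comparable(2)[OF l] s_pos[of k] by (intro powr_mono2) auto
  then have "1 * (s k powr ?h * s l powr (- ?h)) \<le> (\<kappa> * s l) powr ?h * s l powr (- ?h)" by (simp add: mult_right_mono)
  also have "\<dots> = \<kappa> powr ?h * (s l powr ?h * s l powr (- ?h))" using \<kappa>_ge s_pos[of l] by (simp add: powr_mult)
  also have "s l powr ?h * s l powr (- ?h) = 1" using s_pos[of l] by (simp flip: powr_add)
  finally show ?thesis by simp
qed

end

context painless_frame
begin

lemma oscillatory_bound:
  assumes C: "0 \<le> C" "\<And>i. dir_bounded UNIV (s k *\<^sub>R axis i 1) n C G"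
    and m: "G \<in> borel_measurable borel" and supp: "\<And>\<eta>. \<eta> \<notin> bump_carrier k \<Longrightarrow> G \<eta> = 0"
  shows "(1 + s k * norm \<theta>) ^ n * cmod (LINT \<eta>|lborel. G \<eta> * cis (\<theta> \<bullet> \<eta>)) \<le>
    (real CARD('b) + 1) ^ (n + 1) * (C * (unit_ball_vol (real CARD('b)) * R1 ^ CARD('b))) * s k ^ CARD('b)"
proof -
  have sub: "bump_carrier k \<subseteq> cball 0 (norm (\<xi> k) + R1 * s k)"
  proof
    fix \<eta> assume "\<eta> \<in> bump_carrier k"
    then have "norm (\<eta> - \<xi> k) < R1 * s k" using bump_carrier_region[of k] by (auto simp: dist_norm norm_minus_commute)
    then show "\<eta> \<in> cball 0 (norm (\<xi> k) + R1 * s k)" using norm_triangle_ineq[of "\<xi> k" "\<eta> - \<xi> k"] by simp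
  qed
  have "measure lborel (bump_carrier k) \<le> measure lborel (region k)"
    by (rule measure_mono_fmeasurable[OF bump_carrier_region])
       (use emeasure_bounded_finite[of "region k"] bump_carrier_closed in \<open>auto intro!: fmeasurableI borel_closed\<close>)
  also have "\<dots> = unit_ball_vol (real CARD('b)) * R1 ^ CARD('b) * s k ^ CARD('b)"
    using R1 s_pos[of k] by (simp add: content_ball power_mult_distrib)
  finally have vol: "measure lborel (bump_carrier k) \<le> unit_ball_vol (real CARD('b)) * R1 ^ CARD('b) * s k ^ CARD('b)" .
  have "(1 + s k * norm \<theta>) ^ n * cmod (LINT \<eta>|lborel. G \<eta> * cis (\<theta> \<bullet> \<eta>)) \<le> (real CARD('b) + 1) ^ (n + 1) * (C * measure lborel (bump_carrier k))"
    by (rule oscillatory_integral_decay[OF s_pos C(2,1) m bump_carrier_closed sub supp])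
  also have "\<dots> \<le> (real CARD('b) + 1) ^ (n + 1) * (C * (unit_ball_vol (real CARD('b)) * R1 ^ CARD('b) * s k ^ CARD('b)))"
    using C(1) vol by (intro mult_left_mono) auto
  finally show ?thesis by (simp only: mult.assoc)
qed

text \<open>
  The phases of two packets combine to the single phase \<open>(y - x) \<bullet> \<eta>\<close>.
\<close>

lemma cross_integral_bound:
  assumes C: "0 \<le> C"
    and db: "\<And>k l i. l \<in> neighbours k \<Longrightarrow> dir_bounded UNIV (s k *\<^sub>R axis i 1) n C (\<lambda>\<eta>. bump k \<eta> * (cnj (bump l \<eta>) * g \<eta>))"
    and g: "g \<in> borel_measurable borel"
  shows "\<exists>D\<ge>0. \<forall>k l x y. cmod (LINT \<eta>|lborel. pf (x, \<xi> k) \<eta> * cnj (pf (y, \<xi> l) \<eta>) * g \<eta>) \<le>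
     D * (1 + separation \<alpha> (x, \<xi> k) (y, \<xi> l)) powr (- real n)"
proof -
  define V where "V = (real CARD('b) + 1) ^ (n + 1) * (C * (unit_ball_vol (real CARD('b)) * R1 ^ CARD('b)))"
  have V: "0 \<le> V" using C R1 by (simp add: V_def)
  define Q where "Q = 1 + \<kappa> + \<kappa> * (R1 * (1 + \<kappa>))"
  have Q: "1 \<le> Q" using \<kappa>_ge R1 by (simp add: Q_def)
  let ?h = "real CARD('b) / 2"
  \<comment> \<open>\<open>Q\<close> converts decay in \<open>s k * norm (y - x)\<close> into decay in the separation.\<close>
  define D where "D = \<kappa> powr ?h * V * Q ^ n"
  have D: "0 \<le> D" using V Q by (simp add: D_def)
  show ?thesis
  proof (intro exI[of _ D] conjI allI D)
    fix k l x y
    let ?I = "LINT \<eta>|lborel. pf (x, \<xi> k) \<eta> * cnj (pf (y, \<xi> l) \<eta>) * g \<eta>"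
    let ?S = "1 + separation \<alpha> (x, \<xi> k) (y, \<xi> l)"
    let ?G = "\<lambda>\<eta>. bump k \<eta> * (cnj (bump l \<eta>) * g \<eta>)"
    let ?ck = "s k powr (- ?h)" and ?cl = "s l powr (- ?h)"
    show "cmod ?I \<le> D * ?S powr (- real n)"
    proof (cases "l \<in> neighbours k")
      case False
      have z: "pf (x, \<xi> k) \<eta> * cnj (pf (y, \<xi> l) \<eta>) * g \<eta> = 0" for \<eta>
        using bump_overlap_neighbours[of \<eta> k l] bump_support[of k \<eta>] False by (auto simp: pf_eq)
      have "?I = 0" unfolding z by simp
      then show ?thesis using D by simp
    next
      case True
      have "pf (x, \<xi> k) \<eta> * cnj (pf (y, \<xi> l) \<eta>) * g \<eta> =
          of_real (?ck * ?cl) * cis (x \<bullet> \<xi> k - y \<bullet> \<xi> l) * (?G \<eta> * cis ((y - x) \<bullet> \<eta>))" for \<eta>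
      proof -
        have c: "cis (- (x \<bullet> (\<eta> - \<xi> k))) * cnj (cis (- (y \<bullet> (\<eta> - \<xi> l)))) = cis (x \<bullet> \<xi> k - y \<bullet> \<xi> l) * cis ((y - x) \<bullet> \<eta>)"
          unfolding cis_cnj cis_mult by (rule arg_cong[where f=cis]) (simp add: inner_diff_right inner_diff_left)
        have "pf (x, \<xi> k) \<eta> * cnj (pf (y, \<xi> l) \<eta>) * g \<eta> =
            of_real (?ck * ?cl) * (cis (- (x \<bullet> (\<eta> - \<xi> k))) * cnj (cis (- (y \<bullet> (\<eta> - \<xi> l))))) * ?G \<eta>"
          unfolding pf_eq complex_cnj_mult complex_cnj_complex_of_real of_real_mult by (simp only: mult_ac)
        then show ?thesis unfolding c by (simp only: mult_ac)
      qed
      then have "?I = of_real (?ck * ?cl) * cis (x \<bullet> \<xi> k - y \<bullet> \<xi> l) * (LINT \<eta>|lborel. ?G \<eta> * cis ((y - x) \<bullet> \<eta>))"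
        by (simp only: integral_mult_right_zero)
      then have I: "cmod ?I = ?ck * ?cl * cmod (LINT \<eta>|lborel. ?G \<eta> * cis ((y - x) \<bullet> \<eta>))"
        by (simp add: norm_mult)
      let ?t = "1 + s k * norm (y - x)"
      have t: "1 \<le> ?t" using s_pos[of k] by simp
      have osc: "?t ^ n * cmod (LINT \<eta>|lborel. ?G \<eta> * cis ((y - x) \<bullet> \<eta>)) \<le> V * s k ^ CARD('b)"
        unfolding V_def
      proof (rule oscillatory_bound[OF C db[OF True]])
        show "?G \<in> borel_measurable borel" using g by measurable
        show "?G \<eta> = 0" if "\<eta> \<notin> bump_carrier k" for \<eta> using bump_carrier_off[OF that] by simp
      qed
      have "?t ^ n * cmod ?I = ?ck * ?cl * (?t ^ n * cmod (LINT \<eta>|lborel. ?G \<eta> * cis ((y - x) \<bullet> \<eta>)))"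
        unfolding I by (simp only: mult_ac)
      also have "\<dots> \<le> ?ck * ?cl * (V * s k ^ CARD('b))" by (intro mult_left_mono osc) auto
      also have "\<dots> = V * (?ck * ?cl * s k ^ CARD('b))" by (simp only: mult_ac)
      also have "\<dots> \<le> V * \<kappa> powr ?h" by (intro mult_left_mono amplitude_bound True V)
      finally have tI: "?t ^ n * cmod ?I \<le> V * \<kappa> powr ?h" .
      have S1: "1 \<le> ?S" unfolding separation_def by simp
      have "?S \<le> Q * ?t" unfolding Q_def by (rule separation_bound[OF True])
      then have "?S ^ n \<le> (Q * ?t) ^ n" using S1 by (intro power_mono) auto
      then have "?S ^ n * cmod ?I \<le> (Q * ?t) ^ n * cmod ?I" by (intro mult_right_mono) auto
      also have "\<dots> = Q ^ n * (?t ^ n * cmod ?I)" by (simp add: power_mult_distrib mult.assoc)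
      also have "\<dots> \<le> Q ^ n * (V * \<kappa> powr ?h)" using Q tI by (intro mult_left_mono) auto
      also have "\<dots> = D" by (simp add: D_def)
      finally have "cmod ?I * ?S ^ n \<le> D" by (simp add: mult.commute)
      then have "cmod ?I \<le> D / ?S ^ n" using S1 by (simp add: pos_le_divide_eq)
      also have "\<dots> = D * ?S powr (- real n)" using S1 by (simp add: powr_minus powr_realpow divide_inverse)
      finally show ?thesis .
    qed
  qed
qed

theorem intrinsic_localization:
  assumes N: "0 < N"
  shows "\<exists>C. \<forall>w\<in>lattice. \<forall>z\<in>lattice.
    cmod (l2_inner (dual w) (dual z)) + cmod (l2_inner (dual w) (\<psi> z)) \<le> C * (1 + separation \<alpha> w z) powr (- N)"
proof -
  define n where "n = nat \<lceil>N\<rceil>"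
  have n: "N \<le> real n" unfolding n_def using N by linarith
  let ?g = "\<lambda>\<eta>. inverse (complex_of_real (symbol \<eta>))"
  obtain C where C: "0 \<le> C"
    and db: "\<And>k l i. l \<in> neighbours k \<Longrightarrow> dir_bounded UNIV (s k *\<^sub>R axis i 1) n C (\<lambda>\<eta>. bump k \<eta> * (cnj (bump l \<eta>) * ?g \<eta>))"
      "\<And>k l i. l \<in> neighbours k \<Longrightarrow> dir_bounded UNIV (s k *\<^sub>R axis i 1) n C (\<lambda>\<eta>. bump k \<eta> * (cnj (bump l \<eta>) * (?g \<eta> * ?g \<eta>)))"
    using cross_term_dir_bounded[of n] by blast
  have gm: "?g \<in> borel_measurable borel" "(\<lambda>\<eta>. ?g \<eta> * ?g \<eta>) \<in> borel_measurable borel" by measurable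
  obtain D1 where D1: "0 \<le> D1" "\<And>k l x y. cmod (LINT \<eta>|lborel. pf (x, \<xi> k) \<eta> * cnj (pf (y, \<xi> l) \<eta>) * ?g \<eta>) \<le>
     D1 * (1 + separation \<alpha> (x, \<xi> k) (y, \<xi> l)) powr (- real n)"
    using cross_integral_bound[OF C db(1) gm(1)] by blast
  obtain D2 where D2: "0 \<le> D2" "\<And>k l x y. cmod (LINT \<eta>|lborel. pf (x, \<xi> k) \<eta> * cnj (pf (y, \<xi> l) \<eta>) * (?g \<eta> * ?g \<eta>)) \<le>
     D2 * (1 + separation \<alpha> (x, \<xi> k) (y, \<xi> l)) powr (- real n)"
    using cross_integral_bound[OF C db(2) gm(2)] by blast
  show ?thesis
  proof (intro exI[of _ "(D2 + D1) / ft_const"] ballI)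
    fix w z assume w: "w \<in> lattice" and z: "z \<in> lattice"
    obtain x k where wk: "w = (x, \<xi> k)" using w by (rule lattice_memE)
    obtain y l where zl: "z = (y, \<xi> l)" using z by (rule lattice_memE)
    let ?S = "1 + separation \<alpha> w z"
    have S1: "1 \<le> ?S" unfolding separation_def by simp
    have "ft_const * cmod (l2_inner (dual w) (dual z)) = cmod (l2_inner (dual_ft w) (dual_ft z))"
      unfolding dual_dual_inner[OF w z, symmetric] by (simp add: norm_mult)
    also have "l2_inner (dual_ft w) (dual_ft z) = (LINT \<eta>|lborel. pf (x, \<xi> k) \<eta> * cnj (pf (y, \<xi> l) \<eta>) * (?g \<eta> * ?g \<eta>))"
      unfolding l2_inner_def dual_ft_def wk zl by (intro Bochner_Integration.integral_cong refl) (simp add: divide_inverse mult_ac)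
    finally have 2: "ft_const * cmod (l2_inner (dual w) (dual z)) \<le> D2 * ?S powr (- real n)"
      using D2(2)[of x k y l] by (simp add: wk zl)
    have "ft_const * cmod (l2_inner (dual w) (\<psi> z)) = cmod (l2_inner (dual_ft w) (pf z))"
      unfolding dual_packet_inner[OF w z, symmetric] by (simp add: norm_mult)
    also have "l2_inner (dual_ft w) (pf z) = (LINT \<eta>|lborel. pf (x, \<xi> k) \<eta> * cnj (pf (y, \<xi> l) \<eta>) * ?g \<eta>)"
      unfolding l2_inner_def dual_ft_def wk zl by (intro Bochner_Integration.integral_cong refl) (simp add: divide_inverse mult_ac)
    finally have 1: "ft_const * cmod (l2_inner (dual w) (\<psi> z)) \<le> D1 * ?S powr (- real n)"
      using D1(2)[of x k y l] by (simp add: wk zl)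
    have "ft_const * (cmod (l2_inner (dual w) (dual z)) + cmod (l2_inner (dual w) (\<psi> z))) \<le> (D2 + D1) * ?S powr (- real n)"
      using 1 2 by (simp add: distrib_left distrib_right)
    also have "\<dots> \<le> (D2 + D1) * ?S powr (- N)"
      using D1(1) D2(1) n S1 by (intro mult_left_mono powr_mono) auto
    finally show "cmod (l2_inner (dual w) (dual z)) + cmod (l2_inner (dual w) (\<psi> z)) \<le> (D2 + D1) / ft_const * ?S powr (- N)"
      by (simp add: pos_le_divide_eq mult.commute)
  qed
qed

end

lemma frame_with_bounds_mono: "frame_with_bounds A B W \<psi> \<Longrightarrow> B \<le> B' \<Longrightarrow> frame_with_bounds A B' W \<psi>"
  unfolding frame_with_bounds_def by (meson mult_right_mono order_trans zero_le_power2)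

text \<open>
  The scale at \<open>\<zeta>\<close> is at least \<open>2 powr (- max (\<alpha> - 1) 0)\<close>, so \<open>R0\<close> times the scale is at least 3, whereas
  the distance is less than \<open>1 + 2\<close>.
\<close>

lemma low_frequencies_covered:
  assumes "\<alpha> > 0" "1 \<le> norm \<zeta>" "norm \<zeta> < 2" "norm \<eta> < 1" "R0 > 3 * 2 powr (max (\<alpha> - 1) 0)"
  shows "norm (\<eta> - \<zeta>) \<le> R0 * fscale \<alpha> \<zeta>"
proof -
  have s: "2 powr (- max (\<alpha> - 1) 0) \<le> fscale \<alpha> \<zeta>"
  proof (cases "\<alpha> \<le> 1")
    case True
    then show ?thesis using assms(2) by (simp add: fscale_def max_def ge_one_powr_ge_zero)
  next
    case False
    then have "2 powr (1 - \<alpha>) \<le> norm \<zeta> powr (1 - \<alpha>)" using assms by (intro powr_mono2') auto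
    then show ?thesis using False by (simp add: fscale_def max_def)
  qed
  have "3 = 3 * 2 powr (max (\<alpha> - 1) 0) * 2 powr (- max (\<alpha> - 1) 0)" by (simp add: mult.assoc flip: powr_add)
  also have "\<dots> \<le> R0 * fscale \<alpha> \<zeta>"
    using s assms(5) by (intro mult_mono) (auto intro: order_trans[OF _ less_imp_le[OF assms(5)]])
  finally show ?thesis using norm_triangle_ineq4[of \<eta> \<zeta>] assms by simp
qed

lemma fourier_zero: "fourier f 0 = (LINT t|lborel. f t)"
  by (simp add: fourier_def)

lemma lattice_eq_subdyadic:
  assumes "painless_system \<alpha> (b * \<rho>) R1 m0 R0 q \<xi> \<phi>h \<delta> Cb"
  shows "painless_system.lattice \<alpha> (b * \<rho>) \<xi> = subdyadic_lattice \<alpha> b \<rho> \<xi>"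
proof -
  interpret painless_system \<alpha> "b * \<rho>" R1 m0 R0 q \<xi> \<phi>h \<delta> Cb by fact
  have "spatial_node \<alpha> b \<rho> (\<xi> k) j = node k j" for k j
    using powr_minus_divide[of "norm (\<xi> k)" "1 - \<alpha>"] by (simp add: spatial_node_def ivec_def fscale_def)
  then show ?thesis unfolding lattice_def subdyadic_lattice_def by auto
qed

definition localized_frame ::
  "real \<Rightarrow> real \<Rightarrow> real \<Rightarrow> ((real^'d::finite) \<times> (real^'d)) set \<Rightarrow> ((real^'d) \<times> (real^'d) \<Rightarrow> real^'d \<Rightarrow> complex) \<Rightarrow> bool" where
  "localized_frame \<alpha> A B W \<psi> \<longleftrightarrow> frame_with_bounds A B W \<psi> \<and>
     (\<exists>\<psi>d. canonical_dual W \<psi> \<psi>d \<and>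
       (\<forall>N::real. N > 0 \<longrightarrow> (\<exists>C. \<forall>w\<in>W. \<forall>z\<in>W.
          cmod (l2_inner (\<psi>d w) (\<psi>d z)) + cmod (l2_inner (\<psi>d w) (\<psi> z)) \<le> C * (1 + separation \<alpha> w z) powr (- N))) \<and>
       (\<forall>f\<in>L2. l2_has_sum (\<lambda>w t. l2_inner f (\<psi> w) * \<psi>d w t) W f))"

theorem proposition3p5:
  fixes \<alpha> :: real
  assumes "\<alpha> > 0"
  shows "\<exists>a0>0. \<exists>r0>0. \<forall>a \<rho>0 b. 0 < a \<and> a \<le> a0 \<and> 0 < \<rho>0 \<and> \<rho>0 \<le> r0 \<and> 0 < b \<longrightarrow>
    (\<exists>Acov>1. \<exists>M::nat.
      (\<forall>\<rho> (\<xi> :: nat \<Rightarrow> real^'d::finite). 0 < \<rho> \<and> \<rho> \<le> \<rho>0 \<and> subdyadic_frequencies \<alpha> a \<rho> \<xi> \<longrightarrow>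
         {\<eta>. 1 \<le> norm \<eta>} \<subseteq> (\<Union>k. frequency_ball \<alpha> Acov \<rho> \<xi> k) \<and>
         (\<forall>\<eta>. finite {k. \<eta> \<in> frequency_ball \<alpha> Acov \<rho> \<xi> k} \<and>
              card {k. \<eta> \<in> frequency_ball \<alpha> Acov \<rho> \<xi> k} \<le> M)) \<and>
      (\<forall>(\<phi> :: real^'d \<Rightarrow> real) \<phi>h R0 R1 m0.
         schwartz \<phi> \<and> (\<forall>t. \<phi> (- t) = \<phi> t) \<and> l2_norm (\<lambda>t. complex_of_real (\<phi> t)) = 1 \<and>
         \<phi>h = fourier (\<lambda>t. complex_of_real (\<phi> t)) \<and> smooth_compact_support \<phi>h \<and>
         0 < R0 \<and> R0 < R1 \<and> 0 < m0 \<and> R0 > 3 * 2 powr (max (\<alpha> - 1) 0) \<and>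
         supp \<phi>h \<subseteq> ball 0 R1 \<and> (\<forall>\<zeta>. norm \<zeta> \<le> R0 \<longrightarrow> cmod (\<phi>h \<zeta>) \<ge> m0) \<longrightarrow>
         (\<exists>\<rho>s. 0 < \<rho>s \<and> \<rho>s \<le> \<rho>0 \<and>
           (\<exists>A B. 0 < A \<and> A \<le> B \<and>
             (\<forall>(\<xi> :: nat \<Rightarrow> real^'d) W \<psi>.
                subdyadic_frequencies \<alpha> a \<rho>s \<xi> \<and>
                W = subdyadic_lattice \<alpha> b \<rho>s \<xi> \<and> \<psi> = wave_packet \<alpha> \<phi> \<longrightarrow>
                frame_with_bounds A B W \<psi> \<and>
                (\<exists>\<psi>d. canonical_dual W \<psi> \<psi>d \<and>
                   (\<forall>N::real. N > 0 \<longrightarrow> (\<exists>C. \<forall>w\<in>W. \<forall>z\<in>W.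
                      cmod (l2_inner (\<psi>d w) (\<psi>d z)) + cmod (l2_inner (\<psi>d w) (\<psi> z))
                        \<le> C * (1 + separation \<alpha> w z) powr (- N))) \<and>
                   (\<forall>f\<in>L2. l2_has_sum (\<lambda>w t. l2_inner f (\<psi> w) * \<psi>d w t) W f)))))))"
proof (rule exI[of _ 1], rule conjI, simp, rule exI[of _ 1], rule conjI, simp, intro allI impI, elim conjE, goal_cases)
  case (1 a \<rho>0 b)
  then have a: "0 < a" "a \<le> 1" and \<rho>0: "0 < \<rho>0" "\<rho>0 \<le> 1" and b: "0 < b" by simp_all
  define Acov where "Acov = real CARD('d) * (scale_ratio \<alpha> 1)\<^sup>2 + scale_ratio \<alpha> 1 + 1"
  have sr: "1 \<le> scale_ratio \<alpha> 1" by (rule scale_ratio_ge) simp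
  have Acov: "1 < Acov" using sr by (simp add: Acov_def add_nonneg_pos)
  have a\<rho>: "a * \<rho> \<le> 1" if "0 < \<rho>" "\<rho> \<le> \<rho>0" for \<rho>
    using mult_mono[of a 1 \<rho> 1] a \<rho>0 that by simp
  note sep = subdyadic_separated[OF assms a(1) _ a\<rho> a(2)]
    and cov = subdyadic_covering[where 'd='d, OF assms a(1) _ a\<rho> a(2), folded Acov_def]
    and low = subdyadic_low_frequency[OF assms a(1) _ a\<rho> a(2)]
  show ?case
  proof (rule exI[of _ Acov], rule conjI[OF Acov], rule exI[of _ "overlap_bound TYPE(real^'d) \<alpha> (Acov / a) (Acov * \<rho>0)"],
      (intro conjI allI impI; (elim conjE)?), goal_cases)
    fix \<rho> and \<xi> :: "nat \<Rightarrow> real^'d"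
    assume \<rho>: "0 < \<rho>" "\<rho> \<le> \<rho>0" and sf: "subdyadic_frequencies \<alpha> a \<rho> \<xi>"
    show "{\<eta>. 1 \<le> norm \<eta>} \<subseteq> (\<Union>k. frequency_ball \<alpha> Acov \<rho> \<xi> k)"
    proof
      fix \<eta> :: "real^'d" assume "\<eta> \<in> {\<eta>. 1 \<le> norm \<eta>}"
      then obtain k where "norm (\<eta> - \<xi> k) \<le> Acov * \<rho> * fscale \<alpha> (\<xi> k)" using cov[OF \<rho>(1) \<rho> sf, of \<eta>] by auto
      then have "\<eta> \<in> frequency_ball \<alpha> Acov \<rho> \<xi> k"
        by (simp add: frequency_ball_def fscale_def dist_norm norm_minus_commute)
      then show "\<eta> \<in> (\<Union>k. frequency_ball \<alpha> Acov \<rho> \<xi> k)" by blast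
    qed
  next
    fix \<rho> and \<xi> :: "nat \<Rightarrow> real^'d" and \<eta>
    assume \<rho>: "0 < \<rho>" "\<rho> \<le> \<rho>0" and sf: "subdyadic_frequencies \<alpha> a \<rho> \<xi>"
    have "0 < a * \<rho>" using a \<rho> by simp
    have "\<eta> \<in> frequency_ball \<alpha> Acov \<rho> \<xi> k \<longleftrightarrow> norm (\<eta> - \<xi> k) \<le> (Acov * \<rho>) * fscale \<alpha> (\<xi> k)" for k
      by (simp add: frequency_ball_def fscale_def dist_norm norm_minus_commute)
    moreover have "finite {k. norm (\<eta> - \<xi> k) \<le> (Acov * \<rho>) * fscale \<alpha> (\<xi> k)} \<and>
      card {k. norm (\<eta> - \<xi> k) \<le> (Acov * \<rho>) * fscale \<alpha> (\<xi> k)} \<le> overlap_bound TYPE(real^'d) \<alpha> (Acov / a) (Acov * \<rho>0)"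
      using Acov \<rho> a by (intro bounded_overlap[OF assms \<open>0 < a * \<rho>\<close> sep[OF \<rho>(1) \<rho> sf]]) auto
    ultimately show "finite {k. \<eta> \<in> frequency_ball \<alpha> Acov \<rho> \<xi> k}"
      "card {k. \<eta> \<in> frequency_ball \<alpha> Acov \<rho> \<xi> k} \<le> overlap_bound TYPE(real^'d) \<alpha> (Acov / a) (Acov * \<rho>0)"
      by simp_all
  next
    case (4 \<phi> \<phi>h R0 R1 m0)
    then have norm1: "l2_norm (\<lambda>t. complex_of_real (\<phi> t)) = 1"
      and \<phi>h: "\<phi>h = fourier (\<lambda>t. complex_of_real (\<phi> t))" and smooth: "smooth_compact_support \<phi>h"
      and R: "0 < R0" "R0 < R1" and m0: "0 < m0" and R0: "R0 > 3 * 2 powr (max (\<alpha> - 1) 0)"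
      and supp: "supp \<phi>h \<subseteq> ball 0 R1" and lower: "\<forall>\<zeta>. norm \<zeta> \<le> R0 \<longrightarrow> cmod (\<phi>h \<zeta>) \<ge> m0"
      by auto
    let ?f = "\<lambda>t. complex_of_real (\<phi> t)"
    \<comment> \<open>The integral of a function that is not integrable is 0, so a nonzero integral proves
      integrability: \<open>\<phi>h 0\<close> is the integral of \<open>\<phi>\<close>, and the norm of \<open>\<phi>\<close> is 1.\<close>
    have "\<phi>h 0 \<noteq> 0" using lower[rule_format, of 0] R m0 by auto
    then have int: "integrable lborel ?f" using not_integrable_integral_eq[of lborel ?f] by (auto simp: \<phi>h fourier_zero)
    have "(LINT t|lborel. (cmod (?f t))\<^sup>2) \<noteq> 0" using norm1 by (auto simp: l2_norm_def)
    then have "integrable lborel (\<lambda>t. (cmod (?f t))\<^sup>2)" using not_integrable_integral_eq by blast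
    then have \<phi>: "?f \<in> L1L2" using int by (auto simp: L1L2_def intro!: L2_I)
    have meas: "\<phi>h \<in> borel_measurable borel" unfolding \<phi>h using int by (intro fourier_measurable) auto
    obtain Cb where Cb: "\<And>\<zeta>. cmod (\<phi>h \<zeta>) \<le> Cb"
      using smooth_compact_support_uniform[OF smooth, of 0] by auto
    \<comment> \<open>The second bound makes the balls of radius \<open>R0 * s k\<close> cover, the third is the painless condition.\<close>
    define \<rho>s where "\<rho>s = min \<rho>0 (min (R0 / Acov) (pi / (2 * b * R1)))"
    have R1: "0 < R1" using R by simp
    have \<rho>s: "0 < \<rho>s" "\<rho>s \<le> \<rho>0" "\<rho>s \<le> R0 / Acov" "\<rho>s \<le> pi / (2 * b * R1)"
      using \<rho>0 R Acov b R1 by (auto simp: \<rho>s_def)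
    \<comment> \<open>The constants are fixed before any choice of frequencies; \<open>max A B\<close> below is the upper bound
      because \<open>A \<le> B\<close> would itself need a system of frequencies.\<close>
    define q where "q = R1 / (a * \<rho>s)"
    define A where "A = (1 / (b * \<rho>s)) ^ CARD('d) * m0\<^sup>2"
    define B where "B = (1 / (b * \<rho>s)) ^ CARD('d) * (real (overlap_bound TYPE(real^'d) \<alpha> q R1) * Cb\<^sup>2)"
    have A: "0 < A" using b \<rho>s m0 by (simp add: A_def)
    have main: "localized_frame \<alpha> A (max A B) (subdyadic_lattice \<alpha> b \<rho>s \<xi>) (wave_packet \<alpha> \<phi>)"
      if sf: "subdyadic_frequencies \<alpha> a \<rho>s \<xi>" for \<xi> :: "nat \<Rightarrow> real^'d"
    proof -
      note sepx = sep[OF \<rho>s(1) \<rho>s(1,2) sf]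
      have n1: "1 \<le> norm (\<xi> k)" for k using sepx by (simp add: separated_frequencies_def)
      have cover: "\<exists>k. norm (\<eta> - \<xi> k) \<le> R0 * fscale \<alpha> (\<xi> k)" for \<eta>
      proof (cases "1 \<le> norm \<eta>")
        case True
        obtain k where k: "norm (\<eta> - \<xi> k) \<le> Acov * \<rho>s * fscale \<alpha> (\<xi> k)" using cov[OF \<rho>s(1) \<rho>s(1,2) sf True] by blast
        have "Acov * \<rho>s \<le> R0" using \<rho>s(3) Acov by (simp add: pos_le_divide_eq mult.commute)
        then have "Acov * \<rho>s * fscale \<alpha> (\<xi> k) \<le> R0 * fscale \<alpha> (\<xi> k)" using fscale_pos[OF n1[of k], of \<alpha>] by (intro mult_right_mono) auto
        then show ?thesis using k by (intro exI[of _ k]) linarith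
      next
        case False
        obtain k where "norm (\<xi> k) < 2" using low[OF \<rho>s(1) \<rho>s(1,2) sf] by blast
        then show ?thesis using low_frequencies_covered[OF assms n1[of k] _ _ R0, of \<eta>] False by (intro exI[of _ k]) simp
      qed
      have R1\<beta>: "R1 * (b * \<rho>s) < pi"
      proof -
        have "R1 * (b * \<rho>s) \<le> R1 * (b * (pi / (2 * b * R1)))" using \<rho>s(4) R1 b by (intro mult_left_mono) auto
        also have "\<dots> = pi / 2" using R1 b by simp
        also have "\<dots> < pi" using pi_gt_zero by linarith
        finally show ?thesis .
      qed
      interpret painless_frame \<alpha> "b * \<rho>s" R1 m0 R0 q \<xi> \<phi>h "a * \<rho>s" Cb \<phi>
        by unfold_locales
           (use assms b \<rho>s R1 m0 R1\<beta> a sepx cover smooth supp lower Cb meas \<phi> \<phi>h in \<open>auto simp: q_def\<close>)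
      have lat: "lattice = subdyadic_lattice \<alpha> b \<rho>s \<xi>"
        by (rule lattice_eq_subdyadic[OF painless_system_axioms])
      have AB: "m_min = A" "m_max = B" by (simp_all add: m_min_def m_max_def overlap_def A_def B_def)
      have "frame_with_bounds A (max A B) (subdyadic_lattice \<alpha> b \<rho>s \<xi>) (wave_packet \<alpha> \<phi>)"
        using packets_frame unfolding lat AB by (rule frame_with_bounds_mono) simp
      moreover note dual_canonical[unfolded lat] intrinsic_localization[unfolded lat] reconstruction[unfolded lat]
      ultimately show ?thesis unfolding localized_frame_def by blast
    qed
    show ?case
    proof (rule exI[of _ \<rho>s], intro conjI \<rho>s(1,2), rule exI[of _ A], rule exI[of _ "max A B"], rule conjI[OF A],
        rule conjI[OF max.cobounded1], intro allI impI, elim conjE, goal_cases)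
      case (1 \<xi> W \<psi>)
      show ?case unfolding 1(2,3) by (rule main[OF 1(1), unfolded localized_frame_def])
    qed
  qed
qed

end
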